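(* Let $1\le p<\infty$, $0\le s<1$ and $x_0\in\mathbf{R}^n$. Then $\{x_0\}$ is a set of spectral synthesis for $M^{p,1}_s(\mathbf{R}^n)$.
   Context: $\langle \xi\rangle=(1+|\xi|^2)^{1/2}$. For $f\in\mathcal{S}'(\mathbf{R}^n)$ and a window $\phi\in\mathcal{S}(\mathbf{R}^n)\setminus\{0\}$, $V_\phi f(x,\xi)=\int_{\mathbf{R}^n} f(t)\overline{\phi(t-x)}e^{-it\xi}\,dt$ (by duality). The modulation space $X=M^{p,1}_s(\mathbf{R}^n)$ consists of all $f\in\mathcal{S}'(\mathbf{R}^n)$ with $\|f\|_{M^{p,1}_s}=\int\langle\xi\rangle^{s}\big(\int|V_\phi f(x,\xi)|^p\,dx\big)^{1/p}d\xi<\infty$; different windows give equivalent norms. For $s\ge 0$ it consists of continuous functions and is an algebra under (continuous) pointwise multiplication. A linear subspace $I$ of $X$ is an ideal if $fg\in I$ whenever $f\in X$, $g\in I$; it is a closed ideal if moreover it is closed in $X$. The closed ideal generated by $S\subset X$ is the smallest closed ideal of $X$ containing $S$. For a closed set $E\subset\mathbf{R}^n$ let $I(E)=\{f\in X\mid f(x)=0 \text{ for all } x\in E\}$ and let $J(E)$ be the closed ideal in $X$ generated by $J_0(E)=\{f\in X\mid f(x)=0\text{ in a neighborhood of }E\}$. $E$ is called a set of spectral synthesis for $X$ if $I(E)=J(E)$. *)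

theory Defs
  imports "HOL-Analysis.Analysis"
begin

text \<open>
  Schwartz functions.  A list of basis vectors plays the role of a multi-index; requiring every
  iterated partial derivative to be totally differentiable everywhere is smoothness.
\<close>

primrec partial_derivs :: "'a::euclidean_space list \<Rightarrow> ('a \<Rightarrow> complex) \<Rightarrow> 'a \<Rightarrow> complex" where
  "partial_derivs [] f = f"
| "partial_derivs (b # bs) f = (\<lambda>x. frechet_derivative (partial_derivs bs f) (at x) b)"

definition smooth :: "('a::euclidean_space \<Rightarrow> complex) \<Rightarrow> bool" where
  "smooth f \<longleftrightarrow> (\<forall>bs\<in>lists Basis. \<forall>x. partial_derivs bs f differentiable (at x))"

definition schwartz_space :: "('a::euclidean_space \<Rightarrow> complex) set" where
  "schwartz_space = {f. smooth f \<and>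
     (\<forall>k::nat. \<forall>bs\<in>lists Basis. bounded (range (\<lambda>x. (1 + norm x) ^ k *\<^sub>R partial_derivs bs f x)))}"

definition schwartz_seminorm :: "nat \<Rightarrow> nat \<Rightarrow> ('a::euclidean_space \<Rightarrow> complex) \<Rightarrow> real" where
  "schwartz_seminorm k m f =
     (\<Sum>bs\<in>{bs\<in>lists Basis. length bs \<le> m}. SUP x. (1 + norm x) ^ k * norm (partial_derivs bs f x))"

text \<open>
  Tempered distributions are functionals on the Schwartz space only; membership in
  \<^const>\<open>extensional\<close> fixes their (irrelevant) values at other functions, so that equality of
  tempered distributions is equality in HOL.  They are complex-linear, so the distribution
  given by a function pairs with test functions without complex conjugation.
\<close>

definition tempered_distributions :: "(('a::euclidean_space \<Rightarrow> complex) \<Rightarrow> complex) set" where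
  "tempered_distributions = {u \<in> extensional schwartz_space.
     (\<forall>f\<in>schwartz_space. \<forall>g\<in>schwartz_space. u (\<lambda>t. f t + g t) = u f + u g) \<and>
     (\<forall>c. \<forall>f\<in>schwartz_space. u (\<lambda>t. c * f t) = c * u f) \<and>
     (\<exists>C k m. \<forall>f\<in>schwartz_space. norm (u f) \<le> C * schwartz_seminorm k m f)}"

definition distribution_of :: "('a::euclidean_space \<Rightarrow> complex) \<Rightarrow> ('a \<Rightarrow> complex) \<Rightarrow> complex" where
  "distribution_of f = (\<lambda>\<psi>\<in>schwartz_space. \<integral>t. f t * \<psi> t \<partial>lborel)"

definition stft ::
  "('a::euclidean_space \<Rightarrow> complex) \<Rightarrow> (('a \<Rightarrow> complex) \<Rightarrow> complex) \<Rightarrow> 'a \<Rightarrow> 'a \<Rightarrow> complex" where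
  "stft \<phi> u x \<xi> = u (\<lambda>t. cnj (\<phi> (t - x)) * cis (- (t \<bullet> \<xi>)))"

definition japanese_bracket :: "'a::euclidean_space \<Rightarrow> real" where
  "japanese_bracket \<xi> = sqrt (1 + (norm \<xi>)\<^sup>2)"

definition ennreal_powr :: "ennreal \<Rightarrow> real \<Rightarrow> ennreal" where
  "ennreal_powr a r = (if a = \<infinity> then \<infinity> else ennreal (enn2real a powr r))"

text \<open>The norm of the modulation space with indices \<open>p, 1\<close> and weight exponent \<open>s\<close>, for a
  finite exponent \<open>p\<close> and the window \<open>\<phi>\<close>; it is infinite outside of the space.\<close>

definition modulation_norm ::
  "real \<Rightarrow> real \<Rightarrow> ('a::euclidean_space \<Rightarrow> complex) \<Rightarrow> (('a \<Rightarrow> complex) \<Rightarrow> complex) \<Rightarrow> ennreal" where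
  "modulation_norm p s \<phi> u =
     (\<integral>\<^sup>+\<xi>. ennreal (japanese_bracket \<xi> powr s) *
        ennreal_powr (\<integral>\<^sup>+x. ennreal (norm (stft \<phi> u x \<xi>) powr p) \<partial>lborel) (1 / p) \<partial>lborel)"

definition modulation_space ::
  "real \<Rightarrow> real \<Rightarrow> ('a::euclidean_space \<Rightarrow> complex) \<Rightarrow> (('a \<Rightarrow> complex) \<Rightarrow> complex) set" where
  "modulation_space p s \<phi> = {u \<in> tempered_distributions. modulation_norm p s \<phi> u < \<infinity>}"

text \<open>
  For \<open>s \<ge> 0\<close> the modulation space consists of (bounded) continuous functions.  The algebra below
  is the modulation space under the usual identification of a continuous function with the
  distribution it induces.  Integrability is demanded explicitly because the Bochner integral of a
  non-integrable function is 0 by convention.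
\<close>

definition modulation_algebra ::
  "real \<Rightarrow> real \<Rightarrow> ('a::euclidean_space \<Rightarrow> complex) \<Rightarrow> ('a \<Rightarrow> complex) set" where
  "modulation_algebra p s \<phi> = {f. continuous_on UNIV f \<and>
     (\<forall>\<psi>\<in>schwartz_space. integrable lborel (\<lambda>t. f t * \<psi> t)) \<and>
     distribution_of f \<in> modulation_space p s \<phi>}"

definition modulation_algebra_norm ::
  "real \<Rightarrow> real \<Rightarrow> ('a::euclidean_space \<Rightarrow> complex) \<Rightarrow> ('a \<Rightarrow> complex) \<Rightarrow> ennreal" where
  "modulation_algebra_norm p s \<phi> f = modulation_norm p s \<phi> (distribution_of f)"

text \<open>Ideals and spectral synthesis in an algebra \<open>X\<close> of complex-valued functions with norm \<open>N\<close>.\<close>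

definition function_ideal :: "('a \<Rightarrow> complex) set \<Rightarrow> ('a \<Rightarrow> complex) set \<Rightarrow> bool" where
  "function_ideal X I \<longleftrightarrow> I \<subseteq> X \<and>
     (\<lambda>_. 0) \<in> I \<and>
     (\<forall>f\<in>I. \<forall>g\<in>I. (\<lambda>x. f x + g x) \<in> I) \<and>
     (\<forall>c. \<forall>f\<in>I. (\<lambda>x. c * f x) \<in> I) \<and>
     (\<forall>f\<in>X. \<forall>g\<in>I. (\<lambda>x. f x * g x) \<in> I)"

definition norm_closed_in ::
  "('a \<Rightarrow> complex) set \<Rightarrow> (('a \<Rightarrow> complex) \<Rightarrow> ennreal) \<Rightarrow> ('a \<Rightarrow> complex) set \<Rightarrow> bool" where
  "norm_closed_in X N I \<longleftrightarrow> I \<subseteq> X \<and> (\<forall>f\<in>X. (\<forall>\<epsilon>>0. \<exists>g\<in>I. N (\<lambda>x. f x - g x) < \<epsilon>) \<longrightarrow> f \<in> I)"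

definition closed_function_ideal ::
  "('a \<Rightarrow> complex) set \<Rightarrow> (('a \<Rightarrow> complex) \<Rightarrow> ennreal) \<Rightarrow> ('a \<Rightarrow> complex) set \<Rightarrow> bool" where
  "closed_function_ideal X N I \<longleftrightarrow> function_ideal X I \<and> norm_closed_in X N I"

definition closed_ideal_generated ::
  "('a \<Rightarrow> complex) set \<Rightarrow> (('a \<Rightarrow> complex) \<Rightarrow> ennreal) \<Rightarrow> ('a \<Rightarrow> complex) set \<Rightarrow> ('a \<Rightarrow> complex) set" where
  "closed_ideal_generated X N S = \<Inter> {I. closed_function_ideal X N I \<and> S \<subseteq> I}"

definition vanishing_ideal :: "('a \<Rightarrow> complex) set \<Rightarrow> 'a set \<Rightarrow> ('a \<Rightarrow> complex) set" where
  "vanishing_ideal X E = {f\<in>X. \<forall>x\<in>E. f x = 0}"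

definition locally_vanishing ::
  "('a::topological_space \<Rightarrow> complex) set \<Rightarrow> 'a set \<Rightarrow> ('a \<Rightarrow> complex) set" where
  "locally_vanishing X E = {f\<in>X. \<exists>U. open U \<and> E \<subseteq> U \<and> (\<forall>x\<in>U. f x = 0)}"

definition spectral_synthesis_set ::
  "('a::topological_space \<Rightarrow> complex) set \<Rightarrow> (('a \<Rightarrow> complex) \<Rightarrow> ennreal) \<Rightarrow> 'a set \<Rightarrow> bool" where
  "spectral_synthesis_set X N E \<longleftrightarrow> closed E \<and>
     vanishing_ideal X E = closed_ideal_generated X N (locally_vanishing X E)"

end

theory Submission
  imports Defs "HOL-Probability.Probability"
begin

text \<open>Write \<open>V f (x, \<xi>)\<close> for the short-time Fourier transform of \<open>f\<close> with window \<open>\<phi>\<close>, and \<open>x\<^sub>0\<close> for the point.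

  The closed ideal generated by the functions vanishing near \<open>x\<^sub>0\<close> is contained in the vanishing ideal
  of \<open>x\<^sub>0\<close> because the latter is itself a closed ideal: the space is an algebra
  (\<open>modulation_algebra_mult\<close>) and point evaluations are bounded (\<open>point_evaluation_bounded\<close>).
  Conversely let \<open>f\<close> vanish at \<open>x\<^sub>0\<close>, and let \<open>\<tau>\<close> be a compactly supported bump that equals 1 near 0.
  The functions \<open>f (1 - \<tau> ((\<cdot> - x\<^sub>0) / l))\<close> vanish near \<open>x\<^sub>0\<close>, so it is enough that the norm of
  \<open>f \<tau> ((\<cdot> - x\<^sub>0) / l)\<close> tends to 0 with \<open>l\<close> (\<open>localisation_small\<close>).

  Global estimates come from a reproducing formula (\<open>reproducing_formula\<close>). For almost every \<open>y\<close> the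
  function \<open>V f (y, \<cdot>)\<close> is integrable, and Fourier inversion recovers \<open>f(t)\<close> times the conjugate of
  \<open>\<phi>(t - y)\<close> from it; multiplying by \<open>\<phi>(t - y)\<close> and integrating over \<open>y\<close> gives \<open>f(t)\<close>, up to a constant,
  as the integral of \<open>V f (y, \<eta>) \<phi>(t - y) e\<^sup>i\<^sup>t\<^sup>\<eta>\<close>. A Hoelder estimate in \<open>y\<close> bounds \<open>f\<close> uniformly.
  Multiplying the formula by \<open>m\<close> dominates the Fourier transform of \<open>f m\<close> by a superposition of the
  transforms of \<open>m \<phi>(\<cdot> - y)\<close> (\<open>ft_mult_bound\<close>). The Fourier transform of a product of translates of
  smooth rapidly decreasing functions decays in the frequency and in the distances of the translates
  (\<open>ft_product2\<close>, \<open>ft_product3\<close>). Applying \<open>ft_mult_bound\<close> once for \<open>g\<close> and once for \<open>f\<close> therefore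
  dominates \<open>V (f g)\<close> by a convolution of \<open>|V f|\<close> with an integrable kernel, and Minkowski's
  inequality makes \<open>f g\<close> a member of the space.

  Near \<open>x\<^sub>0\<close> the norm is that of a weighted Fourier algebra, whatever \<open>p\<close> is: if \<open>\<chi>\<close> is a bump with value
  1 near \<open>x\<^sub>0\<close>, then \<open>f \<chi>\<close> is the inverse Fourier transform of some \<open>H\<close> for which \<open>(1 + |\<theta>|)\<^sup>s |H(\<theta>)|\<close> is
  integrable (\<open>ft_cut_weighted\<close>), and conversely such an integral bounds the norm of a function cut
  off by \<open>\<chi>\<close> (\<open>mnorm_ift_window\<close>). Since the integral of \<open>H(\<theta>) e\<^sup>i\<^sup>\<theta>\<^sup>x\<close> is 0 at \<open>x = x\<^sub>0\<close>, the localised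
  function is a superposition of the functions \<open>e\<^sup>i\<^sup>\<theta>\<^sup>t\<close>, minus their values at \<open>x\<^sub>0\<close>, times the dilated bump. If \<open>T\<close> is the
  transform of \<open>\<tau>\<close>, the weighted size of such a term is the integral of
  \<open>(1 + |u| / l)\<^sup>s |T(u - l \<theta>) - T(u)|\<close>. For \<open>l |\<theta>| \<le> 1\<close> it is at most a constant times
  \<open>l\<^sup>-\<^sup>s l |\<theta>| = (l |\<theta>|)\<^sup>1\<^sup>-\<^sup>s |\<theta>|\<^sup>s\<close>, and otherwise at most a constant times \<open>(1 + |\<theta>|)\<^sup>s\<close>
  (\<open>dilated_difference_bound\<close>). Because \<open>s < 1\<close> this is dominated by \<open>(1 + |\<theta>|)\<^sup>s\<close> and tends to 0 for
  each \<open>\<theta>\<close>, so dominated convergence finishes the proof.\<close>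

section \<open>Schwartz functions\<close>

lemma one_plus_norm_add_le: "1 + norm (x + y) \<le> (1 + norm x) * (1 + norm (y::'a::real_normed_vector))"
  unfolding distrib_left distrib_right mult_1 mult_1_right
  using norm_triangle_ineq[of x y] mult_nonneg_nonneg[OF norm_ge_zero[of x] norm_ge_zero[of y]]
  by linarith

text \<open>The Schwartz space is the largest set of differentiable, rapidly decreasing functions that is
  closed under partial derivatives. Membership of a function is thus shown by exhibiting a family of
  functions, closed under partial derivatives, that contains it, as in coinduction.\<close>

lemma schwartz_coinduct:
  assumes "f \<in> S"
    and diff: "\<And>g x. g \<in> S \<Longrightarrow> g differentiable (at x)"
    and bdd: "\<And>g k. g \<in> S \<Longrightarrow> bounded (range (\<lambda>x. (1 + norm x) ^ k *\<^sub>R g x))"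
    and deriv: "\<And>g b. g \<in> S \<Longrightarrow> b \<in> Basis \<Longrightarrow> (\<lambda>x. frechet_derivative g (at x) b) \<in> S"
  shows "f \<in> schwartz_space"
proof -
  have "partial_derivs bs f \<in> S" if "bs \<in> lists Basis" for bs
    using that
  proof (induction bs)
    case Nil
    then show ?case using assms(1) by simp
  next
    case (Cons b bs)
    then show ?case using deriv[of "partial_derivs bs f" b] by simp
  qed
  then show ?thesis
    using diff bdd by (auto simp: schwartz_space_def smooth_def)
qed

lemma schwartz_differentiable:
  assumes "f \<in> schwartz_space" shows "f differentiable (at x)"
proof -
  have "partial_derivs [] f differentiable (at x)"
    using assms unfolding schwartz_space_def smooth_def by blast
  then show ?thesis by simp
qed

lemma schwartz_bounded:
  assumes "f \<in> schwartz_space" shows "bounded (range (\<lambda>x. (1 + norm x) ^ k *\<^sub>R f x))"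
proof -
  have "bounded (range (\<lambda>x. (1 + norm x) ^ k *\<^sub>R partial_derivs [] f x))"
    using assms unfolding schwartz_space_def by blast
  then show ?thesis by simp
qed

lemma partial_derivs_append:
  "partial_derivs bs (partial_derivs cs f) = partial_derivs (bs @ cs) f"
  by (induction bs) auto

lemma schwartz_deriv:
  assumes f: "f \<in> schwartz_space" and b: "b \<in> Basis"
  shows "(\<lambda>x. frechet_derivative f (at x) b) \<in> schwartz_space"
proof -
  have "partial_derivs [b] f \<in> schwartz_space"
    unfolding schwartz_space_def smooth_def mem_Collect_eq partial_derivs_append
    using f b by (auto simp: schwartz_space_def smooth_def)
  then show ?thesis by simp
qed

lemma schwartz_linear:
  assumes f: "f \<in> schwartz_space" and g: "g \<in> schwartz_space"
  shows "(\<lambda>x. a * f x + c * g x) \<in> schwartz_space"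
proof (rule schwartz_coinduct
    [where S = "{\<lambda>x. a * f x + c * g x | f g. f \<in> schwartz_space \<and> g \<in> schwartz_space}"])
  show "(\<lambda>x. a * f x + c * g x) \<in> {\<lambda>x. a * f x + c * g x | f g. f \<in> schwartz_space \<and> g \<in> schwartz_space}"
    using f g by blast
next
  fix h :: "'a \<Rightarrow> complex" and x
  assume "h \<in> {\<lambda>x. a * f x + c * g x | f g. f \<in> schwartz_space \<and> g \<in> schwartz_space}"
  then obtain f g where h: "h = (\<lambda>x. a * f x + c * g x)" and fg: "f \<in> schwartz_space" "g \<in> schwartz_space"
    by blast
  show "h differentiable (at x)"
    unfolding h using fg[THEN schwartz_differentiable] by (intro derivative_intros)
next
  fix h :: "'a \<Rightarrow> complex" and k
  assume "h \<in> {\<lambda>x. a * f x + c * g x | f g. f \<in> schwartz_space \<and> g \<in> schwartz_space}"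
  then obtain f g where h: "h = (\<lambda>x. a * f x + c * g x)" and fg: "f \<in> schwartz_space" "g \<in> schwartz_space"
    by blast
  from schwartz_bounded[OF fg(1), of k] obtain A where A: "\<And>x. norm ((1 + norm x) ^ k *\<^sub>R f x) \<le> A"
    by (auto simp: bounded_iff)
  from schwartz_bounded[OF fg(2), of k] obtain B where B: "\<And>x. norm ((1 + norm x) ^ k *\<^sub>R g x) \<le> B"
    by (auto simp: bounded_iff)
  have "norm ((1 + norm x) ^ k *\<^sub>R h x) \<le> norm a * A + norm c * B" for x
  proof -
    have "(1 + norm x) ^ k *\<^sub>R h x = a * ((1 + norm x) ^ k *\<^sub>R f x) + c * ((1 + norm x) ^ k *\<^sub>R g x)"
      by (simp add: h scaleR_conv_of_real algebra_simps)
    also have "norm \<dots> \<le> norm a * norm ((1 + norm x) ^ k *\<^sub>R f x) + norm c * norm ((1 + norm x) ^ k *\<^sub>R g x)"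
      by (metis norm_mult norm_triangle_ineq)
    also have "\<dots> \<le> norm a * A + norm c * B"
      using A[of x] B[of x] by (intro add_mono mult_left_mono) auto
    finally show ?thesis .
  qed
  then show "bounded (range (\<lambda>x. (1 + norm x) ^ k *\<^sub>R h x))"
    unfolding bounded_iff by blast
next
  fix h :: "'a \<Rightarrow> complex" and b :: 'a
  assume b: "b \<in> Basis"
  assume "h \<in> {\<lambda>x. a * f x + c * g x | f g. f \<in> schwartz_space \<and> g \<in> schwartz_space}"
  then obtain f g where h: "h = (\<lambda>x. a * f x + c * g x)" and fg: "f \<in> schwartz_space" "g \<in> schwartz_space"
    by blast
  have "(h has_derivative (\<lambda>t. a * frechet_derivative f (at x) t + c * frechet_derivative g (at x) t)) (at x)" for x
    unfolding h
    using fg[THEN schwartz_differentiable, THEN frechet_derivative_works[THEN iffD1]]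
    by (auto intro!: derivative_eq_intros)
  from frechet_derivative_at[OF this]
  have "(\<lambda>x. frechet_derivative h (at x) b) =
    (\<lambda>x. a * frechet_derivative f (at x) b + c * frechet_derivative g (at x) b)"
    by (simp add: fun_eq_iff)
  then show "(\<lambda>x. frechet_derivative h (at x) b) \<in> {\<lambda>x. a * f x + c * g x | f g. f \<in> schwartz_space \<and> g \<in> schwartz_space}"
    using schwartz_deriv[OF fg(1) b] schwartz_deriv[OF fg(2) b]
    by (intro CollectI exI[of _ "\<lambda>x. frechet_derivative f (at x) b"]
        exI[of _ "\<lambda>x. frechet_derivative g (at x) b"]) simp
qed

text \<open>The functions against which a distribution is tested in its short-time Fourier transform. They form
  a closed family because the derivative of the exponential only adds a multiple of the function
  itself: each partial derivative is again a time-frequency shift, by the same \<open>x\<close> and \<open>\<xi>\<close>, of a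
  Schwartz function.\<close>

lemma schwartz_time_frequency_shift:
  assumes f: "f \<in> schwartz_space"
  shows "(\<lambda>t. cnj (f (t - x)) * cis (- (t \<bullet> \<xi>))) \<in> schwartz_space"
proof (rule schwartz_coinduct
    [where S = "{\<lambda>t. cnj (f (t - x)) * cis (- (t \<bullet> \<xi>)) | f. f \<in> schwartz_space}"])
  let ?S = "{\<lambda>t. cnj (f (t - x)) * cis (- (t \<bullet> \<xi>)) | f. f \<in> schwartz_space}"
  show "(\<lambda>t. cnj (f (t - x)) * cis (- (t \<bullet> \<xi>))) \<in> ?S"
    using f by blast
  have der: "((\<lambda>t. cnj (f (t - x)) * cis (- (t \<bullet> \<xi>))) has_derivative
      (\<lambda>u. cnj (frechet_derivative f (at (t - x)) u + \<i> * (u \<bullet> \<xi>) * f (t - x)) * cis (- (t \<bullet> \<xi>)))) (at t)"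
    if f: "f \<in> schwartz_space" for f t
  proof -
    have "((\<lambda>t. f (t - x)) has_derivative (\<lambda>u. frechet_derivative f (at (t - x)) u)) (at t)"
    proof -
      have "(f has_derivative frechet_derivative f (at (t - x))) (at (t - x))"
        using schwartz_differentiable[OF f] frechet_derivative_works by blast
      moreover have "((\<lambda>t. t - x) has_derivative (\<lambda>u. u)) (at t)"
        by (auto intro!: derivative_eq_intros)
      ultimately have "((f \<circ> (\<lambda>t. t - x)) has_derivative (frechet_derivative f (at (t - x)) \<circ> (\<lambda>u. u))) (at t)"
        using diff_chain_at[of "\<lambda>t. t - x" "\<lambda>u. u" t f] by blast
      then show ?thesis by (simp add: o_def)
    qed
    from has_derivative_cnj[OF this]
    have 1: "((\<lambda>t. cnj (f (t - x))) has_derivative (\<lambda>u. cnj (frechet_derivative f (at (t - x)) u))) (at t)" .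
    have 2: "((\<lambda>t. cis (- (t \<bullet> \<xi>))) has_derivative (\<lambda>u. - (\<i> * (u \<bullet> \<xi>)) * cis (- (t \<bullet> \<xi>)))) (at t)"
    proof -
      have "((\<lambda>t. - (\<i> * of_real (t \<bullet> \<xi>))) has_derivative (\<lambda>u. - (\<i> * of_real (u \<bullet> \<xi>)))) (at t)"
        by (auto intro!: derivative_eq_intros)
      from has_derivative_compose[OF this DERIV_exp[unfolded has_field_derivative_def]] show ?thesis
        by (simp add: cis_conv_exp mult.commute)
    qed
    show ?thesis
      using has_derivative_mult[OF 1 2] by (simp add: algebra_simps)
  qed
  fix h :: "'a \<Rightarrow> complex"
  assume "h \<in> ?S"
  then obtain f where h: "h = (\<lambda>t. cnj (f (t - x)) * cis (- (t \<bullet> \<xi>)))" and f: "f \<in> schwartz_space"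
    by blast
  show "h differentiable (at t)" for t
    unfolding h using der[OF f] by (rule differentiableI)
  show "bounded (range (\<lambda>t. (1 + norm t) ^ k *\<^sub>R h t))" for k
  proof -
    from schwartz_bounded[OF f, of k] obtain A where A: "\<And>x. norm ((1 + norm x) ^ k *\<^sub>R f x) \<le> A"
      by (auto simp: bounded_iff)
    have "norm ((1 + norm t) ^ k *\<^sub>R h t) \<le> (1 + norm x) ^ k * A" for t
    proof -
      have "1 + norm t \<le> (1 + norm x) * (1 + norm (t - x))"
        using one_plus_norm_add_le[of x "t - x"] by simp
      then have "(1 + norm t) ^ k \<le> (1 + norm x) ^ k * (1 + norm (t - x)) ^ k"
        by (metis power_mono power_mult_distrib add_nonneg_nonneg norm_ge_zero zero_le_one)
      then have "(1 + norm t) ^ k * norm (f (t - x)) \<le> (1 + norm x) ^ k * ((1 + norm (t - x)) ^ k * norm (f (t - x)))"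
        by (metis mult.assoc mult_right_mono norm_ge_zero)
      also have "\<dots> \<le> (1 + norm x) ^ k * A"
        using A[of "t - x"] by (intro mult_left_mono) auto
      finally show ?thesis by (simp add: h norm_mult)
    qed
    then show ?thesis unfolding bounded_iff by blast
  qed
  show "(\<lambda>t. frechet_derivative h (at t) b) \<in> ?S" if b: "b \<in> Basis" for b
  proof -
    let ?g = "\<lambda>t. 1 * frechet_derivative f (at t) b + \<i> * (b \<bullet> \<xi>) * f t"
    have "?g \<in> schwartz_space"
      using schwartz_linear[OF schwartz_deriv[OF f b] f] .
    moreover have "(\<lambda>t. frechet_derivative h (at t) b) = (\<lambda>t. cnj (?g (t - x)) * cis (- (t \<bullet> \<xi>)))"
      using frechet_derivative_at[OF der[OF f], symmetric] by (simp add: h fun_eq_iff)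
    ultimately show ?thesis
      by (intro CollectI exI[of _ ?g]) simp
  qed
qed

lemma schwartz_continuous: "f \<in> schwartz_space \<Longrightarrow> continuous_on UNIV f"
  by (meson continuous_at_imp_continuous_on differentiable_imp_continuous_within schwartz_differentiable)

lemma schwartz_decay:
  assumes "f \<in> schwartz_space"
  obtains C where "C > 0" "\<And>x. norm (f x) \<le> C / (1 + norm x) ^ k"
proof -
  from schwartz_bounded[OF assms, of k] obtain A where A: "\<And>x. norm ((1 + norm x) ^ k *\<^sub>R f x) \<le> A"
    by (auto simp: bounded_iff)
  have "norm (f x) \<le> (\<bar>A\<bar> + 1) / (1 + norm x) ^ k" for x
  proof -
    have "(1 + norm x) ^ k > 0" by (simp add: add_pos_nonneg)
    moreover have "norm (f x) * (1 + norm x) ^ k \<le> \<bar>A\<bar> + 1"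
      using A[of x] by (simp add: mult.commute)
    ultimately show ?thesis by (simp add: pos_le_divide_eq)
  qed
  then show thesis by (intro that[of "\<bar>A\<bar> + 1"]) auto
qed

section \<open>Integration over Euclidean spaces\<close>

lemma cis_inner_measurable [measurable]:
  "f \<in> borel_measurable M \<Longrightarrow> (\<lambda>x. cis (f x)) \<in> borel_measurable M"
  unfolding cis_conv_exp by measurable

lemma nn_integral_lborel_affine:
  fixes f :: "'a::euclidean_space \<Rightarrow> ennreal"
  assumes [measurable]: "f \<in> borel_measurable borel" and c: "c \<noteq> 0"
  shows "(\<integral>\<^sup>+x. f x \<partial>lborel) = ennreal (\<bar>c\<bar> ^ DIM('a)) * (\<integral>\<^sup>+x. f (t + c *\<^sub>R x) \<partial>lborel)"
  by (subst lborel_affine[OF c, of t])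
     (simp add: nn_integral_density nn_integral_distr nn_integral_cmult)

lemma lborel_integrable_affine:
  fixes f :: "'a::euclidean_space \<Rightarrow> 'b::{banach, second_countable_topology}"
  assumes "integrable lborel f" and c: "c \<noteq> 0"
  shows "integrable lborel (\<lambda>x. f (t + c *\<^sub>R x))"
proof -
  have [measurable]: "f \<in> borel_measurable borel" using assms(1) by auto
  have "(\<integral>\<^sup>+x. ennreal (norm (f x)) \<partial>lborel) < \<infinity>"
    using assms(1) by (simp add: integrable_iff_bounded)
  then have "(\<integral>\<^sup>+x. ennreal (norm (f (t + c *\<^sub>R x))) \<partial>lborel) < \<infinity>"
    by (subst (asm) nn_integral_lborel_affine[OF _ c, of _ t])
       (auto simp: ennreal_mult_less_top c)
  then show ?thesis by (intro integrableI_bounded) auto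
qed

lemma lborel_integral_affine:
  fixes f :: "'a::euclidean_space \<Rightarrow> 'b::{banach, second_countable_topology}"
  assumes f: "integrable lborel f" and c: "c \<noteq> 0"
  shows "(\<integral>x. f x \<partial>lborel) = \<bar>c\<bar> ^ DIM('a) *\<^sub>R (\<integral>x. f (t + c *\<^sub>R x) \<partial>lborel)"
proof -
  have [measurable]: "f \<in> borel_measurable borel" using f by auto
  show ?thesis
    using lborel_integrable_affine[OF f c, of t]
    by (subst lborel_affine[OF c, of t])
       (simp add: integral_density integral_distr)
qed

lemma nn_integral_lborel_translate:
  fixes f :: "'a::euclidean_space \<Rightarrow> ennreal"
  assumes [measurable]: "f \<in> borel_measurable borel"
  shows "(\<integral>\<^sup>+x. f (x - t) \<partial>lborel) = (\<integral>\<^sup>+x. f x \<partial>lborel)"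
    and "(\<integral>\<^sup>+x. f (t - x) \<partial>lborel) = (\<integral>\<^sup>+x. f x \<partial>lborel)"
  using nn_integral_lborel_affine[of f 1 "- t"] nn_integral_lborel_affine[of f "-1" t] by auto

lemma integrable_lborel_prod:
  fixes f :: "'a::euclidean_space \<Rightarrow> real \<Rightarrow> complex"
  assumes "\<And>b. b \<in> Basis \<Longrightarrow> integrable lborel (f b)"
  shows "integrable lborel (\<lambda>x. \<Prod>b\<in>Basis. f b (x \<bullet> b))"
    and "(\<integral>x. (\<Prod>b\<in>Basis. f b (x \<bullet> b)) \<partial>lborel) = (\<Prod>b\<in>Basis. \<integral>x. f b x \<partial>lborel)"
proof -
  interpret product_sigma_finite "\<lambda>b::'a. lborel :: real measure" ..
  have [measurable]: "f b \<in> borel_measurable borel" if "b \<in> Basis" for b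
    using assms[OF that] by auto
  have *: "(\<Prod>b\<in>Basis. f b ((\<Sum>c\<in>Basis. g c *\<^sub>R c) \<bullet> b)) = (\<Prod>b\<in>Basis. f b (g b))" for g :: "'a \<Rightarrow> real"
    by (intro prod.cong) auto
  show "integrable lborel (\<lambda>x. \<Prod>b\<in>Basis. f b (x \<bullet> b))"
    unfolding lborel_eq[where 'a='a]
    using product_integrable_prod[of Basis f] assms
    by (subst integrable_distr_eq) (simp_all add: *)
  show "(\<integral>x. (\<Prod>b\<in>Basis. f b (x \<bullet> b)) \<partial>lborel) = (\<Prod>b\<in>Basis. \<integral>x. f b x \<partial>lborel)"
    unfolding lborel_eq[where 'a='a]
    using product_integral_prod[of Basis f] assms
    by (subst integral_distr) (simp_all add: *)
qed

text \<open>A power that is integrable even against \<open>1 + norm t\<close>, hence against all the weights below. The same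
  function serves as majorant on the time side and on the frequency side.\<close>

definition ker :: "'a::euclidean_space \<Rightarrow> real" where
  "ker t = 1 / (1 + norm t) ^ (2 * DIM('a) + 1)"

lemma one_plus_norm_pos [simp]: "1 + norm (t::'a::real_normed_vector) > 0" "1 + norm t \<noteq> 0"
  using norm_ge_zero[of t] by linarith+

lemma ker_pos: "ker t > 0" and ker_le_1: "ker t \<le> 1" and ker_minus [simp]: "ker (- t) = ker t"
  using one_le_power[of "1 + norm t" "2 * DIM('a) + 1"] by (auto simp: ker_def simp del: power_Suc)

lemma ker_nonneg [simp]: "ker t \<ge> 0"
  using ker_pos[of t] by simp

lemma ker_measurable [measurable]: "ker \<in> borel_measurable borel"
  unfolding ker_def by measurable

lemma nn_integral_Cauchy_density: "(\<integral>\<^sup>+x. ennreal (1 / (1 + (x::real)\<^sup>2)) \<partial>lborel) < \<infinity>"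
proof -
  have 1: "(\<integral>\<^sup>+x. ennreal (1 / (1 + x\<^sup>2)) * indicator {0..} x \<partial>lborel) = ennreal (pi / 2 - arctan 0)"
    using tendsto_arctan_at_top
    by (intro nn_integral_FTC_atLeast)
       (auto intro!: derivative_eq_intros simp: power2_eq_square inverse_eq_divide add_nonneg_eq_0_iff)
  have "(\<integral>\<^sup>+x. ennreal (1 / (1 + x\<^sup>2)) \<partial>lborel) \<le>
    (\<integral>\<^sup>+x. ennreal (1 / (1 + x\<^sup>2)) * indicator {0..} x + ennreal (1 / (1 + (-x)\<^sup>2)) * indicator {0..} (-x) \<partial>lborel)"
    by (intro nn_integral_mono) (auto simp: indicator_def)
  also have "\<dots> = (\<integral>\<^sup>+x. ennreal (1 / (1 + x\<^sup>2)) * indicator {0..} x \<partial>lborel) +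
    (\<integral>\<^sup>+x. ennreal (1 / (1 + (-x)\<^sup>2)) * indicator {0..} (-x) \<partial>lborel)"
    by (rule nn_integral_add) auto
  also have "(\<integral>\<^sup>+x. ennreal (1 / (1 + (-x)\<^sup>2)) * indicator {0..} (-x) \<partial>lborel)
     = (\<integral>\<^sup>+x. ennreal (1 / (1 + x\<^sup>2)) * indicator {0..} x \<partial>lborel)"
    using nn_integral_lborel_translate(2)[of "\<lambda>x::real. ennreal (1 / (1 + x\<^sup>2)) * indicator {0..} x" 0]
    by simp
  finally show ?thesis using 1 by (auto simp: ennreal_plus[symmetric] simp del: ennreal_plus intro: le_less_trans)
qed

text \<open>Each factor \<open>1 + (t \<bullet> b)\<^sup>2\<close> is at most \<open>(1 + norm t)\<^sup>2\<close>, so that \<open>(1 + norm t) * ker t\<close>, a power with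
  exponent \<open>- 2 * DIM('a)\<close>, is dominated by a product of Cauchy densities in the coordinates.\<close>

lemma nn_integral_norm_ker: 
  "(\<integral>\<^sup>+t. ennreal ((1 + norm (t::'a::euclidean_space)) * ker t) \<partial>lborel) < \<infinity>"
proof -
  have "(\<integral>\<^sup>+t. ennreal ((1 + norm (t::'a)) * ker t) \<partial>lborel)
      \<le> (\<integral>\<^sup>+t. (\<Prod>b\<in>Basis. ennreal (1 / (1 + ((t::'a) \<bullet> b)\<^sup>2))) \<partial>lborel)"
  proof (intro nn_integral_mono)
    fix t :: 'a
    have "(\<Prod>b\<in>(Basis::'a set). (1 + (t \<bullet> b)\<^sup>2)) \<le> (\<Prod>b\<in>(Basis::'a set). (1 + norm t)\<^sup>2)"
    proof (intro prod_mono conjI)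
      fix b :: 'a assume "b \<in> Basis"
      then have "(t \<bullet> b)\<^sup>2 \<le> (norm t)\<^sup>2"
        using Basis_le_norm[of b t] by (simp add: abs_le_square_iff[symmetric])
      then show "1 + (t \<bullet> b)\<^sup>2 \<le> (1 + norm t)\<^sup>2"
        using norm_ge_zero[of t] unfolding power2_sum one_power2 mult_1_right by linarith
    qed auto
    then have le: "(\<Prod>b\<in>(Basis::'a set). (1 + (t \<bullet> b)\<^sup>2)) \<le> (1 + norm t) ^ (2 * DIM('a))"
      by (simp add: power_mult)
    have pos: "0 < (\<Prod>b\<in>(Basis::'a set). (1 + (t \<bullet> b)\<^sup>2))"
      by (intro prod_pos) (auto intro: add_pos_nonneg)
    have "(1 + norm t) * ker t = 1 / (1 + norm t) ^ (2 * DIM('a))"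
      by (simp add: ker_def)
    also have "\<dots> \<le> 1 / (\<Prod>b\<in>(Basis::'a set). (1 + (t \<bullet> b)\<^sup>2))"
      using le pos by (intro divide_left_mono) auto
    also have "\<dots> = (\<Prod>b\<in>(Basis::'a set). 1 / (1 + (t \<bullet> b)\<^sup>2))"
      by (simp add: prod_dividef)
    finally show "ennreal ((1 + norm t) * ker t) \<le> (\<Prod>b\<in>(Basis::'a set). ennreal (1 / (1 + (t \<bullet> b)\<^sup>2)))"
      by (simp add: prod_ennreal ennreal_leI)
  qed
  also have "\<dots> = (\<Prod>b\<in>(Basis::'a set). (\<integral>\<^sup>+x. ennreal (1 / (1 + (x::real)\<^sup>2)) \<partial>lborel))"
    by (intro nn_integral_lborel_prod) auto
  also have "\<dots> < \<infinity>"
    using nn_integral_Cauchy_density by (simp add: ennreal_prod_eq_top less_top[symmetric] power_eq_top_ennreal)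
  finally show ?thesis .
qed

lemma integrable_ker: "integrable lborel (ker :: 'a::euclidean_space \<Rightarrow> real)"
proof (rule integrableI_bounded)
  have "(\<integral>\<^sup>+t. ennreal (norm (ker (t::'a))) \<partial>lborel) \<le> (\<integral>\<^sup>+t. ennreal ((1 + norm (t::'a)) * ker t) \<partial>lborel)"
    by (intro nn_integral_mono ennreal_leI) (auto simp: algebra_simps)
  then show "(\<integral>\<^sup>+t. ennreal (norm (ker (t::'a))) \<partial>lborel) < \<infinity>"
    using nn_integral_norm_ker[where 'a='a] by simp
qed simp

lemma ker_mult_le:
  "ker (a + b) \<ge> ker a * ker b"
proof -
  have "1 + norm (a + b) \<le> (1 + norm a) * (1 + norm b)"
    by (rule one_plus_norm_add_le)
  then have "(1 + norm (a + b)) ^ (2 * DIM('a) + 1) \<le> ((1 + norm a) * (1 + norm b)) ^ (2 * DIM('a) + 1)"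
    by (intro power_mono) auto
  then show ?thesis
    unfolding ker_def times_divide_times_eq mult_1 power_mult_distrib[symmetric]
    by (intro divide_left_mono) auto
qed

lemma integrable_pairI:
  fixes K :: "'a::euclidean_space \<Rightarrow> 'b::euclidean_space \<Rightarrow> complex"
  assumes [measurable]: "case_prod K \<in> borel_measurable (borel \<Otimes>\<^sub>M borel)"
    and "(\<integral>\<^sup>+x. \<integral>\<^sup>+y. ennreal (norm (K x y)) \<partial>lborel \<partial>lborel) < \<infinity>"
  shows "integrable (lborel \<Otimes>\<^sub>M lborel) (case_prod K)"
proof (rule integrableI_bounded)
  show "(\<integral>\<^sup>+z. ennreal (norm (case_prod K z)) \<partial>(lborel \<Otimes>\<^sub>M lborel)) < \<infinity>"
    using assms(2) by (subst lborel.nn_integral_fst[symmetric]) auto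
qed simp

section \<open>Fourier inversion\<close>

text \<open>The Fourier transform, without a normalising factor.\<close>

definition ft :: "('a::euclidean_space \<Rightarrow> complex) \<Rightarrow> 'a \<Rightarrow> complex" where
  "ft h \<xi> = (\<integral>t. h t * cis (- (t \<bullet> \<xi>)) \<partial>lborel)"

lemma integrable_mult_cis:
  fixes h :: "'a::euclidean_space \<Rightarrow> complex"
  assumes "integrable lborel h" and [measurable]: "u \<in> borel_measurable borel"
  shows "integrable lborel (\<lambda>t. h t * cis (u t))"
  using assms(1) by (rule Bochner_Integration.integrable_bound) (use assms(1) in \<open>auto simp: norm_mult\<close>)

lemma ft_measurable [measurable]:
  fixes h :: "'a::euclidean_space \<Rightarrow> complex"
  assumes [measurable]: "h \<in> borel_measurable borel"
  shows "ft h \<in> borel_measurable borel"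
  unfolding ft_def by measurable

definition gauss :: "'a::euclidean_space \<Rightarrow> complex" where
  "gauss t = of_real (exp (- (norm t)\<^sup>2 / 2))"

lemma gauss_measurable [measurable]: "gauss \<in> borel_measurable borel"
  unfolding gauss_def by measurable

lemma gauss_1_dim:
  "integrable lborel (\<lambda>x::real. cis (r * x) * gauss x)"
  "(\<integral>x. cis (r * x) * gauss x \<partial>lborel) = sqrt (2 * pi) * gauss r"
proof -
  have eq: "std_normal_density x *\<^sub>R iexp (r * x) = (1 / sqrt (2 * pi)) * (cis (r * x) * gauss x)" for x
    by (simp add: std_normal_density_def gauss_def cis_conv_exp scaleR_conv_of_real field_simps)
  have "integrable std_normal_distribution (\<lambda>x. iexp (r * x))"
  proof -
    interpret real_distribution std_normal_distribution by (rule real_dist_normal_dist)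
    show ?thesis by (rule integrable_const_bound[of _ 1]) auto
  qed
  then have "integrable lborel (\<lambda>x. std_normal_density x *\<^sub>R iexp (r * x))"
    by (subst (asm) integrable_density) auto
  then show 1: "integrable lborel (\<lambda>x::real. cis (r * x) * gauss x)"
    using integrable_mult_right[of "of_real (sqrt (2 * pi))" lborel
        "\<lambda>x. of_real (1 / sqrt (2 * pi)) * (cis (r * x) * gauss x :: complex)"]
    unfolding eq by (simp add: mult.assoc[symmetric])
  have "char std_normal_distribution r = (\<integral>x. std_normal_density x *\<^sub>R iexp (r * x) \<partial>lborel)"
    unfolding char_def by (subst integral_density) auto
  also have "\<dots> = (1 / sqrt (2 * pi)) * (\<integral>x. cis (r * x) * gauss x \<partial>lborel)"
    unfolding eq by simp
  finally have "(1 / sqrt (2 * pi)) * (\<integral>x. cis (r * x) * gauss x \<partial>lborel) = gauss r"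
    by (simp add: char_std_normal_distribution gauss_def)
  then show "(\<integral>x. cis (r * x) * gauss x \<partial>lborel) = sqrt (2 * pi) * gauss r"
    by (simp add: field_simps)
qed

lemma gauss_prod: "gauss t = (\<Prod>b\<in>Basis. gauss (t \<bullet> b))"
proof -
  have "(norm t)\<^sup>2 = (\<Sum>b\<in>Basis. (t \<bullet> b)\<^sup>2)"
    unfolding power2_norm_eq_inner by (subst euclidean_inner) (simp add: power2_eq_square)
  then show ?thesis
    by (simp add: gauss_def exp_sum[symmetric] sum_negf sum_divide_distrib flip: of_real_prod)
qed

lemma cis_inner_prod: "cis (t \<bullet> u) = (\<Prod>b\<in>Basis. cis ((u \<bullet> b) * (t \<bullet> b)))"
  by (subst euclidean_inner) (simp add: cis_conv_exp exp_sum[symmetric] sum_distrib_left mult.commute)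

lemma gauss_ft:
  "integrable lborel (\<lambda>t::'a::euclidean_space. cis (t \<bullet> u) * gauss t)"
  "(\<integral>t. cis (t \<bullet> u) * gauss t \<partial>lborel) = sqrt (2 * pi) ^ DIM('a) * gauss (u::'a)"
proof -
  have eq: "cis (t \<bullet> u) * gauss t = (\<Prod>b\<in>Basis. cis ((u \<bullet> b) * (t \<bullet> b)) * gauss (t \<bullet> b))" for t :: 'a
    unfolding cis_inner_prod[of t u] gauss_prod[of t] by (rule prod.distrib[symmetric])
  show "integrable lborel (\<lambda>t::'a::euclidean_space. cis (t \<bullet> u) * gauss t)"
    unfolding eq by (rule integrable_lborel_prod(1)) (rule gauss_1_dim(1))
  show "(\<integral>t. cis (t \<bullet> u) * gauss t \<partial>lborel) = sqrt (2 * pi) ^ DIM('a) * gauss (u::'a)"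
    unfolding eq
    by (subst integrable_lborel_prod(2)[OF gauss_1_dim(1)])
       (simp add: gauss_1_dim(2) prod.distrib gauss_prod[of u])
qed

lemma gauss_decay:
  assumes "norm t \<ge> 1"
  shows "norm (gauss t) \<le> 2 ^ m * fact m / norm t ^ m"
proof -
  let ?r = "norm t"
  have "(?r\<^sup>2 / 2) ^ m / fact m \<le> exp (?r\<^sup>2 / 2)"
  proof -
    have "(\<Sum>k\<in>{m}. (?r\<^sup>2 / 2) ^ k /\<^sub>R fact k) \<le> (\<Sum>k. (?r\<^sup>2 / 2) ^ k /\<^sub>R fact k)"
      by (intro sum_le_suminf summable_exp_generic) auto
    then have "(?r\<^sup>2 / 2) ^ m /\<^sub>R fact m \<le> exp (?r\<^sup>2 / 2)"
      unfolding exp_def by simp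
    then show ?thesis by (simp only: real_scaleR_def divide_inverse mult.commute)
  qed
  moreover have "?r ^ m \<le> (?r\<^sup>2) ^ m"
    using assms self_le_power[of ?r 2] by (intro power_mono) auto
  moreover have "(?r\<^sup>2) ^ m = 2 ^ m * fact m * ((?r\<^sup>2 / 2) ^ m / fact m)"
    by (simp add: power_divide)
  ultimately have "?r ^ m \<le> 2 ^ m * fact m * exp (?r\<^sup>2 / 2)"
    by (smt (verit) mult_left_mono fact_gt_zero zero_less_power zero_less_mult_iff)
  then have "1 / exp (?r\<^sup>2 / 2) \<le> 2 ^ m * fact m / ?r ^ m"
    using zero_less_power[of ?r m] assms
    by (simp only: pos_le_divide_eq times_divide_eq_left mult_1 pos_divide_le_eq exp_gt_zero)
  then show ?thesis
    by (simp add: gauss_def exp_minus inverse_eq_divide norm_divide)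
qed

lemma gauss_tendsto:
  fixes u :: "'a::euclidean_space"
  assumes "e \<longlonglongrightarrow> 0"
  shows "(\<lambda>j. gauss (e j *\<^sub>R u)) \<longlonglongrightarrow> 1"
proof -
  have "(\<lambda>j. gauss (e j *\<^sub>R u)) \<longlonglongrightarrow> of_real (exp (- (norm (0 *\<^sub>R u))\<^sup>2 / 2))"
    unfolding gauss_def by (intro tendsto_intros assms) auto
  then show ?thesis by simp
qed

lemma norm_gauss_le_1: "norm (gauss t) \<le> 1"
  by (simp add: gauss_def)

lemma gauss_minus [simp]: "gauss (- t) = gauss t"
  by (simp add: gauss_def)

lemma gauss_0 [simp]: "gauss 0 = 1"
  by (simp add: gauss_def)

text \<open>The function \<open>h\<close> may be unbounded. Near \<open>t\<close> it is bounded by continuity, and dominated convergence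
  applies there (\<open>C\<close>). Where \<open>e j * norm u > 1\<close> the Gaussian is so small that integrability of
  \<open>h\<close> is enough (\<open>D\<close>).\<close>

lemma gauss_approximate_identity:
  fixes h :: "'a::euclidean_space \<Rightarrow> complex"
  assumes h: "continuous_on UNIV h" "integrable lborel h"
    and e: "\<And>j. 0 < e j" "\<And>j. e j \<le> 1" "e \<longlonglongrightarrow> 0"
  shows "(\<lambda>j. \<integral>u. h (t + e j *\<^sub>R u) * gauss u \<partial>lborel) \<longlonglongrightarrow> sqrt (2 * pi) ^ DIM('a) * h t"
proof -
  have [measurable]: "h \<in> borel_measurable borel" using h(2) by auto
  define C where "C j u = h (t + e j *\<^sub>R u) * gauss u * indicator (cball 0 1) (e j *\<^sub>R u)" for j u
  define D where "D j u = h (t + e j *\<^sub>R u) * gauss u * indicator (- cball 0 1) (e j *\<^sub>R u)" for j u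
  have gi: "integrable lborel (gauss :: 'a \<Rightarrow> complex)" "(\<integral>u. gauss (u::'a) \<partial>lborel) = sqrt (2 * pi) ^ DIM('a)"
    using gauss_ft[of "0::'a"] by simp_all
  have hi: "integrable lborel (\<lambda>u. h (t + e j *\<^sub>R u))" for j
    using e(1)[of j] by (intro lborel_integrable_affine h) auto
  have Ci: "integrable lborel (C j)" for j
    unfolding C_def
    by (rule Bochner_Integration.integrable_bound[OF hi[of j]])
       (auto simp: norm_mult indicator_def mult_left_le norm_gauss_le_1)
  have Di: "integrable lborel (D j)" for j
    unfolding D_def
    by (rule Bochner_Integration.integrable_bound[OF hi[of j]])
       (auto simp: norm_mult indicator_def mult_left_le norm_gauss_le_1)
  have "compact (h ` cball t 1)"
    using h(1) by (intro compact_continuous_image) (auto intro: continuous_on_subset)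
  then obtain B where B: "\<And>x. x \<in> cball t 1 \<Longrightarrow> norm (h x) \<le> B"
    unfolding bounded_iff[symmetric] by (metis bounded_iff compact_imp_bounded imageI)
  have "(\<lambda>j. \<integral>u. C j u \<partial>lborel) \<longlonglongrightarrow> (\<integral>u. h t * gauss (u::'a) \<partial>lborel)"
  proof (rule integral_dominated_convergence[where w = "\<lambda>u::'a. B * norm (gauss u)"])
    show "integrable lborel (\<lambda>u::'a. B * norm (gauss u))"
      using gi by auto
    show "AE u in lborel. (\<lambda>j. C j u) \<longlonglongrightarrow> h t * gauss u"
    proof (intro AE_I2)
      fix u :: 'a
      have lim: "(\<lambda>j. e j *\<^sub>R u) \<longlonglongrightarrow> 0"
        using tendsto_scaleR[OF e(3) tendsto_const[of u]] by simp
      have "isCont h t"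
        using h(1) by (simp add: continuous_on_eq_continuous_at)
      then have "(\<lambda>j. h (t + e j *\<^sub>R u)) \<longlonglongrightarrow> h t"
        using tendsto_add[OF tendsto_const[of t] lim] by (intro isCont_tendsto_compose[of t h]) auto
      then have "(\<lambda>j. h (t + e j *\<^sub>R u) * gauss u) \<longlonglongrightarrow> h t * gauss u"
        by (intro tendsto_intros)
      moreover have "eventually (\<lambda>j. e j *\<^sub>R u \<in> ball 0 1) sequentially"
        using topological_tendstoD[OF lim, of "ball 0 1"] by auto
      then have "eventually (\<lambda>j. h (t + e j *\<^sub>R u) * gauss u = C j u) sequentially"
        by eventually_elim (auto simp: C_def indicator_def)
      ultimately show "(\<lambda>j. C j u) \<longlonglongrightarrow> h t * gauss u"
        by (rule Lim_transform_eventually)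
    qed
    show "AE u in lborel. norm (C j u) \<le> B * norm (gauss u)" for j
    proof (intro AE_I2)
      fix u :: 'a
      show "norm (C j u) \<le> B * norm (gauss u)"
      proof (cases "e j *\<^sub>R u \<in> cball 0 1")
        case True
        then have "norm (h (t + e j *\<^sub>R u)) \<le> B"
          by (intro B) (auto simp: dist_norm)
        then show ?thesis
          using True by (auto simp: C_def norm_mult intro!: mult_right_mono)
      next
        case False
        have "0 \<le> B" using order_trans[OF norm_ge_zero B[of t]] by simp
        then show ?thesis using False by (simp add: C_def)
      qed
    qed
  qed (use Ci[THEN borel_measurable_integrable] in auto)
  then have limC: "(\<lambda>j. \<integral>u. C j u \<partial>lborel) \<longlonglongrightarrow> sqrt (2 * pi) ^ DIM('a) * h t"
    using gi by (simp add: mult.commute)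
  let ?m = "Suc DIM('a)"
  let ?K = "2 ^ ?m * fact ?m :: real"
  let ?I = "\<integral>u. norm (h u) \<partial>lborel"
  have Dle: "norm (\<integral>u. D j u \<partial>lborel) \<le> ?K * ?I * e j" for j
  proof -
    have "norm (\<integral>u. D j u \<partial>lborel) \<le> (\<integral>u. norm (D j u) \<partial>lborel)"
      by (rule integral_norm_bound)
    also have "\<dots> \<le> (\<integral>u. ?K * e j ^ ?m * norm (h (t + e j *\<^sub>R u)) \<partial>lborel)"
    proof (rule integral_mono)
      fix u :: 'a
      show "norm (D j u) \<le> ?K * e j ^ ?m * norm (h (t + e j *\<^sub>R u))"
      proof (cases "e j *\<^sub>R u \<in> cball 0 1")
        case False
        then have u: "1 < e j * norm u" using e(1)[of j] by simp
        then have "1 \<le> norm u"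
          using e(2)[of j] mult_right_mono[of "e j" 1 "norm u"] by simp
        have "norm (gauss u) \<le> ?K / norm u ^ ?m"
          by (rule gauss_decay) fact
        also have "\<dots> \<le> ?K / norm u ^ ?m * (e j * norm u) ^ ?m"
        proof -
          have "?K / norm u ^ ?m * 1 \<le> ?K / norm u ^ ?m * (e j * norm u) ^ ?m"
            using u by (intro mult_left_mono one_le_power) auto
          then show ?thesis by simp
        qed
        also have "\<dots> = ?K * e j ^ ?m"
          using \<open>1 \<le> norm u\<close> by (auto simp: power_mult_distrib simp del: power_Suc)
        finally have "norm (gauss u) \<le> ?K * e j ^ ?m" .
        from mult_right_mono[OF this norm_ge_zero[of "h (t + e j *\<^sub>R u)"]] show ?thesis
          using False by (simp add: D_def norm_mult mult.commute[of "norm (h _)"] del: power_Suc fact_Suc)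
      qed (use e(1)[of j] in \<open>auto simp: D_def\<close>)
    qed (use Di hi in auto)
    also have "\<dots> = ?K * e j ^ ?m * (\<integral>u. norm (h (t + e j *\<^sub>R u)) \<partial>lborel)"
      by simp
    also have "\<dots> = ?K * ?I * e j"
      using e(1)[of j] lborel_integral_affine[of "\<lambda>u. norm (h u)" "e j" t] h(2) by simp
    finally show ?thesis .
  qed
  have "(\<lambda>j. \<integral>u. D j u \<partial>lborel) \<longlonglongrightarrow> 0"
  proof (rule Lim_null_comparison)
    show "eventually (\<lambda>j. norm (\<integral>u. D j u \<partial>lborel) \<le> ?K * ?I * e j) sequentially"
      by (intro always_eventually allI Dle)
    show "(\<lambda>j. ?K * ?I * e j) \<longlonglongrightarrow> 0"
      by (rule tendsto_mult_right_zero[OF e(3)])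
  qed
  from tendsto_add[OF limC this]
  have "(\<lambda>j. (\<integral>u. C j u \<partial>lborel) + (\<integral>u. D j u \<partial>lborel)) \<longlonglongrightarrow> sqrt (2 * pi) ^ DIM('a) * h t"
    by simp
  moreover have "(\<integral>u. C j u \<partial>lborel) + (\<integral>u. D j u \<partial>lborel) = (\<integral>u. h (t + e j *\<^sub>R u) * gauss u \<partial>lborel)" for j
    by (subst Bochner_Integration.integral_add[symmetric, OF Ci Di])
       (auto intro!: Bochner_Integration.integral_cong simp: C_def D_def indicator_def)
  ultimately show ?thesis by simp
qed

text \<open>Damp the inversion integral by a dilated Gaussian. Undoing the damping gives the left-hand side;
  exchanging the integrals turns the damped integral into a Gaussian average of \<open>h\<close> around \<open>t\<close>.\<close>

lemma fourier_inversion: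
  fixes h :: "'a::euclidean_space \<Rightarrow> complex"
  assumes h: "continuous_on UNIV h" "integrable lborel h" and fth: "integrable lborel (ft h)"
  shows "(\<integral>\<xi>. ft h \<xi> * cis (\<xi> \<bullet> t) \<partial>lborel) = (2 * pi) ^ DIM('a) * h t"
proof -
  have [measurable]: "h \<in> borel_measurable borel" using h(2) by auto
  define e :: "nat \<Rightarrow> real" where "e j = 1 / Suc j" for j
  have e: "0 < e j" "e j \<le> 1" for j by (auto simp: e_def)
  have e0: "e \<longlonglongrightarrow> 0"
    unfolding e_def using LIMSEQ_inverse_real_of_nat by (simp add: inverse_eq_divide)
  let ?c = "complex_of_real (sqrt (2 * pi) ^ DIM('a))"
  define A where "A j = (\<integral>\<xi>. ft h \<xi> * cis (\<xi> \<bullet> t) * gauss (e j *\<^sub>R \<xi>) \<partial>lborel)" for j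
  have A1: "A \<longlonglongrightarrow> (\<integral>\<xi>. ft h \<xi> * cis (\<xi> \<bullet> t) \<partial>lborel)"
    unfolding A_def
  proof (rule integral_dominated_convergence[where w = "\<lambda>\<xi>. norm (ft h \<xi>)"])
    show "AE \<xi> in lborel. (\<lambda>j. ft h \<xi> * cis (\<xi> \<bullet> t) * gauss (e j *\<^sub>R \<xi>)) \<longlonglongrightarrow> ft h \<xi> * cis (\<xi> \<bullet> t)"
      using tendsto_mult[OF tendsto_const gauss_tendsto[OF e0]] by (intro AE_I2) simp
  qed (use fth in \<open>auto simp: norm_mult mult_left_le norm_gauss_le_1\<close>)
  have "A j = ?c * (\<integral>u. h (t + e j *\<^sub>R u) * gauss u \<partial>lborel)" for j
  proof -
    let ?e = "e j"
    have gi: "integrable lborel (\<lambda>\<xi>::'a. norm (gauss (?e *\<^sub>R \<xi>)))"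
      using gauss_ft(1)[of "0::'a"] lborel_integrable_affine[of "gauss :: 'a \<Rightarrow> complex" ?e 0] e(1)[of j]
      by auto
    have gh: "integrable (lborel \<Otimes>\<^sub>M lborel) (\<lambda>(s, \<xi>). h s * cis (- (s \<bullet> \<xi>)) * cis (\<xi> \<bullet> t) * gauss (?e *\<^sub>R \<xi>))"
    proof (rule integrable_pairI)
      have "(\<integral>\<^sup>+s. \<integral>\<^sup>+\<xi>. ennreal (norm (h s * cis (- (s \<bullet> \<xi>)) * cis (\<xi> \<bullet> t) * gauss (?e *\<^sub>R \<xi>))) \<partial>lborel \<partial>lborel)
        = (\<integral>\<^sup>+s. ennreal (norm (h s)) * (\<integral>\<^sup>+\<xi>. ennreal (norm (gauss (?e *\<^sub>R (\<xi>::'a)))) \<partial>lborel) \<partial>lborel)"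
        by (simp add: norm_mult ennreal_mult' nn_integral_cmult)
      also have "\<dots> = (\<integral>\<^sup>+s. ennreal (norm (h s)) \<partial>lborel) * (\<integral>\<^sup>+\<xi>. ennreal (norm (gauss (?e *\<^sub>R (\<xi>::'a)))) \<partial>lborel)"
        by (simp add: nn_integral_multc)
      also have "\<dots> < \<infinity>"
        using h(2) gi by (simp add: integrable_iff_bounded ennreal_mult_less_top)
      finally show "(\<integral>\<^sup>+s. \<integral>\<^sup>+\<xi>. ennreal (norm (h s * cis (- (s \<bullet> \<xi>)) * cis (\<xi> \<bullet> t) * gauss (?e *\<^sub>R \<xi>))) \<partial>lborel \<partial>lborel) < \<infinity>" .
    qed measurable
    have [simp]: "inverse ?e * (?e * r) = r" for r
      using e(1)[of j] by simp
    have inner: "(\<integral>\<xi>. cis (\<xi> \<bullet> (t - s)) * gauss (?e *\<^sub>R \<xi>) \<partial>lborel) = ?c * gauss ((t - s) /\<^sub>R ?e) / of_real (?e ^ DIM('a))" for s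
    proof -
      have "?c * gauss ((t - s) /\<^sub>R ?e) = (\<integral>\<xi>. cis (\<xi> \<bullet> ((t - s) /\<^sub>R ?e)) * gauss \<xi> \<partial>lborel)"
        using gauss_ft(2)[of "(t - s) /\<^sub>R ?e"] by simp
      also have "\<dots> = ?e ^ DIM('a) *\<^sub>R (\<integral>\<xi>. cis (\<xi> \<bullet> (t - s)) * gauss (?e *\<^sub>R \<xi>) \<partial>lborel)"
        using e(1)[of j] gauss_ft(1)[of "(t - s) /\<^sub>R ?e"] by (subst lborel_integral_affine[of _ ?e 0]) simp_all
      finally show ?thesis
        using e(1)[of j] by (simp add: scaleR_conv_of_real)
    qed
    have hg: "integrable lborel (\<lambda>s. h s * gauss ((t - s) /\<^sub>R ?e))"
      by (rule Bochner_Integration.integrable_bound[OF h(2)])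
         (auto simp: norm_mult mult_left_le norm_gauss_le_1)
    have "A j = (\<integral>\<xi>. \<integral>s. h s * cis (- (s \<bullet> \<xi>)) * cis (\<xi> \<bullet> t) * gauss (?e *\<^sub>R \<xi>) \<partial>lborel \<partial>lborel)"
      unfolding A_def ft_def by simp
    also have "\<dots> = (\<integral>s. \<integral>\<xi>. h s * cis (- (s \<bullet> \<xi>)) * cis (\<xi> \<bullet> t) * gauss (?e *\<^sub>R \<xi>) \<partial>lborel \<partial>lborel)"
      using lborel_pair.Fubini_integral[OF gh] .
    also have "\<dots> = (\<integral>s. h s * (\<integral>\<xi>. cis (\<xi> \<bullet> (t - s)) * gauss (?e *\<^sub>R \<xi>) \<partial>lborel) \<partial>lborel)"
      by (simp add: mult.assoc inner_diff_right cis_mult inner_commute flip: mult.assoc[of "cis _" "cis _"])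
    also have "\<dots> = (\<integral>s. h s * (?c * gauss ((t - s) /\<^sub>R ?e) / of_real (?e ^ DIM('a))) \<partial>lborel)"
      by (simp only: inner)
    also have "\<dots> = (\<integral>s. ?c / of_real (?e ^ DIM('a)) * (h s * gauss ((t - s) /\<^sub>R ?e)) \<partial>lborel)"
      by (intro Bochner_Integration.integral_cong) auto
    also have "\<dots> = ?c / of_real (?e ^ DIM('a)) * (\<integral>s. h s * gauss ((t - s) /\<^sub>R ?e) \<partial>lborel)"
      by simp
    also have "(\<integral>s. h s * gauss ((t - s) /\<^sub>R ?e) \<partial>lborel) = ?e ^ DIM('a) *\<^sub>R (\<integral>u. h (t + ?e *\<^sub>R u) * gauss u \<partial>lborel)"
      using e(1)[of j] hg by (subst lborel_integral_affine[of _ ?e t]) simp_all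
    also have "?c / of_real (?e ^ DIM('a)) * (?e ^ DIM('a) *\<^sub>R (\<integral>u. h (t + ?e *\<^sub>R u) * gauss u \<partial>lborel))
        = ?c * (\<integral>u. h (t + ?e *\<^sub>R u) * gauss u \<partial>lborel)"
      using e(1)[of j] by (simp add: scaleR_conv_of_real)
    finally show ?thesis .
  qed
  then have "A = (\<lambda>j. ?c * (\<integral>u. h (t + e j *\<^sub>R u) * gauss u \<partial>lborel))"
    by (intro ext)
  moreover have "(\<lambda>j. ?c * (\<integral>u. h (t + e j *\<^sub>R u) * gauss u \<partial>lborel)) \<longlonglongrightarrow> ?c * (?c * h t)"
    by (intro tendsto_mult_left gauss_approximate_identity h e e0)
  ultimately have "A \<longlonglongrightarrow> ?c * (?c * h t)"
    by simp
  with A1 have "(\<integral>\<xi>. ft h \<xi> * cis (\<xi> \<bullet> t) \<partial>lborel) = ?c * (?c * h t)"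
    by (rule LIMSEQ_unique)
  moreover have "?c * ?c = of_real ((2 * pi) ^ DIM('a))"
  proof -
    have "sqrt (2 * pi) ^ DIM('a) * sqrt (2 * pi) ^ DIM('a) = (sqrt (2 * pi) * sqrt (2 * pi)) ^ DIM('a)"
      by (rule power_mult_distrib[symmetric])
    also have "\<dots> = (2 * pi) ^ DIM('a)" by simp
    finally show ?thesis by (simp only: of_real_mult[symmetric])
  qed
  ultimately show ?thesis by (metis mult.assoc)
qed

section \<open>Minkowski's inequality\<close>

lemma ennreal_powr_top [simp]: "ennreal_powr \<infinity> q = \<infinity>" "ennreal_powr top q = top"
  by (auto simp: ennreal_powr_def)

lemma ennreal_powr_0 [simp]: "ennreal_powr 0 q = 0"
  by (simp add: ennreal_powr_def)

lemma ennreal_powr_ennreal: "0 \<le> r \<Longrightarrow> ennreal_powr (ennreal r) q = ennreal (r powr q)"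
  by (simp add: ennreal_powr_def)

lemma ennreal_powr_mono: "a \<le> b \<Longrightarrow> 0 \<le> q \<Longrightarrow> ennreal_powr a q \<le> ennreal_powr b q"
  by (cases a; cases b) (auto simp: ennreal_powr_ennreal top_unique intro!: ennreal_leI powr_mono2)

lemma ennreal_powr_mult: "ennreal_powr (a * b) q = ennreal_powr a q * ennreal_powr b q"
proof (cases "a = 0 \<or> b = 0")
  case False
  then have "ennreal_powr a q \<noteq> 0" "ennreal_powr b q \<noteq> 0"
    by (cases a; cases b; auto simp: ennreal_powr_ennreal ennreal_eq_0_iff)+
  with False show ?thesis
    by (cases a; cases b) (auto simp: ennreal_powr_ennreal ennreal_mult[symmetric] powr_mult ennreal_top_mult ennreal_mult_top simp del: ennreal_eq_0_iff)
qed auto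

lemma ennreal_powr_powr: "ennreal_powr (ennreal_powr a q) r = ennreal_powr a (q * r)"
  by (cases a) (auto simp: ennreal_powr_ennreal powr_powr)

lemma ennreal_powr_1 [simp]: "ennreal_powr a 1 = a"
  by (cases a) (auto simp: ennreal_powr_ennreal)

lemma ennreal_powr_eq_0_iff [simp]: "ennreal_powr a q = 0 \<longleftrightarrow> a = 0"
  by (cases a) (auto simp: ennreal_powr_ennreal)

lemma ennreal_powr_eq_top_iff [simp]: "ennreal_powr a q = top \<longleftrightarrow> a = top"
  by (cases a) (auto simp: ennreal_powr_ennreal)

lemma pred_eq_ennreal:
  fixes f g :: "'a \<Rightarrow> ennreal"
  assumes [measurable]: "f \<in> borel_measurable M" "g \<in> borel_measurable M"
  shows "Measurable.pred M (\<lambda>x. f x = g x)"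
  unfolding order.eq_iff by measurable

lemma ennreal_powr_measurable [measurable]:
  assumes [measurable]: "f \<in> borel_measurable M"
  shows "(\<lambda>x. ennreal_powr (f x) q) \<in> borel_measurable M"
  unfolding ennreal_powr_def
proof (intro measurable_If predE pred_eq_ennreal assms)
  show "(\<lambda>x. ennreal (enn2real (f x) powr q)) \<in> borel_measurable M"
    by measurable
qed auto

lemma inverse_mult_self_ennreal: "a \<noteq> 0 \<Longrightarrow> a \<noteq> top \<Longrightarrow> inverse a * a = (1::ennreal)"
  by (cases a) (auto simp: inverse_ennreal ennreal_mult[symmetric])

definition Lp_norm :: "real \<Rightarrow> ('a::euclidean_space \<Rightarrow> ennreal) \<Rightarrow> ennreal" where
  "Lp_norm p F = ennreal_powr (\<integral>\<^sup>+x. ennreal_powr (F x) p \<partial>lborel) (1 / p)"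

lemma Lp_norm_mono: "(\<And>x. F x \<le> G x) \<Longrightarrow> 0 < p \<Longrightarrow> Lp_norm p F \<le> Lp_norm p G"
  unfolding Lp_norm_def by (intro ennreal_powr_mono nn_integral_mono) auto

lemma Lp_norm_cmult:
  assumes [measurable]: "F \<in> borel_measurable borel" and "0 < p"
  shows "Lp_norm p (\<lambda>x. c * F x) = c * Lp_norm p F"
  using assms by (simp add: Lp_norm_def ennreal_powr_mult nn_integral_cmult ennreal_powr_powr)

lemma Lp_norm_multc:
  assumes "F \<in> borel_measurable borel" and "0 < p"
  shows "Lp_norm p (\<lambda>x. F x * c) = Lp_norm p F * c"
  using Lp_norm_cmult[OF assms, of c] by (simp add: mult.commute)

lemma Lp_norm_measurable [measurable]:
  fixes F :: "'b \<Rightarrow> 'a::euclidean_space \<Rightarrow> ennreal"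
  assumes [measurable]: "case_prod F \<in> borel_measurable (M \<Otimes>\<^sub>M borel)"
  shows "(\<lambda>\<omega>. Lp_norm p (F \<omega>)) \<in> borel_measurable M"
  unfolding Lp_norm_def by measurable

lemma Lp_norm_translate:
  assumes [measurable]: "F \<in> borel_measurable borel"
  shows "Lp_norm p (\<lambda>x. F (x - t)) = Lp_norm p F"
  unfolding Lp_norm_def using nn_integral_lborel_translate(1)[of "\<lambda>x. ennreal_powr (F x) p" t] by simp

lemma Lp_norm_powr: "0 < p \<Longrightarrow> ennreal_powr (Lp_norm p F) p = (\<integral>\<^sup>+x. ennreal_powr (F x) p \<partial>lborel)"
  by (simp add: Lp_norm_def ennreal_powr_powr)

text \<open>The graph of \<open>r powr p\<close> lies above its tangent at \<open>g\<close>; this is Young's inequality rearranged.\<close>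

lemma powr_tangent:
  fixes r g p :: real
  assumes "1 \<le> p" "0 \<le> r" "0 < g"
  shows "p * g powr (p - 1) * r \<le> r powr p + (p - 1) * g powr p"
proof (cases "p = 1 \<or> r = 0")
  case False
  then have "1 < p" "0 < r" using assms by auto
  define q where "q = p / (p - 1)"
  have "1 < q" "1 / p + 1 / q = 1"
    using \<open>1 < p\<close> by (auto simp: q_def field_simps)
  from Youngs_inequality[OF \<open>1 < p\<close> this, of r "g powr (p - 1)"] assms
  have "r * g powr (p - 1) \<le> r powr p / p + (g powr (p - 1)) powr q / q"
    by simp
  also have "(g powr (p - 1)) powr q = g powr p"
    using \<open>1 < p\<close> by (simp add: powr_powr q_def)
  finally have "p * (r * g powr (p - 1)) \<le> p * (r powr p / p + g powr p / q)"
    using \<open>1 < p\<close> by (intro mult_left_mono) auto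
  also have "\<dots> = r powr p + (p - 1) * g powr p"
    using \<open>1 < p\<close> by (simp add: q_def field_simps)
  finally show ?thesis by (simp add: ac_simps)
qed (use assms in auto)

lemma ennreal_powr_tangent:
  assumes "1 \<le> p" "0 < g"
  shows "ennreal (p * g powr (p - 1)) * r \<le> ennreal_powr r p + ennreal ((p - 1) * g powr p)"
proof (cases r)
  case (real x)
  then show ?thesis
    using powr_tangent[OF assms(1) _ assms(2), of x] assms
    by (simp add: ennreal_powr_ennreal ennreal_mult[symmetric] ennreal_plus[symmetric] del: ennreal_plus)
qed auto

text \<open>Jensen's inequality for the convex function \<open>r powr p\<close> and the weight \<open>a\<close> of total mass \<open>S\<close>, obtained
  by integrating the tangent inequality at the mean value \<open>g\<close> of \<open>f\<close>.\<close>

lemma powr_nn_integral_le: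
  assumes p: "1 \<le> p" and [measurable]: "f \<in> borel_measurable M" "a \<in> borel_measurable M"
    and S: "(\<integral>\<^sup>+\<omega>. a \<omega> \<partial>M) = ennreal S" "0 < S"
  shows "ennreal_powr (\<integral>\<^sup>+\<omega>. f \<omega> * a \<omega> \<partial>M) p
    \<le> ennreal (S powr (p - 1)) * (\<integral>\<^sup>+\<omega>. ennreal_powr (f \<omega>) p * a \<omega> \<partial>M)"
proof -
  define G where "G = (\<integral>\<^sup>+\<omega>. f \<omega> * a \<omega> \<partial>M)"
  define R where "R = (\<integral>\<^sup>+\<omega>. ennreal_powr (f \<omega>) p * a \<omega> \<partial>M)"
  have tan: "ennreal (p * g powr (p - 1)) * G \<le> R + ennreal ((p - 1) * g powr p * S)" if "0 < g" for g
  proof -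
    have "ennreal (p * g powr (p - 1)) * G = (\<integral>\<^sup>+\<omega>. ennreal (p * g powr (p - 1)) * f \<omega> * a \<omega> \<partial>M)"
      unfolding G_def by (simp add: nn_integral_cmult mult.assoc)
    also have "\<dots> \<le> (\<integral>\<^sup>+\<omega>. (ennreal_powr (f \<omega>) p + ennreal ((p - 1) * g powr p)) * a \<omega> \<partial>M)"
      by (intro nn_integral_mono mult_right_mono ennreal_powr_tangent p that) auto
    also have "\<dots> = R + ennreal ((p - 1) * g powr p) * ennreal S"
      unfolding R_def by (simp add: distrib_right nn_integral_add nn_integral_cmult S)
    finally show ?thesis
      using p S(2) by (simp add: ennreal_mult[symmetric])
  qed
  have "ennreal_powr G p \<le> ennreal (S powr (p - 1)) * R"
  proof (cases R)
    case top
    then show ?thesis using S(2) by (simp add: ennreal_mult_top)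
  next
    case (real R')
    have "G \<noteq> top"
      using tan[of 1] real p by (auto simp: ennreal_mult_top top_unique ennreal_plus[symmetric] simp del: ennreal_plus)
    then obtain G' where G': "G = ennreal G'" "0 \<le> G'" by (cases G) auto
    show ?thesis
    proof (cases "G' = 0")
      case False
      define g where "g = G' / S"
      have g: "0 < g" "G' = g * S" using False G' S(2) by (auto simp: g_def)
      have "g powr p = g powr (p - 1) * g"
        using g powr_add[of g "p - 1" 1] by simp
      have "p * g powr (p - 1) * G' \<le> R' + (p - 1) * g powr p * S"
        using tan[OF g(1)] p S(2) G'(2) real(1) 
        by (simp add: G'(1) real(2) ennreal_mult[symmetric] ennreal_plus[symmetric] del: ennreal_plus)
      then have "g powr p * S \<le> R'"
        unfolding g(2) \<open>g powr p = g powr (p - 1) * g\<close> by (simp add: algebra_simps)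
      then have "S powr (p - 1) * (g powr p * S) \<le> S powr (p - 1) * R'"
        by (intro mult_left_mono) auto
      moreover have "S powr (p - 1) * (g powr p * S) = G' powr p"
        using g S(2) powr_add[of S "p - 1" 1] by (simp add: powr_mult ac_simps)
      ultimately show ?thesis
        using G' real S(2) by (simp add: ennreal_powr_ennreal ennreal_mult[symmetric] ennreal_leI)
    qed (use G' in auto)
  qed
  then show ?thesis by (simp add: G_def R_def)
qed

lemma Lp_norm_eq_0_AE:
  assumes [measurable]: "F \<in> borel_measurable borel" and "0 < p" "Lp_norm p F = 0"
  shows "AE x in lborel. F x = 0"
proof -
  have "(\<integral>\<^sup>+x. ennreal_powr (F x) p \<partial>lborel) = 0"
    using assms by (simp add: Lp_norm_def)
  then show ?thesis by (subst (asm) nn_integral_0_iff_AE) auto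
qed

text \<open>Write \<open>F x \<omega>\<close> as \<open>(F x \<omega> / A \<omega>) * A \<omega>\<close>, where \<open>A \<omega>\<close> is the norm of the slice, and apply Jensen's
  inequality in \<open>\<omega>\<close> for the weight \<open>A\<close>. Integrating over \<open>x\<close> and exchanging the integrals, the slices
  \<open>F x \<omega> / A \<omega>\<close> contribute at most 1 each. The slices with \<open>A \<omega> = 0\<close> vanish almost everywhere.\<close>

lemma minkowski:
  fixes F :: "'a::euclidean_space \<Rightarrow> 'b::euclidean_space \<Rightarrow> ennreal"
  assumes p: "1 \<le> p" and [measurable]: "case_prod F \<in> borel_measurable (borel \<Otimes>\<^sub>M borel)"
  shows "Lp_norm p (\<lambda>x. \<integral>\<^sup>+\<omega>. F x \<omega> \<partial>lborel) \<le> (\<integral>\<^sup>+\<omega>. Lp_norm p (\<lambda>x. F x \<omega>) \<partial>lborel)"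
proof -
  have p0: "0 < p" using p by simp
  define A where "A \<omega> = Lp_norm p (\<lambda>x. F x \<omega>)" for \<omega>
  have [measurable]: "A \<in> borel_measurable borel"
    unfolding A_def by measurable
  have A_powr: "ennreal_powr (A \<omega>) p = (\<integral>\<^sup>+x. ennreal_powr (F x \<omega>) p \<partial>lborel)" for \<omega>
    unfolding A_def using p0 by (rule Lp_norm_powr)
  have "AE \<omega> in lborel. AE x in lborel. A \<omega> = 0 \<longrightarrow> F x \<omega> = 0"
  proof (rule AE_I2)
    fix \<omega>
    show "AE x in lborel. A \<omega> = 0 \<longrightarrow> F x \<omega> = 0"
      using Lp_norm_eq_0_AE[of "\<lambda>x. F x \<omega>" p] p0 by (cases "A \<omega> = 0") (auto simp: A_def)
  qed
  then have F0: "AE x in lborel. AE \<omega> in lborel. A \<omega> = 0 \<longrightarrow> F x \<omega> = 0"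
    by (subst lborel_pair.AE_commute) (intro predE pred_intros_logic pred_eq_ennreal; measurable)
  show ?thesis
  proof (cases "\<integral>\<^sup>+\<omega>. A \<omega> \<partial>lborel")
    case top
    then show ?thesis by (simp add: A_def)
  next
    case (real S)
    have Afin: "AE \<omega> in lborel. A \<omega> \<noteq> top"
      using real by (intro nn_integral_PInf_AE[of A lborel, simplified]) auto
    show ?thesis
    proof (cases "S = 0")
      case True
      then have A0: "AE \<omega> in lborel. A \<omega> = 0"
        using real nn_integral_0_iff_AE[of A lborel] by simp
      have "AE x in lborel. (\<integral>\<^sup>+\<omega>. F x \<omega> \<partial>lborel) = 0"
        using F0
      proof eventually_elim
        case (elim x)
        then have "AE \<omega> in lborel. F x \<omega> = 0"
          using A0 by eventually_elim auto
        then have "(\<integral>\<^sup>+\<omega>. F x \<omega> \<partial>lborel) = (\<integral>\<^sup>+\<omega>. 0 * ennreal (norm (\<omega>::'b)) \<partial>lborel)"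
          by (intro nn_integral_cong_AE) simp
        then show ?case by simp
      qed
      then have "(\<integral>\<^sup>+x. ennreal_powr (\<integral>\<^sup>+\<omega>. F x \<omega> \<partial>lborel) p \<partial>lborel) = 0"
        by (subst nn_integral_0_iff_AE) auto
      then show ?thesis by (simp add: Lp_norm_def)
    next
      case False
      with real have S: "0 < S" by simp
      have pt: "AE x in lborel. ennreal_powr (\<integral>\<^sup>+\<omega>. F x \<omega> \<partial>lborel) p
          \<le> ennreal (S powr (p - 1)) * (\<integral>\<^sup>+\<omega>. ennreal_powr (F x \<omega> / A \<omega>) p * A \<omega> \<partial>lborel)"
        using F0
      proof eventually_elim
        case (elim x)
        have "(\<integral>\<^sup>+\<omega>. F x \<omega> \<partial>lborel) = (\<integral>\<^sup>+\<omega>. F x \<omega> / A \<omega> * A \<omega> \<partial>lborel)"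
          using elim Afin
          by (intro nn_integral_cong_AE, eventually_elim)
             (auto simp: divide_ennreal_def mult.assoc inverse_mult_self_ennreal)
        then show ?case
          using powr_nn_integral_le[OF p, of "\<lambda>\<omega>. F x \<omega> / A \<omega>" lborel A S] real S by simp
      qed
      have "(\<integral>\<^sup>+x. \<integral>\<^sup>+\<omega>. ennreal_powr (F x \<omega> / A \<omega>) p * A \<omega> \<partial>lborel \<partial>lborel)
          = (\<integral>\<^sup>+\<omega>. \<integral>\<^sup>+x. ennreal_powr (F x \<omega> / A \<omega>) p * A \<omega> \<partial>lborel \<partial>lborel)"
        by (rule lborel_pair.Fubini') measurable
      also have "\<dots> \<le> (\<integral>\<^sup>+\<omega>. A \<omega> \<partial>lborel)"
      proof (intro nn_integral_mono)
        fix \<omega>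
        have "(\<integral>\<^sup>+x. ennreal_powr (F x \<omega> / A \<omega>) p * A \<omega> \<partial>lborel)
          = ennreal_powr (inverse (A \<omega>)) p * ennreal_powr (A \<omega>) p * A \<omega>"
          by (simp add: divide_ennreal_def ennreal_powr_mult nn_integral_multc A_powr
              mult.commute[of "nn_integral _ _"])
        also have "\<dots> = ennreal_powr (inverse (A \<omega>) * A \<omega>) p * A \<omega>"
          by (simp add: ennreal_powr_mult)
        also have "\<dots> \<le> 1 * A \<omega>"
        proof (intro mult_right_mono)
          have "inverse (A \<omega>) * A \<omega> \<le> 1"
            by (cases "A \<omega> = 0 \<or> A \<omega> = top") (auto simp: inverse_mult_self_ennreal)
          then have "ennreal_powr (inverse (A \<omega>) * A \<omega>) p \<le> ennreal_powr 1 p"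
            using p0 by (intro ennreal_powr_mono) auto
          then show "ennreal_powr (inverse (A \<omega>) * A \<omega>) p \<le> 1"
            using ennreal_powr_ennreal[of 1 p] by simp
        qed auto
        finally show "(\<integral>\<^sup>+x. ennreal_powr (F x \<omega> / A \<omega>) p * A \<omega> \<partial>lborel) \<le> A \<omega>" by simp
      qed
      finally have R: "(\<integral>\<^sup>+x. \<integral>\<^sup>+\<omega>. ennreal_powr (F x \<omega> / A \<omega>) p * A \<omega> \<partial>lborel \<partial>lborel) \<le> ennreal S"
        using real by simp
      have "(\<integral>\<^sup>+x. ennreal_powr (\<integral>\<^sup>+\<omega>. F x \<omega> \<partial>lborel) p \<partial>lborel)
        \<le> (\<integral>\<^sup>+x. ennreal (S powr (p - 1)) * (\<integral>\<^sup>+\<omega>. ennreal_powr (F x \<omega> / A \<omega>) p * A \<omega> \<partial>lborel) \<partial>lborel)"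
        using pt by (rule nn_integral_mono_AE)
      also have "\<dots> \<le> ennreal (S powr (p - 1)) * ennreal S"
        using R by (subst nn_integral_cmult) (auto intro: mult_left_mono)
      also have "\<dots> = ennreal_powr (ennreal S) p"
        using S powr_add[of S "p - 1" 1] by (simp add: ennreal_powr_ennreal ennreal_mult[symmetric])
      finally have "Lp_norm p (\<lambda>x. \<integral>\<^sup>+\<omega>. F x \<omega> \<partial>lborel) \<le> ennreal_powr (ennreal_powr (ennreal S) p) (1 / p)"
        unfolding Lp_norm_def using p0 by (intro ennreal_powr_mono) auto
      also have "\<dots> = ennreal S"
        using p0 by (simp add: ennreal_powr_powr)
      finally show ?thesis using real by (simp add: A_def)
    qed
  qed
qed

section \<open>Smoothness along lines and decay of the Fourier transform\<close>

text \<open>Only iterated derivatives in one direction \<open>b\<close> are recorded: they suffice for integration by parts,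
  and their Leibniz rule is the one of a single variable. The majorant \<open>\<rho>\<close> is a parameter, common to
  all derivatives up to order \<open>k\<close>, in order that constants can be followed through products and
  translations.\<close>

primrec line_smooth :: "'a::euclidean_space \<Rightarrow> nat \<Rightarrow> ('a \<Rightarrow> real) \<Rightarrow> ('a \<Rightarrow> complex) \<Rightarrow> bool" where
  "line_smooth b 0 \<rho> h \<longleftrightarrow> continuous_on UNIV h \<and> (\<forall>t. norm (h t) \<le> \<rho> t)"
| "line_smooth b (Suc k) \<rho> h \<longleftrightarrow> continuous_on UNIV h \<and> (\<forall>t. norm (h t) \<le> \<rho> t) \<and>
     (\<exists>h'. (\<forall>t. ((\<lambda>r. h (t + r *\<^sub>R b)) has_vector_derivative h' t) (at 0)) \<and> line_smooth b k \<rho> h')"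

lemma line_smoothD:
  assumes "line_smooth b k \<rho> h"
  shows "continuous_on UNIV h" "norm (h t) \<le> \<rho> t"
  using assms by (cases k; auto)+

lemma line_smooth_SucI:
  assumes "line_smooth b k \<rho> h'" "\<And>t. norm (h t) \<le> \<rho> t" "continuous_on UNIV h"
    and "\<And>t. ((\<lambda>r. h (t + r *\<^sub>R b)) has_vector_derivative h' t) (at 0)"
  shows "line_smooth b (Suc k) \<rho> h"
  using assms by auto

lemma line_smooth_SucE:
  assumes "line_smooth b (Suc k) \<rho> h"
  obtains h' where "line_smooth b k \<rho> h'"
    "\<And>t. ((\<lambda>r. h (t + r *\<^sub>R b)) has_vector_derivative h' t) (at 0)"
  using assms by auto

lemma line_smooth_mono:
  "line_smooth b k \<rho> h \<Longrightarrow> (\<And>t. \<rho> t \<le> \<sigma> t) \<Longrightarrow> line_smooth b k \<sigma> h"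
proof (induction k arbitrary: h)
  case 0
  then show ?case by (auto intro: order_trans)
next
  case (Suc k)
  from Suc.prems(1) obtain h' where h': "line_smooth b k \<rho> h'"
    "\<And>t. ((\<lambda>r. h (t + r *\<^sub>R b)) has_vector_derivative h' t) (at 0)"
    by (rule line_smooth_SucE) blast
  show ?case
    using Suc.IH[OF h'(1) Suc.prems(2)] h'(2) line_smoothD[OF Suc.prems(1)] Suc.prems(2)
    by (intro line_smooth_SucI) (auto intro: order_trans)
qed

lemma line_smooth_pred: "line_smooth b (Suc k) \<rho> h \<Longrightarrow> line_smooth b k \<rho> h"
proof (induction k arbitrary: h)
  case (Suc k)
  from Suc.prems obtain h' where h': "line_smooth b (Suc k) \<rho> h'"
    "\<And>t. ((\<lambda>r. h (t + r *\<^sub>R b)) has_vector_derivative h' t) (at 0)"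
    by (rule line_smooth_SucE) blast
  show ?case
    using Suc.IH[OF h'(1)] h'(2) line_smoothD[OF Suc.prems]
    by (intro line_smooth_SucI) auto
qed auto

lemma line_smooth_add:
  "line_smooth b k \<rho> f \<Longrightarrow> line_smooth b k \<sigma> g \<Longrightarrow> line_smooth b k (\<lambda>t. \<rho> t + \<sigma> t) (\<lambda>t. f t + g t)"
proof (induction k arbitrary: f g)
  case 0
  then show ?case by (auto intro!: continuous_intros norm_triangle_mono)
next
  case (Suc k)
  from Suc.prems(1) obtain f' where f': "line_smooth b k \<rho> f'"
    "\<And>t. ((\<lambda>r. f (t + r *\<^sub>R b)) has_vector_derivative f' t) (at 0)"
    by (rule line_smooth_SucE) blast
  from Suc.prems(2) obtain g' where g': "line_smooth b k \<sigma> g'"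
    "\<And>t. ((\<lambda>r. g (t + r *\<^sub>R b)) has_vector_derivative g' t) (at 0)"
    by (rule line_smooth_SucE) blast
  show ?case
    using Suc.IH[OF f'(1) g'(1)] line_smoothD[OF Suc.prems(1)] line_smoothD[OF Suc.prems(2)]
    by (intro line_smooth_SucI[where h' = "\<lambda>t. f' t + g' t"])
       (auto intro!: continuous_intros norm_triangle_mono has_vector_derivative_add f' g')
qed

text \<open>The factor \<open>2 ^ k\<close> is the sum of the binomial coefficients in the Leibniz rule.\<close>

lemma line_smooth_mult:
  "line_smooth b k \<rho> f \<Longrightarrow> line_smooth b k \<sigma> g \<Longrightarrow> line_smooth b k (\<lambda>t. 2 ^ k * (\<rho> t * \<sigma> t)) (\<lambda>t. f t * g t)"
proof (induction k arbitrary: f g)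
  case 0
  have "norm (f t * g t) \<le> \<rho> t * \<sigma> t" for t
    using line_smoothD(2)[OF 0(1), of t] line_smoothD(2)[OF 0(2), of t]
    by (auto simp: norm_mult intro!: mult_mono intro: order_trans[OF norm_ge_zero])
  then show ?case using 0 by (auto intro!: continuous_intros)
next
  case (Suc k)
  from Suc.prems(1) obtain f' where f': "line_smooth b k \<rho> f'"
    "\<And>t. ((\<lambda>r. f (t + r *\<^sub>R b)) has_vector_derivative f' t) (at 0)"
    by (rule line_smooth_SucE) blast
  from Suc.prems(2) obtain g' where g': "line_smooth b k \<sigma> g'"
    "\<And>t. ((\<lambda>r. g (t + r *\<^sub>R b)) has_vector_derivative g' t) (at 0)"
    by (rule line_smooth_SucE) blast
  note D = line_smoothD[OF Suc.prems(1)] line_smoothD[OF Suc.prems(2)]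
  have nonneg: "0 \<le> \<rho> t" "0 \<le> \<sigma> t" for t
    using D(2)[of t] D(4)[of t] by (auto intro: order_trans[OF norm_ge_zero])
  have "line_smooth b k (\<lambda>t. 2 ^ Suc k * (\<rho> t * \<sigma> t)) (\<lambda>t. f t * g' t + f' t * g t)"
    using line_smooth_add[OF Suc.IH[OF line_smooth_pred[OF Suc.prems(1)] g'(1)] Suc.IH[OF f'(1) line_smooth_pred[OF Suc.prems(2)]]]
    by (simp add: mult_ac)
  moreover have "norm (f t * g t) \<le> 2 ^ Suc k * (\<rho> t * \<sigma> t)" for t
  proof -
    have "norm (f t * g t) \<le> 1 * (\<rho> t * \<sigma> t)"
      using D(2)[of t] D(4)[of t] nonneg by (auto simp: norm_mult intro!: mult_mono)
    also have "\<dots> \<le> 2 ^ Suc k * (\<rho> t * \<sigma> t)"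
      using nonneg[of t] one_le_power[of "2::real" "Suc k"] by (intro mult_right_mono) auto
    finally show ?thesis .
  qed
  moreover have "((\<lambda>r. f (t + r *\<^sub>R b) * g (t + r *\<^sub>R b)) has_vector_derivative f t * g' t + f' t * g t) (at 0)" for t
    using has_vector_derivative_mult[OF f'(2)[of t] g'(2)[of t]] by simp
  ultimately show ?case
    using D by (intro line_smooth_SucI[where h' = "\<lambda>t. f t * g' t + f' t * g t"]) (auto intro!: continuous_intros)
qed

lemma line_smooth_cmult:
  "line_smooth b k \<rho> h \<Longrightarrow> line_smooth b k (\<lambda>t. norm c * \<rho> t) (\<lambda>t. c * h t)"
proof (induction k arbitrary: h)
  case 0
  then show ?case by (auto intro!: continuous_intros mult_left_mono simp: norm_mult)
next
  case (Suc k)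
  from Suc.prems obtain h' where h': "line_smooth b k \<rho> h'"
    "\<And>t. ((\<lambda>r. h (t + r *\<^sub>R b)) has_vector_derivative h' t) (at 0)"
    by (rule line_smooth_SucE) blast
  show ?case
    using Suc.IH[OF h'(1)] line_smoothD[OF Suc.prems]
    by (intro line_smooth_SucI[where h' = "\<lambda>t. c * h' t"])
       (auto intro!: continuous_intros mult_left_mono has_vector_derivative_mult_right h' simp: norm_mult)
qed

lemma line_smooth_translate:
  "line_smooth b k \<rho> h \<Longrightarrow> line_smooth b k (\<lambda>t. \<rho> (t - x)) (\<lambda>t. h (t - x))"
proof (induction k arbitrary: h)
  case 0
  then show ?case by (auto intro!: continuous_intros continuous_on_compose2[of UNIV h])
next
  case (Suc k)
  from Suc.prems obtain h' where h': "line_smooth b k \<rho> h'"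
    "\<And>t. ((\<lambda>r. h (t + r *\<^sub>R b)) has_vector_derivative h' t) (at 0)"
    by (rule line_smooth_SucE) blast
  have "((\<lambda>r. h (t + r *\<^sub>R b - x)) has_vector_derivative h' (t - x)) (at 0)" for t
    using h'(2)[of "t - x"] by (simp add: algebra_simps)
  then show ?case
    using Suc.IH[OF h'(1)] line_smoothD[OF Suc.prems]
    by (intro line_smooth_SucI) (auto intro!: continuous_intros continuous_on_compose2[of UNIV h])
qed

lemma line_smooth_cnj:
  "line_smooth b k \<rho> h \<Longrightarrow> line_smooth b k \<rho> (\<lambda>t. cnj (h t))"
proof (induction k arbitrary: h)
  case 0
  then show ?case by (auto intro!: continuous_intros)
next
  case (Suc k)
  from Suc.prems obtain h' where h': "line_smooth b k \<rho> h'"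
    "\<And>t. ((\<lambda>r. h (t + r *\<^sub>R b)) has_vector_derivative h' t) (at 0)"
    by (rule line_smooth_SucE) blast
  show ?case
    using Suc.IH[OF h'(1)] line_smoothD[OF Suc.prems]
    by (intro line_smooth_SucI) (auto intro!: continuous_intros has_vector_derivative_cnj h')
qed

lemma line_smooth_schwartz:
  assumes "f \<in> schwartz_space" "b \<in> Basis"
  shows "\<exists>C>0. line_smooth b k (\<lambda>t. C / (1 + norm t) ^ l) f"
  using assms(1)
proof (induction k arbitrary: f)
  case 0
  then show ?case using schwartz_decay[OF 0, of l] schwartz_continuous[OF 0] by (auto intro: exI)
next
  case (Suc k)
  let ?f' = "\<lambda>x. frechet_derivative f (at x) b"
  from Suc.IH[OF schwartz_deriv[OF Suc.prems assms(2)]]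
  obtain C where C: "C > 0" "line_smooth b k (\<lambda>t. C / (1 + norm t) ^ l) ?f'" by blast
  obtain D where D: "D > 0" "\<And>x. norm (f x) \<le> D / (1 + norm x) ^ l"
    using schwartz_decay[OF Suc.prems] by blast
  have le: "C / (1 + norm t) ^ l \<le> (C + D) / (1 + norm t) ^ l" "D / (1 + norm t) ^ l \<le> (C + D) / (1 + norm t) ^ l" for t :: 'a
    using C(1) D(1) by (auto intro!: divide_right_mono)
  have "((\<lambda>r. f (t + r *\<^sub>R b)) has_vector_derivative ?f' t) (at 0)" for t
  proof -
    have "(f has_derivative frechet_derivative f (at t)) (at (t + 0 *\<^sub>R b))"
      using frechet_derivative_works[THEN iffD1, OF schwartz_differentiable[OF Suc.prems]] by simp
    moreover have "((\<lambda>r. t + r *\<^sub>R b) has_derivative (\<lambda>r. r *\<^sub>R b)) (at 0)"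
      by (auto intro!: derivative_eq_intros)
    ultimately have "((\<lambda>r. f (t + r *\<^sub>R b)) has_derivative (\<lambda>r. frechet_derivative f (at t) (r *\<^sub>R b))) (at 0)"
      by (rule has_derivative_compose[rotated])
    moreover have "linear (frechet_derivative f (at t))"
      using schwartz_differentiable[OF Suc.prems] linear_frechet_derivative by blast
    ultimately show ?thesis
      unfolding has_vector_derivative_def by (simp add: linear_scale)
  qed
  then show ?case
    using C D le schwartz_continuous[OF Suc.prems]
    by (intro exI[of _ "C + D"] conjI line_smooth_SucI[OF line_smooth_mono[OF C(2)]])
       (auto intro: order_trans[OF D(2)])
qed

text \<open>Integration by parts along \<open>b\<close> without splitting the integral into coordinates. A translation by
  \<open>r *\<^sub>R b\<close> multiplies the Fourier transform by \<open>cis (r * (\<xi> \<bullet> b))\<close>. On the other hand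
  \<open>h (t + r *\<^sub>R b) - h t\<close> is the integral of the derivative over the translations by \<open>u *\<^sub>R b\<close> with
  \<open>0 \<le> u \<le> r\<close>. Comparing the two Fourier transforms for one suitable \<open>r\<close> gives the formula.\<close>

lemma ft_derivative:
  fixes h h' :: "'a::euclidean_space \<Rightarrow> complex"
  assumes h: "integrable lborel h" "integrable lborel h'" "continuous_on UNIV h'"
    and der: "\<And>t. ((\<lambda>r. h (t + r *\<^sub>R b)) has_vector_derivative h' t) (at 0)"
  shows "ft h' \<xi> = \<i> * (\<xi> \<bullet> b) * ft h \<xi>"
proof -
  have [measurable]: "h \<in> borel_measurable borel" "h' \<in> borel_measurable borel"
    using h by auto
  have shift: "(\<integral>t. g (t + u *\<^sub>R b) * cis (- (t \<bullet> \<xi>)) \<partial>lborel) = cis (u * (\<xi> \<bullet> b)) * ft g \<xi>"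
    if g: "integrable lborel g" for g :: "'a \<Rightarrow> complex" and u
  proof -
    have "ft g \<xi> = (\<integral>t. g (u *\<^sub>R b + 1 *\<^sub>R t) * cis (- ((u *\<^sub>R b + 1 *\<^sub>R t) \<bullet> \<xi>)) \<partial>lborel)"
      unfolding ft_def
      by (subst lborel_integral_affine[of _ 1 "u *\<^sub>R b"]) (auto intro!: integrable_mult_cis g)
    also have "\<dots> = (\<integral>t. cis (- (u * (\<xi> \<bullet> b))) * (g (t + u *\<^sub>R b) * cis (- (t \<bullet> \<xi>))) \<partial>lborel)"
    proof (intro Bochner_Integration.integral_cong refl)
      fix t
      have "cis (- ((u *\<^sub>R b + 1 *\<^sub>R t) \<bullet> \<xi>)) = cis (- (u * (\<xi> \<bullet> b))) * cis (- (t \<bullet> \<xi>))"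
        by (simp add: cis_mult inner_add_left inner_commute[of \<xi>])
      then show "g (u *\<^sub>R b + 1 *\<^sub>R t) * cis (- ((u *\<^sub>R b + 1 *\<^sub>R t) \<bullet> \<xi>))
        = cis (- (u * (\<xi> \<bullet> b))) * (g (t + u *\<^sub>R b) * cis (- (t \<bullet> \<xi>)))"
        by (simp add: add.commute mult.left_commute)
    qed
    also have "\<dots> = cis (- (u * (\<xi> \<bullet> b))) * (\<integral>t. g (t + u *\<^sub>R b) * cis (- (t \<bullet> \<xi>)) \<partial>lborel)"
      by simp
    finally show ?thesis by (simp add: mult.assoc[symmetric] cis_mult)
  qed
  have der': "((\<lambda>r. h (t + r *\<^sub>R b)) has_vector_derivative h' (t + u *\<^sub>R b)) (at u within S)" for t u S
  proof -
    have "((\<lambda>r. h (t + u *\<^sub>R b + (r - u) *\<^sub>R b)) has_vector_derivative h' (t + u *\<^sub>R b)) (at u)"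
    proof -
      have 1: "((\<lambda>r. r - u) has_vector_derivative 1) (at u)"
        by (auto intro!: derivative_eq_intros)
      have 2: "((\<lambda>r. h (t + u *\<^sub>R b + r *\<^sub>R b)) has_vector_derivative h' (t + u *\<^sub>R b)) (at (u - u))"
        using der[of "t + u *\<^sub>R b"] by simp
      from vector_diff_chain_at[OF 1 2] show ?thesis by (simp add: o_def)
    qed
    then show ?thesis by (auto simp: algebra_simps intro: has_vector_derivative_at_within)
  qed
  have FTC: "h (t + r *\<^sub>R b) - h t = (\<integral>u. indicator {0..r} u *\<^sub>R h' (t + u *\<^sub>R b) \<partial>lborel)" if "0 \<le> r" for t r
  proof -
    have "continuous_on {0..r} (\<lambda>u. h' (t + u *\<^sub>R b))"
      by (intro continuous_on_compose2[OF h(3)] continuous_intros) auto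
    from integral_FTC_Icc[OF that der' this]
    show ?thesis by simp
  qed
  have eq: "(cis (r * (\<xi> \<bullet> b)) - 1) * ft h \<xi> = (\<integral>u. indicator {0..r} u *\<^sub>R cis (u * (\<xi> \<bullet> b)) \<partial>lborel) * ft h' \<xi>"
    if r: "0 \<le> r" for r
  proof -
    have K: "integrable (lborel \<Otimes>\<^sub>M lborel)
        (\<lambda>(u, t). indicator {0..r} u *\<^sub>R (h' (t + u *\<^sub>R b) * cis (- (t \<bullet> \<xi>))))"
    proof (rule integrable_pairI)
      have "(\<integral>\<^sup>+u. \<integral>\<^sup>+t. ennreal (norm (indicator {0..r} u *\<^sub>R (h' (t + u *\<^sub>R b) * cis (- (t \<bullet> \<xi>))))) \<partial>lborel \<partial>lborel)
        = (\<integral>\<^sup>+u. indicator {0..r} u * (\<integral>\<^sup>+t. ennreal (norm (h' (t + u *\<^sub>R b))) \<partial>lborel) \<partial>lborel)"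
        by (simp add: norm_mult ennreal_mult' ennreal_indicator nn_integral_cmult)
      also have "\<dots> = (\<integral>\<^sup>+u. indicator {0..r} u * (\<integral>\<^sup>+t. ennreal (norm (h' t)) \<partial>lborel) \<partial>lborel)"
        using nn_integral_lborel_affine[of "\<lambda>t. ennreal (norm (h' t))" 1 "_ *\<^sub>R b"] by (simp add: add.commute)
      also have "\<dots> = ennreal r * (\<integral>\<^sup>+t. ennreal (norm (h' t)) \<partial>lborel)"
        using r by (simp add: nn_integral_multc)
      also have "\<dots> < \<infinity>"
        using h(2) by (simp add: integrable_iff_bounded ennreal_mult_less_top)
      finally show "(\<integral>\<^sup>+u. \<integral>\<^sup>+t. ennreal (norm (indicator {0..r} u *\<^sub>R (h' (t + u *\<^sub>R b) * cis (- (t \<bullet> \<xi>))))) \<partial>lborel \<partial>lborel) < \<infinity>" .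
    qed measurable
    have hr: "integrable lborel (\<lambda>t. h (t + r *\<^sub>R b))"
      using lborel_integrable_affine[OF h(1), of 1 "r *\<^sub>R b"] by (simp add: add.commute)
    have "(cis (r * (\<xi> \<bullet> b)) - 1) * ft h \<xi> =
        (\<integral>t. h (t + r *\<^sub>R b) * cis (- (t \<bullet> \<xi>)) \<partial>lborel) - (\<integral>t. h t * cis (- (t \<bullet> \<xi>)) \<partial>lborel)"
      using shift[OF h(1), of r] by (simp add: ft_def left_diff_distrib)
    also have "\<dots> = (\<integral>t. (h (t + r *\<^sub>R b) - h t) * cis (- (t \<bullet> \<xi>)) \<partial>lborel)"
      by (subst Bochner_Integration.integral_diff[symmetric])
         (auto intro!: integrable_mult_cis h hr simp: left_diff_distrib)
    also have "\<dots> = (\<integral>t. \<integral>u. indicator {0..r} u *\<^sub>R (h' (t + u *\<^sub>R b) * cis (- (t \<bullet> \<xi>))) \<partial>lborel \<partial>lborel)"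
      by (simp add: FTC[OF r] flip: mult_scaleR_left)
    also have "\<dots> = (\<integral>u. \<integral>t. indicator {0..r} u *\<^sub>R (h' (t + u *\<^sub>R b) * cis (- (t \<bullet> \<xi>))) \<partial>lborel \<partial>lborel)"
      using lborel_pair.Fubini_integral[OF K] .
    also have "\<dots> = (\<integral>u. (indicator {0..r} u *\<^sub>R cis (u * (\<xi> \<bullet> b))) * ft h' \<xi> \<partial>lborel)"
      by (simp add: shift[OF h(2)])
    also have "\<dots> = (\<integral>u. indicator {0..r} u *\<^sub>R cis (u * (\<xi> \<bullet> b)) \<partial>lborel) * ft h' \<xi>"
      by (rule integral_mult_left_zero)
    finally show ?thesis .
  qed
  let ?a = "\<xi> \<bullet> b"
  have int_cis: "(\<integral>u. indicator {0..r} u *\<^sub>R cis (u * ?a) \<partial>lborel) * (\<i> * ?a) = cis (r * ?a) - 1" if "0 \<le> r" for r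
  proof -
    have "((\<lambda>u. cis (u * ?a)) has_vector_derivative (\<i> * ?a) * cis (u * ?a)) (at u within S)" for u S
    proof -
      have "((\<lambda>u::real. \<i> * of_real (u * ?a)) has_vector_derivative \<i> * ?a) (at u within S)"
        by (auto intro!: derivative_eq_intros)
      from field_vector_diff_chain_within[OF this DERIV_exp[THEN has_field_derivative_at_within]]
      show ?thesis by (simp add: o_def cis_conv_exp)
    qed
    moreover have "continuous_on {0..r} (\<lambda>u. (\<i> * ?a) * cis (u * ?a))"
      unfolding cis_conv_exp by (intro continuous_intros)
    ultimately have "(\<integral>u. indicator {0..r} u *\<^sub>R ((\<i> * ?a) * cis (u * ?a)) \<partial>lborel) = cis (r * ?a) - cis (0 * ?a)"
      by (intro integral_FTC_Icc that)
    moreover have "(\<integral>u. indicator {0..r} u *\<^sub>R ((\<i> * ?a) * cis (u * ?a)) \<partial>lborel)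
      = (\<integral>u. indicator {0..r} u *\<^sub>R cis (u * ?a) \<partial>lborel) * (\<i> * ?a)"
      unfolding integral_mult_left_zero[symmetric]
      by (intro Bochner_Integration.integral_cong) auto
    ultimately show ?thesis by simp
  qed
  show ?thesis
  proof (cases "?a = 0")
    case True
    have "(\<integral>u. indicator {0..1} u *\<^sub>R cis (u * ?a) \<partial>lborel) = (1::complex)"
      using True by simp
    then show ?thesis using eq[of 1] True by simp
  next
    case False
    \<comment> \<open>half a period, so that \<open>cis (r * ?a) - 1\<close> is not 0 and can be cancelled\<close>
    define r where "r = pi / \<bar>?a\<bar>"
    have "0 \<le> r" by (simp add: r_def)
    have "r * ?a = pi \<or> r * ?a = - pi"
      using False by (auto simp: r_def abs_if)
    then have r: "cis (r * ?a) = - 1" by (auto simp: complex_eq_iff)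
    let ?J = "\<integral>u. indicator {0..r} u *\<^sub>R cis (u * ?a) \<partial>lborel :: complex"
    have "(cis (r * ?a) - 1) * (\<i> * ?a) * ft h \<xi> = ((cis (r * ?a) - 1) * ft h \<xi>) * (\<i> * ?a)"
      by (simp only: mult_ac)
    also have "\<dots> = (?J * ft h' \<xi>) * (\<i> * ?a)"
      by (simp only: eq[OF \<open>0 \<le> r\<close>])
    also have "\<dots> = (?J * (\<i> * ?a)) * ft h' \<xi>"
      by (simp only: mult_ac)
    also have "\<dots> = (cis (r * ?a) - 1) * ft h' \<xi>"
      by (simp only: int_cis[OF \<open>0 \<le> r\<close>])
    finally have "(cis (r * ?a) - 1) * (\<i> * ?a) * ft h \<xi> = (cis (r * ?a) - 1) * ft h' \<xi>" .
    then show ?thesis unfolding r by (simp add: mult.assoc)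
  qed
qed

lemma line_smooth_integrable:
  assumes "line_smooth b k \<rho> h" "integrable lborel \<rho>"
  shows "integrable lborel h"
proof (rule Bochner_Integration.integrable_bound[OF assms(2)])
  show "h \<in> borel_measurable lborel"
    using line_smoothD(1)[OF assms(1)] by (simp add: borel_measurable_continuous_onI)
  have "norm (h t) \<le> norm (\<rho> t)" for t
    using line_smoothD(2)[OF assms(1), of t] by simp
  then show "AE t in lborel. norm (h t) \<le> norm (\<rho> t)" by simp
qed

lemma ft_line_smooth:
  assumes "line_smooth b k \<rho> h" "integrable lborel \<rho>"
  shows "\<bar>\<xi> \<bullet> b\<bar> ^ k * norm (ft h \<xi>) \<le> (\<integral>t. \<rho> t \<partial>lborel)"
  using assms(1)
proof (induction k arbitrary: h)
  case 0
  have "norm (ft h \<xi>) \<le> (\<integral>t. norm (h t * cis (- (t \<bullet> \<xi>))) \<partial>lborel)"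
    unfolding ft_def by (rule integral_norm_bound)
  also have "\<dots> \<le> (\<integral>t. \<rho> t \<partial>lborel)"
    using line_smooth_integrable[OF 0 assms(2)] line_smoothD(2)[OF 0] assms(2)
    by (intro integral_mono) (auto intro!: integrable_mult_cis simp: norm_mult)
  finally show ?case by simp
next
  case (Suc k)
  from Suc.prems obtain h' where h': "line_smooth b k \<rho> h'"
    "\<And>t. ((\<lambda>r. h (t + r *\<^sub>R b)) has_vector_derivative h' t) (at 0)"
    by (rule line_smooth_SucE) blast
  have "ft h' \<xi> = \<i> * (\<xi> \<bullet> b) * ft h \<xi>"
    using line_smooth_integrable[OF Suc.prems assms(2)] line_smooth_integrable[OF h'(1) assms(2)]
      line_smoothD(1)[OF h'(1)] h'(2) by (rule ft_derivative)
  then show ?case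
    using Suc.IH[OF h'(1)] by (simp add: norm_mult mult_ac)
qed

lemma le_kerI:
  fixes \<xi> :: "'a::euclidean_space"
  assumes "(1 + norm \<xi>) ^ (2 * DIM('a) + 1) * a \<le> c"
  shows "a \<le> c * ker \<xi>"
proof -
  have "0 < (1 + norm \<xi>) ^ (2 * DIM('a) + 1)"
    by (rule zero_less_power) simp
  then show ?thesis
    using assms by (simp only: ker_def times_divide_eq_right mult_1_right pos_le_divide_eq mult.commute[of a])
qed

text \<open>The largest of 1 and the coordinates \<open>\<bar>\<xi> \<bullet> b\<bar>\<close> dominates \<open>(1 + norm \<xi>) / (1 + DIM('a))\<close>, so
  integrating by parts in that single direction is enough.\<close>

lemma ft_ker_bound:
  fixes h :: "'a::euclidean_space \<Rightarrow> complex"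
  assumes h: "\<And>b. b \<in> Basis \<Longrightarrow> line_smooth b (2 * DIM('a) + 1) \<rho> h" and \<rho>: "integrable lborel \<rho>"
  shows "norm (ft h \<xi>) \<le> (1 + DIM('a)) ^ (2 * DIM('a) + 1) * (\<integral>t. \<rho> t \<partial>lborel) * ker \<xi>"
proof -
  let ?N = "2 * DIM('a) + 1"
  let ?I = "\<integral>t. \<rho> t \<partial>lborel"
  define m where "m = Max (insert 1 ((\<lambda>b. \<bar>\<xi> \<bullet> b\<bar>) ` Basis))"
  have m1: "1 \<le> m"
    unfolding m_def by (rule Max_ge) auto
  have m2: "\<bar>\<xi> \<bullet> b\<bar> \<le> m" if "b \<in> Basis" for b
    unfolding m_def using that by (intro Max_ge) auto
  have m3: "m \<in> insert 1 ((\<lambda>b. \<bar>\<xi> \<bullet> b\<bar>) ` Basis)"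
    unfolding m_def by (rule Max_in) auto
  \<comment> \<open>if no coordinate exceeds 1, the bound is the one by the integral of the absolute value\<close>
  obtain b0 :: 'a where "b0 \<in> Basis" using nonempty_Basis by blast
  have "line_smooth b0 0 \<rho> h" using line_smoothD[OF h[OF \<open>b0 \<in> Basis\<close>]] by simp
  from ft_line_smooth[OF this \<rho>] have "norm (ft h \<xi>) \<le> ?I" by simp
  then have 1: "m ^ ?N * norm (ft h \<xi>) \<le> ?I"
  proof (cases "m = 1")
    case False
    with m3 obtain b where b: "b \<in> Basis" "m = \<bar>\<xi> \<bullet> b\<bar>" by blast
    show ?thesis unfolding b(2) by (rule ft_line_smooth[OF h[OF b(1)] \<rho>])
  qed simp
  have 2: "(1 + norm \<xi>) ^ ?N \<le> ((1 + DIM('a)) * m) ^ ?N"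
  proof (intro power_mono)
    have "norm \<xi> \<le> (\<Sum>b\<in>(Basis::'a set). m)"
      using norm_le_l1[of \<xi>] by (rule order_trans) (intro sum_mono m2)
    then show "1 + norm \<xi> \<le> (1 + DIM('a)) * m"
      using m1 by (simp add: algebra_simps)
  qed auto
  have "(1 + norm \<xi>) ^ ?N * norm (ft h \<xi>) \<le> (1 + DIM('a)) ^ ?N * ?I"
  proof -
    have "(1 + norm \<xi>) ^ ?N * norm (ft h \<xi>) \<le> ((1 + DIM('a)) * m) ^ ?N * norm (ft h \<xi>)"
      by (intro mult_right_mono 2) simp
    also have "\<dots> = (1 + DIM('a)) ^ ?N * (m ^ ?N * norm (ft h \<xi>))"
      by (simp only: power_mult_distrib mult.assoc of_nat_power of_nat_add of_nat_1)
    also have "\<dots> \<le> (1 + DIM('a)) ^ ?N * ?I"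
      by (intro mult_left_mono 1) (rule of_nat_0_le_iff)
    finally show ?thesis .
  qed
  then show ?thesis by (rule le_kerI)
qed

section \<open>Rapidly decreasing functions and cutoffs\<close>

text \<open>The order of smoothness is the one that \<open>ker\<close> requires, while the decay is of every order. Schwartz
  functions qualify, and so do the cutoff functions below, which have finitely many derivatives.\<close>

definition rapidly_smooth :: "('a::euclidean_space \<Rightarrow> complex) \<Rightarrow> bool" where
  "rapidly_smooth f \<longleftrightarrow> (\<forall>l. \<exists>C>0. \<forall>b\<in>Basis. line_smooth b (2 * DIM('a) + 1) (\<lambda>t. C / (1 + norm t) ^ l) f)"

lemma rapidly_smoothI:
  fixes f :: "'a::euclidean_space \<Rightarrow> complex"
  assumes "\<And>l b. b \<in> Basis \<Longrightarrow> \<exists>C>0. line_smooth b (2 * DIM('a) + 1) (\<lambda>t. C / (1 + norm t) ^ l) f"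
  shows "rapidly_smooth f"
  unfolding rapidly_smooth_def
proof
  fix l
  obtain C where C: "\<And>b. b \<in> Basis \<Longrightarrow> 0 < C b"
    "\<And>b. b \<in> Basis \<Longrightarrow> line_smooth b (2 * DIM('a) + 1) (\<lambda>t. C b / (1 + norm t) ^ l) f"
    using assms[of _ l] by metis
  have "line_smooth b (2 * DIM('a) + 1) (\<lambda>t. (\<Sum>b\<in>Basis. C b) / (1 + norm t) ^ l) f" if b: "b \<in> Basis" for b
  proof (rule line_smooth_mono[OF C(2)[OF b]])
    fix t :: 'a
    have "C b \<le> (\<Sum>b\<in>Basis. C b)"
      using C(1) b by (intro member_le_sum) (auto intro: less_imp_le)
    then show "C b / (1 + norm t) ^ l \<le> (\<Sum>b\<in>Basis. C b) / (1 + norm t) ^ l"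
      by (intro divide_right_mono) auto
  qed
  moreover have "0 < (\<Sum>b\<in>(Basis::'a set). C b)"
    using C(1) by (intro sum_pos) auto
  ultimately show "\<exists>C>0. \<forall>b\<in>Basis. line_smooth b (2 * DIM('a) + 1) (\<lambda>t. C / (1 + norm t) ^ l) f"
    by blast
qed

lemma rapidly_smooth_schwartz: "f \<in> schwartz_space \<Longrightarrow> rapidly_smooth f"
  by (intro rapidly_smoothI line_smooth_schwartz)

lemma rapidly_smooth_cnj:
  fixes f :: "'a::euclidean_space \<Rightarrow> complex"
  shows "rapidly_smooth f \<Longrightarrow> rapidly_smooth (\<lambda>t. cnj (f t))"
proof (rule rapidly_smoothI)
  fix l and b :: 'a assume "rapidly_smooth f" "b \<in> Basis"
  then obtain C where "C > 0" "line_smooth b (2 * DIM('a) + 1) (\<lambda>t. C / (1 + norm t) ^ l) f"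
    unfolding rapidly_smooth_def by blast
  then show "\<exists>C>0. line_smooth b (2 * DIM('a) + 1) (\<lambda>t. C / (1 + norm t) ^ l) (\<lambda>t. cnj (f t))"
    using line_smooth_cnj by blast
qed

lemma has_derivative_max_power:
  assumes "1 \<le> j"
  shows "((\<lambda>x::real. max 0 x ^ Suc j) has_real_derivative real (Suc j) * max 0 x ^ j) (at x)"
proof -
  consider "x > 0" | "x < 0" | "x = 0" by linarith
  then show ?thesis
  proof cases
    case 1
    have "((\<lambda>x::real. x ^ Suc j) has_real_derivative real (Suc j) * x ^ j) (at x)"
      using DERIV_pow[of "Suc j" x] by simp
    then have "((\<lambda>x::real. max 0 x ^ Suc j) has_real_derivative real (Suc j) * x ^ j) (at x)"
      by (rule has_field_derivative_transform_within_open[where S = "{0<..}"]) (use 1 in auto)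
    then show ?thesis using 1 by simp
  next
    case 2
    have "((\<lambda>x::real. 0) has_real_derivative 0) (at x)" by simp
    then have "((\<lambda>x::real. max 0 x ^ Suc j) has_real_derivative 0) (at x)"
      by (rule has_field_derivative_transform_within_open[where S = "{..<0}"]) (use 2 in auto)
    then show ?thesis using 2 assms by (simp add: zero_power)
  next
    case 3
    have "((\<lambda>h. max 0 h ^ Suc j / h) \<longlongrightarrow> 0) (at (0::real))"
    proof (rule Lim_null_comparison)
      show "\<forall>\<^sub>F h::real in at 0. norm (max 0 h ^ Suc j / h) \<le> \<bar>h\<bar> ^ j"
        by (intro always_eventually allI) (auto simp: max_def abs_mult power_abs)
      have "((\<lambda>h::real. \<bar>h\<bar> ^ j) \<longlongrightarrow> \<bar>0\<bar> ^ j) (at 0)"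
        by (intro tendsto_intros)
      then show "((\<lambda>h::real. \<bar>h\<bar> ^ j) \<longlongrightarrow> 0) (at 0)"
        using assms by (simp add: zero_power)
    qed
    then show ?thesis using 3 assms by (simp add: has_field_derivative_iff zero_power)
  qed
qed

text \<open>A continuous function on a ball is bounded, and so is its product with any power of \<open>1 + norm t\<close>.\<close>

lemma compact_support_decay:
  fixes g :: "'a::euclidean_space \<Rightarrow> complex"
  assumes "continuous_on UNIV g" "\<And>t. r \<le> norm t \<Longrightarrow> g t = 0"
  shows "\<exists>C>0. \<forall>t. norm (g t) \<le> C / (1 + norm t) ^ l"
proof -
  have "compact ((\<lambda>t. (1 + norm t) ^ l *\<^sub>R g t) ` cball 0 r)"
    by (intro compact_continuous_image continuous_intros) (auto intro: continuous_on_subset[OF assms(1)])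
  then obtain B where B: "\<And>t. t \<in> cball 0 r \<Longrightarrow> norm ((1 + norm t) ^ l *\<^sub>R g t) \<le> B"
    by (metis (mono_tags, lifting) bounded_iff compact_imp_bounded imageI)
  have "norm (g t) \<le> (\<bar>B\<bar> + 1) / (1 + norm t) ^ l" for t
  proof (cases "t \<in> cball 0 r")
    case True
    from B[OF True] have "norm (g t) * (1 + norm t) ^ l \<le> \<bar>B\<bar> + 1"
      by (simp add: mult.commute)
    then show ?thesis by (simp add: pos_le_divide_eq)
  qed (use assms(2)[of t] in auto)
  then show ?thesis by (intro exI[of _ "\<bar>B\<bar> + 1"]) auto
qed

context
  fixes R :: real and m :: nat
begin

definition outer_power :: "'a::euclidean_space \<Rightarrow> real" where
  "outer_power t = max 0 ((norm t)\<^sup>2 - R)"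

definition inner_power :: "'a::euclidean_space \<Rightarrow> real" where
  "inner_power t = max 0 (1 - outer_power t ^ m)"

text \<open>Differentiating a product of powers of \<open>inner_power\<close>, \<open>outer_power\<close> and the coordinate \<open>t \<bullet> b\<close> gives
  products of the same kind, in which each power has dropped by at most one or vanished. Hence the
  induction over the order \<open>k\<close> works for all exponents exceeding \<open>k\<close> at the same time.\<close>

lemma cutoff_monomial_smooth:
  fixes b :: "'a::euclidean_space"
  assumes b: "b \<in> Basis" and "m \<ge> 1"
  shows "m \<ge> k + 1 \<Longrightarrow> j \<ge> k + 1 \<Longrightarrow> i = 0 \<or> i \<ge> k + 1 \<Longrightarrow>
    \<exists>C>0. line_smooth b k (\<lambda>t. C / (1 + norm t) ^ l)
      (\<lambda>t. of_real (inner_power t ^ j * outer_power t ^ i * (t \<bullet> b) ^ e))"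
proof (induction k arbitrary: i j e)
  have *: "continuous_on UNIV (\<lambda>t::'a. complex_of_real (inner_power t ^ j * outer_power t ^ i * (t \<bullet> b) ^ e))" for i j e
    unfolding inner_power_def outer_power_def by (intro continuous_intros)
  have **: "inner_power t ^ j * outer_power t ^ i * (t \<bullet> b) ^ e = 0" if "1 \<le> j" "1 + \<bar>R\<bar> \<le> norm t" for t i j e
  proof -
    have "1 + R \<le> (1 + \<bar>R\<bar>)\<^sup>2" 
      unfolding power2_sum one_power2 mult_1_right
      using abs_ge_self[of R] zero_le_power2[of "\<bar>R\<bar>"] abs_ge_zero[of R] by linarith
    also have "\<dots> \<le> (norm t)\<^sup>2" using that by (intro power_mono) auto
    finally have "1 \<le> outer_power t" by (simp add: outer_power_def)
    then have "inner_power t = 0" unfolding inner_power_def by simp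
    then show ?thesis using that by simp
  qed
  {
    case 0
    then show ?case
      using compact_support_decay[OF *[of j i e], of "1 + \<bar>R\<bar>" l] * **[of j _ i e] by (auto simp del: of_real_mult of_real_power)
  next
    case (Suc k)
    let ?G = "\<lambda>j i e (t::'a). complex_of_real (inner_power t ^ j * outer_power t ^ i * (t \<bullet> b) ^ e)"
    have ge: "k + 1 \<le> m" "k + 1 \<le> j - 1" "k + 1 \<le> j" "m - 1 + i = 0 \<or> k + 1 \<le> m - 1 + i"
      "i - 1 = 0 \<or> k + 1 \<le> i - 1" "i = 0 \<or> k + 1 \<le> i"
      using Suc.prems by auto
    obtain C1 where C1: "C1 > 0" "line_smooth b k (\<lambda>t. C1 / (1 + norm t) ^ l) (?G (j - 1) (m - 1 + i) (e + 1))"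
      using Suc.IH[OF ge(1,2,4)] by blast
    obtain C2 where C2: "C2 > 0" "line_smooth b k (\<lambda>t. C2 / (1 + norm t) ^ l) (?G j (i - 1) (e + 1))"
      using Suc.IH[OF ge(1,3,5)] by blast
    obtain C3 where C3: "C3 > 0" "line_smooth b k (\<lambda>t. C3 / (1 + norm t) ^ l) (?G j i (e - 1))"
      using Suc.IH[OF ge(1,3,6)] by blast
    have "1 \<le> j" using Suc.prems by simp
    from compact_support_decay[OF *[of j i e], of "1 + \<bar>R\<bar>" l] **[OF this, of _ i e]
    obtain C4 where C4: "C4 > 0" "\<And>t. norm (?G j i e t) \<le> C4 / (1 + norm t) ^ l"
      by (auto simp del: of_real_mult of_real_power)
    let ?a1 = "complex_of_real (- (2 * j * m))" and ?a2 = "complex_of_real (2 * i)" and ?a3 = "complex_of_real e"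
    define h' where "h' t = ?a1 * ?G (j - 1) (m - 1 + i) (e + 1) t + (?a2 * ?G j (i - 1) (e + 1) t + ?a3 * ?G j i (e - 1) t)" for t
    define C where "C = norm ?a1 * C1 + (norm ?a2 * C2 + norm ?a3 * C3) + C4"
    have C: "C > 0" using C1 C2 C3 C4 by (simp add: C_def add_nonneg_pos)
    have le: "norm ?a1 * (C1 / (1 + norm t) ^ l) + (norm ?a2 * (C2 / (1 + norm t) ^ l) + norm ?a3 * (C3 / (1 + norm t) ^ l)) \<le> C / (1 + norm t) ^ l"
      "C4 / (1 + norm t) ^ l \<le> C / (1 + norm t) ^ l" for t :: 'a
    proof -
      have "norm ?a1 * (C1 / (1 + norm t) ^ l) + (norm ?a2 * (C2 / (1 + norm t) ^ l) + norm ?a3 * (C3 / (1 + norm t) ^ l))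
        = (norm ?a1 * C1 + (norm ?a2 * C2 + norm ?a3 * C3)) / (1 + norm t) ^ l"
        by (simp add: add_divide_distrib)
      also have "\<dots> \<le> C / (1 + norm t) ^ l"
        using C4 by (intro divide_right_mono) (auto simp: C_def)
      finally show "norm ?a1 * (C1 / (1 + norm t) ^ l) + (norm ?a2 * (C2 / (1 + norm t) ^ l) + norm ?a3 * (C3 / (1 + norm t) ^ l)) \<le> C / (1 + norm t) ^ l" .
      show "C4 / (1 + norm t) ^ l \<le> C / (1 + norm t) ^ l"
        using C1 C2 C3 by (intro divide_right_mono) (auto simp: C_def)
    qed
    have "line_smooth b k (\<lambda>t. C / (1 + norm t) ^ l) h'"
      unfolding h'_def
      by (rule line_smooth_mono[OF line_smooth_add[OF line_smooth_cmult[OF C1(2)]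
            line_smooth_add[OF line_smooth_cmult[OF C2(2)] line_smooth_cmult[OF C3(2)]]] le(1)])
    moreover have "((\<lambda>r. ?G j i e (t + r *\<^sub>R b)) has_vector_derivative h' t) (at 0)" for t
    proof -
      let ?d = "t \<bullet> b"
      have bb: "b \<bullet> b = 1" using b by simp
      have u: "((\<lambda>r. (norm (t + r *\<^sub>R b))\<^sup>2 - R) has_real_derivative 2 * ?d) (at 0)"
      proof -
        have "(norm (t + r *\<^sub>R b))\<^sup>2 - R = t \<bullet> t + 2 * r * ?d + r\<^sup>2 - R" for r
          unfolding power2_norm_eq_inner
          using bb by (simp add: inner_add_left inner_add_right
              inner_commute[of b t] power2_eq_square algebra_simps)
        moreover have "((\<lambda>r. t \<bullet> t + 2 * r * ?d + r\<^sup>2 - R) has_real_derivative 2 * ?d) (at 0)"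
          by (auto intro!: derivative_eq_intros)
        ultimately show ?thesis by (simp only:)
      qed
      have U: "((\<lambda>r. outer_power (t + r *\<^sub>R b) ^ n) has_real_derivative 2 * n * outer_power t ^ (n - 1) * ?d) (at 0)"
        if n: "n = 0 \<or> 2 \<le> n" for n
      proof (cases "n = 0")
        case False
        then obtain n' where n': "n = Suc n'" "1 \<le> n'" using n by (cases n) auto
        from DERIV_chain2[OF has_derivative_max_power[OF n'(2)] u] show ?thesis
          by (simp add: outer_power_def n' algebra_simps)
      qed simp
      have "((\<lambda>r. 1 - outer_power (t + r *\<^sub>R b) ^ m) has_real_derivative - (2 * m * outer_power t ^ (m - 1) * ?d)) (at 0)"
        using DERIV_diff[OF DERIV_const[of 1] U[of m]] Suc.prems by simp
      moreover obtain j' where j': "j = Suc j'" "1 \<le> j'" using Suc.prems by (cases j) auto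
      ultimately have W: "((\<lambda>r. inner_power (t + r *\<^sub>R b) ^ j) has_real_derivative
          j * inner_power t ^ (j - 1) * (- (2 * m * outer_power t ^ (m - 1) * ?d))) (at 0)"
        using DERIV_chain2[OF has_derivative_max_power[OF j'(2)]] by (fastforce simp: inner_power_def)
      have L: "((\<lambda>r. ((t + r *\<^sub>R b) \<bullet> b) ^ e) has_real_derivative e * ?d ^ (e - 1)) (at 0)"
        using bb by (auto intro!: derivative_eq_intros simp: inner_add_left)
      have Ui: "((\<lambda>r. outer_power (t + r *\<^sub>R b) ^ i) has_real_derivative 2 * i * outer_power t ^ (i - 1) * ?d) (at 0)"
        using U[of i] Suc.prems by auto
      have "((\<lambda>r. inner_power (t + r *\<^sub>R b) ^ j * outer_power (t + r *\<^sub>R b) ^ i * ((t + r *\<^sub>R b) \<bullet> b) ^ e) has_real_derivative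
        - (2 * j * m) * (inner_power t ^ (j - 1) * outer_power t ^ (m - 1 + i) * ?d ^ (e + 1)) +
        (2 * i * (inner_power t ^ j * outer_power t ^ (i - 1) * ?d ^ (e + 1)) +
         e * (inner_power t ^ j * outer_power t ^ i * ?d ^ (e - 1)))) (at 0)"
        using DERIV_mult[OF DERIV_mult[OF W Ui] L] by (simp add: power_add algebra_simps)
      then have "((\<lambda>r. complex_of_real (inner_power (t + r *\<^sub>R b) ^ j * outer_power (t + r *\<^sub>R b) ^ i * ((t + r *\<^sub>R b) \<bullet> b) ^ e))
        has_vector_derivative complex_of_real (
        - (2 * j * m) * (inner_power t ^ (j - 1) * outer_power t ^ (m - 1 + i) * ?d ^ (e + 1)) +
        (2 * i * (inner_power t ^ j * outer_power t ^ (i - 1) * ?d ^ (e + 1)) +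
         e * (inner_power t ^ j * outer_power t ^ i * ?d ^ (e - 1))))) (at 0)"
        by (intro has_vector_derivative_of_real) (simp add: has_real_derivative_iff_has_vector_derivative)
      then show ?thesis by (simp add: h'_def)
    qed
    moreover have "norm (?G j i e t) \<le> C / (1 + norm t) ^ l" for t
      by (rule order_trans[OF C4(2) le(2)])
    ultimately have "line_smooth b (Suc k) (\<lambda>t. C / (1 + norm t) ^ l) (?G j i e)"
      by (intro line_smooth_SucI[OF _ _ *]) blast+
    with C show ?case by blast
  }
qed

end

text \<open>Equal to 1 for \<open>(norm t)\<^sup>2 \<le> R\<close>, equal to 0 for \<open>(norm t)\<^sup>2 \<ge> R + 1\<close>, and of the smoothness asked for by
  \<open>rapidly_smooth\<close>.\<close>

definition cutoff :: "real \<Rightarrow> 'a::euclidean_space \<Rightarrow> complex" where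
  "cutoff R t = of_real (inner_power R (2 * DIM('a) + 2) t ^ (2 * DIM('a) + 2))"

lemma rapidly_smooth_cutoff: "rapidly_smooth (cutoff R :: 'a::euclidean_space \<Rightarrow> complex)"
proof (rule rapidly_smoothI)
  fix l and b :: 'a assume "b \<in> Basis"
  from cutoff_monomial_smooth[OF this, of "2 * DIM('a) + 2" "2 * DIM('a) + 1" "2 * DIM('a) + 2" 0 l R 0]
  show "\<exists>C>0. line_smooth b (2 * DIM('a) + 1) (\<lambda>t. C / (1 + norm t) ^ l) (cutoff R)"
    unfolding cutoff_def by simp
qed

lemma cutoff_eq_1: "(norm t)\<^sup>2 \<le> R \<Longrightarrow> cutoff R t = 1"
  by (simp add: cutoff_def inner_power_def outer_power_def max_def)

lemma cutoff_eq_0: "R + 1 \<le> (norm t)\<^sup>2 \<Longrightarrow> cutoff R t = 0"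
proof -
  assume "R + 1 \<le> (norm t)\<^sup>2"
  then have "1 \<le> outer_power R t" by (simp add: outer_power_def)
  then have "1 \<le> outer_power R t ^ (2 * DIM('a) + 2)" by (rule one_le_power)
  then have "inner_power R (2 * DIM('a) + 2) t = 0"
    by (simp add: inner_power_def max_def del: power_Suc)
  then show ?thesis by (simp add: cutoff_def)
qed

section \<open>The reproducing formula\<close>

text \<open>A form of Hoelder's inequality that only uses \<open>r \<le> 1 + r powr p\<close> for \<open>r = F y / Lp_norm p F\<close>, together
  with \<open>ker \<le> 1\<close>. It treats all exponents alike, the case \<open>p = 1\<close> included.\<close>

lemma nn_integral_Lp_norm_ker_le:
  fixes F :: "'a::euclidean_space \<Rightarrow> ennreal"
  assumes p: "1 \<le> p" and [measurable]: "F \<in> borel_measurable borel"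
  shows "(\<integral>\<^sup>+y. F y * ennreal (ker (t - y)) \<partial>lborel) \<le> (1 + (\<integral>\<^sup>+y. ennreal (ker (y::'a)) \<partial>lborel)) * Lp_norm p F"
proof -
  let ?B = "Lp_norm p F" and ?K = "\<integral>\<^sup>+y. ennreal (ker (y::'a)) \<partial>lborel"
  have p0: "0 < p" using p by simp
  consider "?B = 0" | "?B = top" | "?B \<noteq> 0" "?B \<noteq> top" by blast
  then show ?thesis
  proof cases
    case 1
    have "AE x in lborel. F x = 0"
      using Lp_norm_eq_0_AE[of F p] 1 p0 by simp
    then have "AE y in lborel. F y * ennreal (ker (t - y)) = 0"
      by eventually_elim simp
    then have "(\<integral>\<^sup>+y. F y * ennreal (ker (t - y)) \<partial>lborel) = (\<integral>\<^sup>+(y::'a). 0 \<partial>lborel)"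
      by (rule nn_integral_cong_AE)
    then show ?thesis by simp
  next
    case 2
    then show ?thesis by (simp add: ennreal_mult_top)
  next
    case 3
    have pt: "F y * ennreal (ker (t - y)) \<le> ?B * (ennreal (ker (t - y)) + ennreal_powr (F y * inverse ?B) p)" for y
    proof -
      have "r * k \<le> k + ennreal_powr r p" if "k \<le> 1" for r k :: ennreal
      proof (cases "r \<le> 1")
        case True
        then have "r * k \<le> 1 * k" by (intro mult_right_mono) auto
        then show ?thesis by (simp add: add_increasing2)
      next
        case False
        have "r \<le> ennreal_powr r p"
        proof (cases r)
          case (real x)
          then have "\<not> ennreal x \<le> ennreal 1" using False by simp
          then have "1 \<le> x" by (metis ennreal_leI nle_le)
          then have "x powr 1 \<le> x powr p" using p by (intro powr_mono) auto
          then show ?thesis using real \<open>1 \<le> x\<close> by (simp add: ennreal_powr_ennreal ennreal_leI)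
        qed simp
        moreover have "r * k \<le> r * 1" using that by (intro mult_left_mono) auto
        ultimately show ?thesis by (simp add: add_increasing)
      qed
      \<comment> \<open>normalise \<open>F\<close> to have norm 1\<close>
      from this[of "ennreal (ker (t - y))" "F y * inverse ?B"]
      have "F y * inverse ?B * ennreal (ker (t - y)) \<le> ennreal (ker (t - y)) + ennreal_powr (F y * inverse ?B) p"
        by (simp add: ker_le_1)
      then have "?B * (F y * inverse ?B * ennreal (ker (t - y))) \<le> ?B * (ennreal (ker (t - y)) + ennreal_powr (F y * inverse ?B) p)"
        by (rule mult_left_mono) simp
      moreover have "?B * (F y * inverse ?B * ennreal (ker (t - y))) = (inverse ?B * ?B) * (F y * ennreal (ker (t - y)))"
        by (simp only: mult_ac)
      ultimately show ?thesis using inverse_mult_self_ennreal[OF 3] by simp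
    qed
    have "(\<integral>\<^sup>+y. F y * ennreal (ker (t - y)) \<partial>lborel) \<le> (\<integral>\<^sup>+y. ?B * (ennreal (ker (t - y)) + ennreal_powr (F y * inverse ?B) p) \<partial>lborel)"
      by (intro nn_integral_mono pt)
    also have "\<dots> = ?B * ((\<integral>\<^sup>+y. ennreal (ker (t - y)) \<partial>lborel) + (\<integral>\<^sup>+y. ennreal_powr (F y) p \<partial>lborel) * ennreal_powr (inverse ?B) p)"
      by (simp add: nn_integral_cmult nn_integral_add ennreal_powr_mult nn_integral_multc)
    also have "(\<integral>\<^sup>+y. ennreal (ker (t - y)) \<partial>lborel) = ?K"
      by (rule nn_integral_lborel_translate) simp
    also have "(\<integral>\<^sup>+y. ennreal_powr (F y) p \<partial>lborel) * ennreal_powr (inverse ?B) p = ennreal_powr (inverse ?B * ?B) p"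
      using p0 by (simp add: ennreal_powr_mult Lp_norm_powr mult.commute)
    also have "\<dots> = 1"
      using inverse_mult_self_ennreal[OF 3] ennreal_powr_ennreal[of 1 p] by simp
    finally show ?thesis by (simp add: mult.commute add.commute)
  qed
qed

lemma cnj_measurable [measurable]:
  "f \<in> borel_measurable M \<Longrightarrow> (\<lambda>x. cnj (f x)) \<in> borel_measurable M"
  by (rule measurable_compose[of f M borel cnj]) (auto intro!: borel_measurable_continuous_onI continuous_intros)

lemma fst_borel_measurable: "fst \<in> borel_measurable (borel :: ('a::topological_space \<times> 'b::topological_space) measure)"
  and snd_borel_measurable: "snd \<in> borel_measurable (borel :: ('a::topological_space \<times> 'b::topological_space) measure)"
  by (auto intro!: borel_measurable_continuous_onI continuous_intros)

locale window =
  fixes \<phi> :: "'a::euclidean_space \<Rightarrow> complex" and p :: real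
  assumes schwartz: "\<phi> \<in> schwartz_space" and nonzero: "\<phi> \<noteq> (\<lambda>_. 0)" and p: "1 \<le> p"
begin

text \<open>The short-time Fourier transform of a function. It agrees with \<^const>\<open>stft\<close> of the distribution that
  the function induces, see \<open>stft_distribution_of\<close>.\<close>

definition gabor :: "('a \<Rightarrow> complex) \<Rightarrow> 'a \<Rightarrow> 'a \<Rightarrow> complex" where
  "gabor f x \<xi> = ft (\<lambda>t. f t * cnj (\<phi> (t - x))) \<xi>"

text \<open>What is known about a member of the algebra before it has been shown to be bounded.\<close>

definition admissible :: "('a \<Rightarrow> complex) \<Rightarrow> bool" where
  "admissible f \<longleftrightarrow> continuous_on UNIV f \<and> (\<forall>x. integrable lborel (\<lambda>t. f t * cnj (\<phi> (t - x))))"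

text \<open>The inner norm, in the time variable, of the mixed norm that defines the modulation space.\<close>

definition slice :: "('a \<Rightarrow> complex) \<Rightarrow> 'a \<Rightarrow> ennreal" where
  "slice f \<xi> = Lp_norm p (\<lambda>x. ennreal (norm (gabor f x \<xi>)))"

definition energy :: real where "energy = (\<integral>t. (norm (\<phi> t))\<^sup>2 \<partial>lborel)"

lemma p_pos: "0 < p" using p by simp

lemma phi_continuous: "continuous_on UNIV \<phi>"
  by (rule schwartz_continuous[OF schwartz])

lemma phi_measurable [measurable]: "\<phi> \<in> borel_measurable borel"
  by (rule borel_measurable_continuous_onI[OF phi_continuous])

lemma phi_ker: obtains C where "0 < C" "\<And>t. norm (\<phi> t) \<le> C * ker t"
  using schwartz_decay[OF schwartz, of "2 * DIM('a) + 1"] by (auto simp: ker_def)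

lemma phi_integrable: "integrable lborel \<phi>"
proof -
  obtain C where C: "0 < C" "\<And>t. norm (\<phi> t) \<le> C * ker t" using phi_ker by blast
  have "integrable lborel (\<lambda>t::'a. C * ker t)" using integrable_ker[where 'a='a] by simp
  then show ?thesis
    by (rule Bochner_Integration.integrable_bound) (use C in auto)
qed

lemma phi_bounded: obtains C where "\<And>t. norm (\<phi> t) \<le> C"
proof -
  obtain C where C: "0 < C" "\<And>t. norm (\<phi> t) \<le> C * ker t" using phi_ker by blast
  have "norm (\<phi> t) \<le> C" for t
    using order_trans[OF C(2)[of t] mult_left_le[OF ker_le_1]] C(1) by simp
  then show thesis by (rule that)
qed

lemma energy_integrable: "integrable lborel (\<lambda>t. (norm (\<phi> t))\<^sup>2)"
proof -
  obtain C where C: "\<And>t. norm (\<phi> t) \<le> C" using phi_bounded by blast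
  have "integrable lborel (\<lambda>t. C * norm (\<phi> t))" using phi_integrable by simp
  then show ?thesis
    by (rule Bochner_Integration.integrable_bound)
       (auto simp: power2_eq_square abs_mult intro!: mult_mono intro: order_trans[OF C abs_ge_self])
qed

text \<open>A continuous function that vanishes almost everywhere vanishes identically.\<close>

lemma energy_pos: "0 < energy"
proof -
  obtain t0 where t0: "\<phi> t0 \<noteq> 0" using nonzero by auto
  have "energy \<noteq> 0"
  proof
    assume "energy = 0"
    then have "AE t in lborel. (norm (\<phi> t))\<^sup>2 = 0"
      unfolding energy_def using energy_integrable by (subst (asm) integral_nonneg_eq_0_iff_AE) auto
    then have "AE t in lebesgue. \<phi> t = 0"
      by (auto simp: AE_completion)
    moreover have "closed {t. \<phi> t = 0}"
      using continuous_closed_preimage_constant[OF phi_continuous, of 0] by simp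
    ultimately have "\<phi> t0 = 0"
      using mem_closed_if_AE_lebesgue[of "{t. \<phi> t = 0}" t0] by simp
    with t0 show False by simp
  qed
  moreover have "0 \<le> energy" unfolding energy_def by simp
  ultimately show ?thesis by simp
qed

lemma admissible_measurable: "admissible f \<Longrightarrow> f \<in> borel_measurable borel"
  by (simp add: admissible_def borel_measurable_continuous_onI)

lemma gabor_measurable:
  assumes "admissible f"
  shows "(\<lambda>z. gabor f (fst z) (snd z)) \<in> borel_measurable borel"
    and "(\<lambda>(x, \<xi>). gabor f x \<xi>) \<in> borel_measurable (borel \<Otimes>\<^sub>M borel)"
    and "gabor f x \<in> borel_measurable borel"
    and "(\<lambda>x. gabor f x \<xi>) \<in> borel_measurable borel"
proof -
  have [measurable]: "f \<in> borel_measurable borel" using assms by (rule admissible_measurable)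
  show 1[measurable]: "(\<lambda>(x, \<xi>). gabor f x \<xi>) \<in> borel_measurable (borel \<Otimes>\<^sub>M borel)"
    unfolding gabor_def ft_def by measurable
  show "(\<lambda>z. gabor f (fst z) (snd z)) \<in> borel_measurable borel"
    using 1 by (simp add: borel_prod split_beta')
  show "gabor f x \<in> borel_measurable borel" "(\<lambda>x. gabor f x \<xi>) \<in> borel_measurable borel"
    by measurable
qed

lemma slice_measurable: "admissible f \<Longrightarrow> slice f \<in> borel_measurable borel"
  unfolding slice_def using gabor_measurable(2)[of f] by measurable

text \<open>The windows \<open>\<phi> (t - y)\<close> decay like \<open>ker (t - y)\<close>, and the bound for the pairing with \<open>ker\<close> does not
  depend on the base point \<open>t\<close>.\<close>

lemma gabor_local_bound:
  "\<exists>C>0. \<forall>f t. admissible f \<longrightarrow>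
      (\<integral>\<^sup>+\<eta>. \<integral>\<^sup>+y. ennreal (norm (gabor f y \<eta>) * norm (\<phi> (t - y))) \<partial>lborel \<partial>lborel)
        \<le> ennreal C * (\<integral>\<^sup>+\<eta>. slice f \<eta> \<partial>lborel)"
proof -
  obtain C where C: "0 < C" "\<And>t. norm (\<phi> t) \<le> C * ker t" using phi_ker by blast
  let ?K = "\<integral>t. ker (t::'a) \<partial>lborel"
  have K: "0 \<le> ?K" by simp
  have eqK: "(\<integral>\<^sup>+y. ennreal (ker (y::'a)) \<partial>lborel) = ennreal ?K"
    using integrable_ker by (intro nn_integral_eq_integral) auto
  have "(\<integral>\<^sup>+\<eta>. \<integral>\<^sup>+y. ennreal (norm (gabor f y \<eta>) * norm (\<phi> (t - y))) \<partial>lborel \<partial>lborel)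
        \<le> ennreal (C * (1 + ?K)) * (\<integral>\<^sup>+\<eta>. slice f \<eta> \<partial>lborel)" if f: "admissible f" for f t
  proof -
    note [measurable] = gabor_measurable[OF f] slice_measurable[OF f]
    have "(\<integral>\<^sup>+y. ennreal (norm (gabor f y \<eta>) * norm (\<phi> (t - y))) \<partial>lborel) \<le> ennreal (C * (1 + ?K)) * slice f \<eta>" for \<eta>
    proof -
      have "(\<integral>\<^sup>+y. ennreal (norm (gabor f y \<eta>) * norm (\<phi> (t - y))) \<partial>lborel)
         \<le> (\<integral>\<^sup>+y. ennreal C * (ennreal (norm (gabor f y \<eta>)) * ennreal (ker (t - y))) \<partial>lborel)"
      proof (intro nn_integral_mono)
        fix y
        have "norm (gabor f y \<eta>) * norm (\<phi> (t - y)) \<le> C * (norm (gabor f y \<eta>) * ker (t - y))"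
          using mult_left_mono[OF C(2)[of "t - y"] norm_ge_zero[of "gabor f y \<eta>"]] by (simp add: mult_ac)
        then show "ennreal (norm (gabor f y \<eta>) * norm (\<phi> (t - y))) \<le> ennreal C * (ennreal (norm (gabor f y \<eta>)) * ennreal (ker (t - y)))"
          using C(1) by (simp add: ennreal_mult[symmetric] ennreal_leI)
      qed
      also have "\<dots> = ennreal C * (\<integral>\<^sup>+y. ennreal (norm (gabor f y \<eta>)) * ennreal (ker (t - y)) \<partial>lborel)"
        by (rule nn_integral_cmult) measurable
      also have "\<dots> \<le> ennreal C * ((1 + ennreal ?K) * slice f \<eta>)"
        unfolding slice_def eqK[symmetric] using p by (intro mult_left_mono nn_integral_Lp_norm_ker_le) auto
      also have "\<dots> = ennreal (C * (1 + ?K)) * slice f \<eta>"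
        using C(1) K by (simp add: ennreal_mult mult.assoc)
      finally show ?thesis .
    qed
    then have "(\<integral>\<^sup>+\<eta>. \<integral>\<^sup>+y. ennreal (norm (gabor f y \<eta>) * norm (\<phi> (t - y))) \<partial>lborel \<partial>lborel)
      \<le> (\<integral>\<^sup>+\<eta>. ennreal (C * (1 + ?K)) * slice f \<eta> \<partial>lborel)"
      by (intro nn_integral_mono)
    also have "\<dots> = ennreal (C * (1 + ?K)) * (\<integral>\<^sup>+\<eta>. slice f \<eta> \<partial>lborel)"
      by (rule nn_integral_cmult) measurable
    finally show ?thesis .
  qed
  moreover have "0 < C * (1 + ?K)" using C(1) K by (simp add: add_pos_nonneg)
  ultimately show ?thesis by blast
qed

text \<open>The contribution of the time-frequency point \<open>z = (\<eta>, y)\<close> to the reproducing formula at \<open>t\<close>.\<close>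

definition atom :: "('a \<Rightarrow> complex) \<Rightarrow> 'a \<Rightarrow> 'a \<times> 'a \<Rightarrow> complex" where
  "atom f t z = gabor f (snd z) (fst z) * (\<phi> (t - snd z) * cis (fst z \<bullet> t))"

lemma gabor_swap_measurable:
  assumes "admissible f"
  shows "(\<lambda>z. gabor f (snd z) (fst z)) \<in> borel_measurable borel"
proof -
  note [measurable] = gabor_measurable[OF assms]
  have "(\<lambda>z. (case (snd z, fst z) of (x, \<xi>) \<Rightarrow> gabor f x \<xi>)) \<in> borel_measurable (borel \<Otimes>\<^sub>M borel)"
    by measurable
  then show ?thesis by (simp add: borel_prod)
qed

lemma atom_measurable:
  assumes "admissible f"
  shows "atom f t \<in> borel_measurable borel" "case_prod (atom f) \<in> borel_measurable (borel \<Otimes>\<^sub>M borel)"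
proof -
  note [measurable] = gabor_swap_measurable[OF assms] fst_borel_measurable snd_borel_measurable
  show "atom f t \<in> borel_measurable borel" "case_prod (atom f) \<in> borel_measurable (borel \<Otimes>\<^sub>M borel)"
    unfolding atom_def by measurable
qed

lemma nn_integral_prod_lborel:
  fixes g :: "'a \<times> 'a \<Rightarrow> ennreal"
  assumes "g \<in> borel_measurable borel"
  shows "(\<integral>\<^sup>+z. g z \<partial>lborel) = (\<integral>\<^sup>+\<eta>. \<integral>\<^sup>+y. g (\<eta>, y) \<partial>lborel \<partial>lborel)"
proof -
  have "g \<in> borel_measurable (lborel \<Otimes>\<^sub>M lborel)"
    unfolding lborel_prod using assms by simp
  from lborel.nn_integral_fst[OF this] show ?thesis
    unfolding lborel_prod by (rule sym)
qed

lemma nn_integral_atom: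
  assumes "admissible f"
  shows "(\<integral>\<^sup>+z. ennreal (norm (atom f t z)) \<partial>lborel)
    = (\<integral>\<^sup>+\<eta>. \<integral>\<^sup>+y. ennreal (norm (gabor f y \<eta>) * norm (\<phi> (t - y))) \<partial>lborel \<partial>lborel)"
proof -
  have "(\<lambda>z. ennreal (norm (atom f t z))) \<in> borel_measurable borel"
    using atom_measurable(1)[OF assms] by measurable
  from nn_integral_prod_lborel[OF this] show ?thesis
    by (simp add: atom_def norm_mult)
qed

text \<open>Absolute integrability over the time-frequency plane makes \<open>gabor f y\<close> integrable for almost every
  \<open>y\<close> with \<open>\<phi> (t - y) \<noteq> 0\<close>. For these \<open>y\<close> Fourier inversion evaluates the inner integral to a multiple
  of \<open>f t * (norm (\<phi> (t - y)))\<^sup>2\<close>, and where \<open>\<phi> (t - y) = 0\<close> both sides are 0.\<close>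

lemma reproducing_formula:
  fixes f :: "'a \<Rightarrow> complex"
  assumes f: "admissible f" and fin: "(\<integral>\<^sup>+\<eta>. slice f \<eta> \<partial>lborel) < \<infinity>"
  shows "integrable lborel (atom f t)"
    and "(\<integral>z. atom f t z \<partial>lborel) = (2 * pi) ^ DIM('a) * energy * f t"
proof -
  obtain C where C: "0 < C" 
    "(\<integral>\<^sup>+\<eta>. \<integral>\<^sup>+y. ennreal (norm (gabor f y \<eta>) * norm (\<phi> (t - y))) \<partial>lborel \<partial>lborel)
        \<le> ennreal C * (\<integral>\<^sup>+\<eta>. slice f \<eta> \<partial>lborel)"
    using gabor_local_bound f by blast
  note [measurable] = atom_measurable[OF f] gabor_measurable[OF f]
  have "(\<integral>\<^sup>+z. ennreal (norm (atom f t z)) \<partial>lborel)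
    = (\<integral>\<^sup>+\<eta>. \<integral>\<^sup>+y. ennreal (norm (gabor f y \<eta>) * norm (\<phi> (t - y))) \<partial>lborel \<partial>lborel)"
    by (rule nn_integral_atom[OF f])
  also have "\<dots> < \<infinity>"
    using C(2) fin by (auto intro: le_less_trans simp: ennreal_mult_less_top)
  finally show i: "integrable lborel (atom f t)"
    by (intro integrableI_bounded) auto
  then have i': "integrable (lborel \<Otimes>\<^sub>M lborel) (\<lambda>(\<eta>, y). atom f t (\<eta>, y))"
    unfolding lborel_prod by simp
  have "(\<integral>z. atom f t z \<partial>lborel) = (\<integral>y. \<integral>\<eta>. atom f t (\<eta>, y) \<partial>lborel \<partial>lborel)"
    using lborel_pair.integral_snd[OF i'] unfolding lborel_prod by simp
  also have "\<dots> = (\<integral>y. (2 * pi) ^ DIM('a) * f t * of_real ((norm (\<phi> (t - y)))\<^sup>2) \<partial>lborel)"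
  proof (rule integral_cong_AE)
    show "AE y in lborel. (\<integral>\<eta>. atom f t (\<eta>, y) \<partial>lborel) = (2 * pi) ^ DIM('a) * f t * of_real ((norm (\<phi> (t - y)))\<^sup>2)"
      using lborel_pair.AE_integrable_snd[OF i']
    proof eventually_elim
      case (elim y)
      show ?case
      proof (cases "\<phi> (t - y) = 0")
        case False
        let ?h = "\<lambda>s. f s * cnj (\<phi> (s - y))"
        have "integrable lborel (\<lambda>\<eta>. inverse (\<phi> (t - y)) * atom f t (\<eta>, y))"
          using elim by simp
        then have "integrable lborel (gabor f y)"
          by (rule Bochner_Integration.integrable_bound)
             (use False in \<open>auto intro!: AE_I2 simp: atom_def norm_mult norm_inverse field_simps\<close>)
        moreover have "gabor f y = ft ?h"
          by (simp add: gabor_def fun_eq_iff)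
        moreover have "continuous_on UNIV ?h"
          using f phi_continuous unfolding admissible_def
          by (auto intro!: continuous_intros continuous_on_compose2[of UNIV \<phi>])
        moreover have "integrable lborel ?h"
          using f by (simp add: admissible_def)
        ultimately have "(\<integral>\<eta>. gabor f y \<eta> * cis (\<eta> \<bullet> t) \<partial>lborel) = (2 * pi) ^ DIM('a) * (f t * cnj (\<phi> (t - y)))"
          using fourier_inversion[of ?h t] by simp
        moreover have "(\<integral>\<eta>. atom f t (\<eta>, y) \<partial>lborel) = \<phi> (t - y) * (\<integral>\<eta>. gabor f y \<eta> * cis (\<eta> \<bullet> t) \<partial>lborel)"
          unfolding integral_mult_right_zero[symmetric] atom_def by (simp add: mult_ac)
        ultimately show ?thesis
          by (simp add: complex_norm_square[symmetric] mult_ac)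
      qed (simp add: atom_def)
    qed
  qed measurable
  also have "\<dots> = (2 * pi) ^ DIM('a) * f t * of_real (\<integral>y. (norm (\<phi> (t - y)))\<^sup>2 \<partial>lborel)"
    by (simp only: integral_mult_right_zero integral_complex_of_real)
  also have "(\<integral>y. (norm (\<phi> (t - y)))\<^sup>2 \<partial>lborel) = energy"
    unfolding energy_def using lborel_integral_affine[OF energy_integrable, of "-1" t] by simp
  finally show "(\<integral>z. atom f t z \<partial>lborel) = (2 * pi) ^ DIM('a) * energy * f t"
    by (simp add: mult_ac)
qed

definition frame_const :: real where "frame_const = (2 * pi) ^ DIM('a) * energy"

lemma frame_const_pos: "0 < frame_const"
  using energy_pos by (simp add: frame_const_def)

text \<open>Take absolute values in the reproducing formula.\<close>

lemma sup_bound: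
  "\<exists>C>0. \<forall>(f :: 'a \<Rightarrow> complex) t. admissible f \<longrightarrow> ennreal (norm (f t)) \<le> ennreal C * (\<integral>\<^sup>+\<eta>. slice f \<eta> \<partial>lborel)"
proof -
  obtain C where C: "0 < C" 
    "\<And>f t. admissible f \<Longrightarrow>
      (\<integral>\<^sup>+\<eta>. \<integral>\<^sup>+y. ennreal (norm (gabor f y \<eta>) * norm (\<phi> (t - y))) \<partial>lborel \<partial>lborel)
        \<le> ennreal C * (\<integral>\<^sup>+\<eta>. slice f \<eta> \<partial>lborel)"
    using gabor_local_bound by blast
  have "ennreal (norm (f t)) \<le> ennreal (C / frame_const) * (\<integral>\<^sup>+\<eta>. slice f \<eta> \<partial>lborel)" if f: "admissible f" for f :: "'a \<Rightarrow> complex" and t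
  proof (cases "(\<integral>\<^sup>+\<eta>. slice f \<eta> \<partial>lborel) < \<infinity>")
    case True
    note R = reproducing_formula[OF f True, of t]
    note [measurable] = atom_measurable[OF f]
    have "ennreal frame_const * ennreal (norm (f t)) = ennreal (norm (\<integral>z. atom f t z \<partial>lborel))"
      using frame_const_pos energy_pos unfolding R(2) by (simp add: norm_mult ennreal_mult[symmetric] frame_const_def norm_power)
    also have "\<dots> \<le> (\<integral>\<^sup>+z. ennreal (norm (atom f t z)) \<partial>lborel)"
      by (rule integral_norm_bound_ennreal[OF R(1)])
    also have "\<dots> = (\<integral>\<^sup>+\<eta>. \<integral>\<^sup>+y. ennreal (norm (gabor f y \<eta>) * norm (\<phi> (t - y))) \<partial>lborel \<partial>lborel)"
      by (rule nn_integral_atom[OF f])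
    also have "\<dots> \<le> ennreal C * (\<integral>\<^sup>+\<eta>. slice f \<eta> \<partial>lborel)"
      using C(2) f by blast
    finally have "ennreal (1 / frame_const) * (ennreal frame_const * ennreal (norm (f t)))
        \<le> ennreal (1 / frame_const) * (ennreal C * (\<integral>\<^sup>+\<eta>. slice f \<eta> \<partial>lborel))"
      by (rule mult_left_mono) simp
    then show ?thesis
      using frame_const_pos C(1) by (simp add: mult.assoc[symmetric] ennreal_mult[symmetric])
  next
    case False
    then have "(\<integral>\<^sup>+\<eta>. slice f \<eta> \<partial>lborel) = top" by (simp add: less_top[symmetric])
    then show ?thesis using C(1) frame_const_pos by (simp add: ennreal_mult_top)
  qed
  then show ?thesis using C(1) frame_const_pos by (intro exI[of _ "C / frame_const"]) auto
qed

text \<open>Multiply the reproducing formula by \<open>m\<close>, take Fourier transforms, and exchange the integrals: the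
  exponential \<open>cis (\<eta> \<bullet> t)\<close> of an atom shifts the frequency from \<open>\<xi>\<close> to \<open>\<xi> - \<eta>\<close>.\<close>

lemma ft_mult_bound:
  fixes f m :: "'a \<Rightarrow> complex"
  assumes f: "admissible f" and fin: "(\<integral>\<^sup>+\<eta>. slice f \<eta> \<partial>lborel) < \<infinity>"
    and m: "integrable lborel m"
  shows "ennreal frame_const * ennreal (norm (ft (\<lambda>t. f t * m t) \<xi>)) \<le>
    (\<integral>\<^sup>+\<eta>. \<integral>\<^sup>+y. ennreal (norm (gabor f y \<eta>) * norm (ft (\<lambda>t. m t * \<phi> (t - y)) (\<xi> - \<eta>))) \<partial>lborel \<partial>lborel)"
proof -
  obtain C where C: "0 < C" 
    "\<And>t. (\<integral>\<^sup>+\<eta>. \<integral>\<^sup>+y. ennreal (norm (gabor f y \<eta>) * norm (\<phi> (t - y))) \<partial>lborel \<partial>lborel)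
        \<le> ennreal C * (\<integral>\<^sup>+\<eta>. slice f \<eta> \<partial>lborel)"
    using gabor_local_bound f by blast
  have [measurable]: "f \<in> borel_measurable borel" "m \<in> borel_measurable borel"
    using admissible_measurable[OF f] m by auto
  note [measurable] = atom_measurable[OF f] gabor_measurable[OF f]
  note R = reproducing_formula[OF f fin]
  let ?G = "\<lambda>t z. m t * cis (- (t \<bullet> \<xi>)) * atom f t z"
  have G: "integrable (lborel \<Otimes>\<^sub>M lborel) (\<lambda>(t, z). ?G t z)"
  proof (rule integrable_pairI)
    have "(\<integral>\<^sup>+z. ennreal (norm (atom f t z)) \<partial>lborel) \<le> ennreal C * (\<integral>\<^sup>+\<eta>. slice f \<eta> \<partial>lborel)" for t
      using C(2)[of t] unfolding nn_integral_atom[OF f] .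
    then have "(\<integral>\<^sup>+t. \<integral>\<^sup>+z. ennreal (norm (?G t z)) \<partial>lborel \<partial>lborel)
      \<le> (\<integral>\<^sup>+t. ennreal (norm (m t)) * (ennreal C * (\<integral>\<^sup>+\<eta>. slice f \<eta> \<partial>lborel)) \<partial>lborel)"
      by (intro nn_integral_mono) (auto simp: norm_mult ennreal_mult' nn_integral_cmult intro!: mult_left_mono)
    also have "\<dots> = (\<integral>\<^sup>+t. ennreal (norm (m t)) \<partial>lborel) * (ennreal C * (\<integral>\<^sup>+\<eta>. slice f \<eta> \<partial>lborel))"
      by (rule nn_integral_multc) simp
    also have "\<dots> < \<infinity>"
      using m fin by (simp add: integrable_iff_bounded ennreal_mult_less_top)
    finally show "(\<integral>\<^sup>+t. \<integral>\<^sup>+z. ennreal (norm (?G t z)) \<partial>lborel \<partial>lborel) < \<infinity>" .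
  qed measurable
  have "frame_const * ft (\<lambda>t. f t * m t) \<xi> = (\<integral>t. \<integral>z. ?G t z \<partial>lborel \<partial>lborel)"
    unfolding ft_def integral_mult_right_zero[symmetric]
    by (intro Bochner_Integration.integral_cong) (auto simp: R(2) frame_const_def)
  also have "\<dots> = (\<integral>z. \<integral>t. ?G t z \<partial>lborel \<partial>lborel)"
    using lborel_pair.Fubini_integral[OF G] by simp
  also have "\<dots> = (\<integral>z. gabor f (snd z) (fst z) * ft (\<lambda>t. m t * \<phi> (t - snd z)) (\<xi> - fst z) \<partial>lborel)"
    unfolding ft_def integral_mult_right_zero[symmetric] atom_def
  proof (intro Bochner_Integration.integral_cong refl)
    fix z :: "'a \<times> 'a" and t
    have "cis (- (t \<bullet> (\<xi> - fst z))) = cis (- (t \<bullet> \<xi>)) * cis (fst z \<bullet> t)"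
      by (simp add: cis_mult inner_diff_right inner_commute[of t "fst z"])
    then show "m t * cis (- (t \<bullet> \<xi>)) * (gabor f (snd z) (fst z) * (\<phi> (t - snd z) * cis (fst z \<bullet> t)))
      = gabor f (snd z) (fst z) * (m t * \<phi> (t - snd z) * cis (- (t \<bullet> (\<xi> - fst z))))"
      by (simp only: mult_ac)
  qed
  finally have eq: "frame_const * ft (\<lambda>t. f t * m t) \<xi> =
    (\<integral>z. gabor f (snd z) (fst z) * ft (\<lambda>t. m t * \<phi> (t - snd z)) (\<xi> - fst z) \<partial>lborel)" (is "_ = (\<integral>z. ?H z \<partial>lborel)") .
  have H: "(\<lambda>z. ennreal (norm (?H z))) \<in> borel_measurable borel"
  proof -
    note [measurable] = gabor_swap_measurable[OF f] fst_borel_measurable snd_borel_measurable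
    show ?thesis unfolding ft_def by measurable
  qed
  have "ennreal frame_const * ennreal (norm (ft (\<lambda>t. f t * m t) \<xi>)) = ennreal (norm (\<integral>z. ?H z \<partial>lborel))"
    using frame_const_pos unfolding eq[symmetric] by (simp add: norm_mult ennreal_mult)
  also have "\<dots> \<le> (\<integral>\<^sup>+z. ennreal (norm (?H z)) \<partial>lborel)"
    by (cases "integrable lborel ?H") (auto simp: integral_norm_bound_ennreal not_integrable_integral_eq)
  also have "\<dots> = (\<integral>\<^sup>+\<eta>. \<integral>\<^sup>+y. ennreal (norm (gabor f y \<eta>) * norm (ft (\<lambda>t. m t * \<phi> (t - y)) (\<xi> - \<eta>))) \<partial>lborel \<partial>lborel)"
    using nn_integral_prod_lborel[OF H] by (simp add: norm_mult)
  finally show ?thesis .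
qed

end

section \<open>Weights and convolutions\<close>

text \<open>Equivalent to a power of the Japanese bracket, but submultiplicative with constant 1 for
  nonnegative exponents.\<close>

definition weight :: "real \<Rightarrow> 'a::euclidean_space \<Rightarrow> real" where
  "weight s \<xi> = (1 + norm \<xi>) powr s"

lemma weight_measurable [measurable]: "weight s \<in> borel_measurable borel"
  unfolding weight_def by (intro borel_measurable_continuous_onI continuous_intros) auto

lemma weight_ge_1: "0 \<le> s \<Longrightarrow> 1 \<le> weight s \<xi>"
  by (simp add: weight_def ge_one_powr_ge_zero)

lemma weight_nonneg [simp]: "0 \<le> weight s \<xi>"
  by (simp add: weight_def)

lemma weight_add: "0 \<le> s \<Longrightarrow> weight s (\<xi> + \<eta>) \<le> weight s \<xi> * weight s \<eta>"
proof -
  assume s: "0 \<le> s"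
  have "1 + norm (\<xi> + \<eta>) \<le> (1 + norm \<xi>) * (1 + norm \<eta>)"
    by (rule one_plus_norm_add_le)
  then show ?thesis
    unfolding weight_def using s by (subst powr_mult[symmetric]) (auto intro!: powr_mono2)
qed

lemma weight_ker_integral:
  assumes "s \<le> 1"
  shows "(\<integral>\<^sup>+t. ennreal (weight s t) * ennreal (ker (t::'a::euclidean_space)) \<partial>lborel) < \<infinity>"
proof -
  have "(\<integral>\<^sup>+t. ennreal (weight s t) * ennreal (ker (t::'a)) \<partial>lborel) \<le> (\<integral>\<^sup>+t. ennreal ((1 + norm (t::'a)) * ker t) \<partial>lborel)"
  proof (intro nn_integral_mono)
    fix t :: 'a
    have "weight s t \<le> (1 + norm t) powr 1"
      unfolding weight_def using assms by (intro powr_mono) auto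
    then have "weight s t * ker t \<le> (1 + norm t) * ker t"
      by (intro mult_right_mono) auto
    then show "ennreal (weight s t) * ennreal (ker t) \<le> ennreal ((1 + norm t) * ker t)"
      by (simp add: ennreal_mult[symmetric] ennreal_leI)
  qed
  then show ?thesis using nn_integral_norm_ker[where 'a='a] by (rule le_less_trans)
qed

lemma weighted_convolution_le:
  fixes F G :: "'a::euclidean_space \<Rightarrow> ennreal"
  assumes s: "0 \<le> s" and [measurable]: "F \<in> borel_measurable borel" "G \<in> borel_measurable borel"
  shows "(\<integral>\<^sup>+\<xi>. ennreal (weight s \<xi>) * (\<integral>\<^sup>+\<eta>. F \<eta> * G (\<xi> - \<eta>) \<partial>lborel) \<partial>lborel)
    \<le> (\<integral>\<^sup>+\<eta>. ennreal (weight s \<eta>) * F \<eta> \<partial>lborel) * (\<integral>\<^sup>+\<xi>. ennreal (weight s \<xi>) * G \<xi> \<partial>lborel)"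
proof -
  have "(\<integral>\<^sup>+\<xi>. ennreal (weight s \<xi>) * (\<integral>\<^sup>+\<eta>. F \<eta> * G (\<xi> - \<eta>) \<partial>lborel) \<partial>lborel)
    = (\<integral>\<^sup>+\<xi>. \<integral>\<^sup>+\<eta>. ennreal (weight s \<xi>) * (F \<eta> * G (\<xi> - \<eta>)) \<partial>lborel \<partial>lborel)"
    by (intro nn_integral_cong nn_integral_cmult[symmetric]) measurable
  also have "\<dots> \<le> (\<integral>\<^sup>+\<xi>. \<integral>\<^sup>+\<eta>. (ennreal (weight s \<eta>) * F \<eta>) * (ennreal (weight s (\<xi> - \<eta>)) * G (\<xi> - \<eta>)) \<partial>lborel \<partial>lborel)"
  proof (intro nn_integral_mono)
    fix \<xi> \<eta> :: 'a
    have "ennreal (weight s \<xi>) \<le> ennreal (weight s \<eta>) * ennreal (weight s (\<xi> - \<eta>))"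
      using weight_add[OF s, of \<eta> "\<xi> - \<eta>"] by (simp add: ennreal_mult[symmetric] ennreal_leI)
    then have "ennreal (weight s \<xi>) * (F \<eta> * G (\<xi> - \<eta>)) \<le> ennreal (weight s \<eta>) * ennreal (weight s (\<xi> - \<eta>)) * (F \<eta> * G (\<xi> - \<eta>))"
      by (rule mult_right_mono) simp
    then show "ennreal (weight s \<xi>) * (F \<eta> * G (\<xi> - \<eta>)) \<le> (ennreal (weight s \<eta>) * F \<eta>) * (ennreal (weight s (\<xi> - \<eta>)) * G (\<xi> - \<eta>))"
      by (simp only: mult_ac)
  qed
  also have "\<dots> = (\<integral>\<^sup>+\<eta>. \<integral>\<^sup>+\<xi>. (ennreal (weight s \<eta>) * F \<eta>) * (ennreal (weight s (\<xi> - \<eta>)) * G (\<xi> - \<eta>)) \<partial>lborel \<partial>lborel)"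
    by (rule lborel_pair.Fubini') measurable
  also have "\<dots> = (\<integral>\<^sup>+\<eta>. (ennreal (weight s \<eta>) * F \<eta>) * (\<integral>\<^sup>+\<xi>. ennreal (weight s (\<xi> - \<eta>)) * G (\<xi> - \<eta>) \<partial>lborel) \<partial>lborel)"
    by (intro nn_integral_cong nn_integral_cmult) measurable
  also have "\<dots> = (\<integral>\<^sup>+\<eta>. (ennreal (weight s \<eta>) * F \<eta>) * (\<integral>\<^sup>+\<xi>. ennreal (weight s \<xi>) * G \<xi> \<partial>lborel) \<partial>lborel)"
    by (intro nn_integral_cong arg_cong2[where f = "(*)"] refl nn_integral_lborel_translate(1)[of "\<lambda>\<xi>. ennreal (weight s \<xi>) * G \<xi>"]) measurable
  also have "\<dots> = (\<integral>\<^sup>+\<eta>. ennreal (weight s \<eta>) * F \<eta> \<partial>lborel) * (\<integral>\<^sup>+\<xi>. ennreal (weight s \<xi>) * G \<xi> \<partial>lborel)"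
    by (rule nn_integral_multc) measurable
  finally show ?thesis .
qed

text \<open>Minkowski's inequality, applied to the integral over \<open>\<eta>\<close> and to the integral over the translations
  \<open>z = x - y\<close>, which do not change the norm.\<close>

lemma mixed_young:
  fixes a :: "'a::euclidean_space \<Rightarrow> 'a \<Rightarrow> ennreal" and \<kappa> :: "'a \<Rightarrow> ennreal"
  assumes p: "1 \<le> p" and [measurable]: "case_prod a \<in> borel_measurable (borel \<Otimes>\<^sub>M borel)" "\<kappa> \<in> borel_measurable borel"
  shows "Lp_norm p (\<lambda>x. \<integral>\<^sup>+\<eta>. \<integral>\<^sup>+y. a y \<eta> * (ennreal (ker (x - y)) * \<kappa> (\<xi> - \<eta>)) \<partial>lborel \<partial>lborel)
    \<le> (\<integral>\<^sup>+z. ennreal (ker (z::'a)) \<partial>lborel) * (\<integral>\<^sup>+\<eta>. Lp_norm p (\<lambda>y. a y \<eta>) * \<kappa> (\<xi> - \<eta>) \<partial>lborel)"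
proof -
  have p0: "0 < p" using p by simp
  have pt: "Lp_norm p (\<lambda>x. a (x - z) \<eta> * (ennreal (ker z) * \<kappa> (\<xi> - \<eta>))) = ennreal (ker z) * (Lp_norm p (\<lambda>y. a y \<eta>) * \<kappa> (\<xi> - \<eta>))"
    for \<eta> z
  proof -
    have "Lp_norm p (\<lambda>x. a (x - z) \<eta> * (ennreal (ker z) * \<kappa> (\<xi> - \<eta>))) = Lp_norm p (\<lambda>x. a (x - z) \<eta>) * (ennreal (ker z) * \<kappa> (\<xi> - \<eta>))"
      using p0 by (intro Lp_norm_multc) auto
    also have "Lp_norm p (\<lambda>x. a (x - z) \<eta>) = Lp_norm p (\<lambda>y. a y \<eta>)"
      by (rule Lp_norm_translate[of "\<lambda>y. a y \<eta>"]) measurable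
    finally show ?thesis by (simp only: mult_ac)
  qed
  have "(\<integral>\<^sup>+y. a y \<eta> * (ennreal (ker (x - y)) * \<kappa> (\<xi> - \<eta>)) \<partial>lborel) =
      (\<integral>\<^sup>+z. a (x - z) \<eta> * (ennreal (ker z) * \<kappa> (\<xi> - \<eta>)) \<partial>lborel)" for x \<eta>
    using nn_integral_lborel_translate(2)[of "\<lambda>z. a (x - z) \<eta> * (ennreal (ker z) * \<kappa> (\<xi> - \<eta>))" x] by simp
  then have "Lp_norm p (\<lambda>x. \<integral>\<^sup>+\<eta>. \<integral>\<^sup>+y. a y \<eta> * (ennreal (ker (x - y)) * \<kappa> (\<xi> - \<eta>)) \<partial>lborel \<partial>lborel)
    = Lp_norm p (\<lambda>x. \<integral>\<^sup>+\<eta>. \<integral>\<^sup>+z. a (x - z) \<eta> * (ennreal (ker z) * \<kappa> (\<xi> - \<eta>)) \<partial>lborel \<partial>lborel)"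
    by simp
  also have "\<dots> \<le> (\<integral>\<^sup>+\<eta>. Lp_norm p (\<lambda>x. \<integral>\<^sup>+z. a (x - z) \<eta> * (ennreal (ker z) * \<kappa> (\<xi> - \<eta>)) \<partial>lborel) \<partial>lborel)"
    by (rule minkowski[OF p]) measurable
  also have "\<dots> \<le> (\<integral>\<^sup>+\<eta>. \<integral>\<^sup>+z. Lp_norm p (\<lambda>x. a (x - z) \<eta> * (ennreal (ker z) * \<kappa> (\<xi> - \<eta>))) \<partial>lborel \<partial>lborel)"
    by (intro nn_integral_mono minkowski[OF p]) measurable
  also have "\<dots> = (\<integral>\<^sup>+\<eta>. \<integral>\<^sup>+z. ennreal (ker (z::'a)) * (Lp_norm p (\<lambda>y. a y \<eta>) * \<kappa> (\<xi> - \<eta>)) \<partial>lborel \<partial>lborel)"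
    by (simp only: pt)
  also have "\<dots> = (\<integral>\<^sup>+\<eta>. (\<integral>\<^sup>+z. ennreal (ker (z::'a)) \<partial>lborel) * (Lp_norm p (\<lambda>y. a y \<eta>) * \<kappa> (\<xi> - \<eta>)) \<partial>lborel)"
    by (intro nn_integral_cong nn_integral_multc) measurable
  also have "\<dots> = (\<integral>\<^sup>+z. ennreal (ker (z::'a)) \<partial>lborel) * (\<integral>\<^sup>+\<eta>. Lp_norm p (\<lambda>y. a y \<eta>) * \<kappa> (\<xi> - \<eta>) \<partial>lborel)"
    by (rule nn_integral_cmult) measurable
  finally show ?thesis .
qed

section \<open>Products of translates\<close>

lemma ker_power: "1 / (1 + norm (t::'a::euclidean_space)) ^ ((2 * DIM('a) + 1) * j) = ker t ^ j"
  by (simp only: ker_def power_mult power_divide power_one)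

lemma ft_translated_ker_bound:
  fixes h :: "'a::euclidean_space \<Rightarrow> complex"
  assumes "\<And>b. b \<in> Basis \<Longrightarrow> line_smooth b (2 * DIM('a) + 1) (\<lambda>t. c * ker (t - x)) h"
  shows "norm (ft h \<xi>) \<le> real ((1 + DIM('a)) ^ (2 * DIM('a) + 1)) * (\<integral>t. ker (t::'a) \<partial>lborel) * c * ker \<xi>"
proof -
  have i: "integrable lborel (\<lambda>t::'a. ker (t - x))" "(\<integral>t. ker (t - x) \<partial>lborel) = (\<integral>t. ker (t::'a) \<partial>lborel)"
    using lborel_integrable_affine[OF integrable_ker, of 1 "- x"] lborel_integral_affine[OF integrable_ker, of 1 "- x"] by auto
  then have "integrable lborel (\<lambda>t. c * ker (t - x))" by (intro integrable_mult_right) auto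
  from ft_ker_bound[OF assms this, of \<xi>] show ?thesis
    unfolding integral_mult_right_zero i(2) by (simp only: mult_ac)
qed

lemma rapidly_smoothE:
  fixes \<alpha> :: "'a::euclidean_space \<Rightarrow> complex"
  assumes "rapidly_smooth \<alpha>"
  obtains A where "A > 0" "\<And>b. b \<in> Basis \<Longrightarrow> line_smooth b (2 * DIM('a) + 1) (\<lambda>t. A * ker t ^ j) \<alpha>"
proof -
  let ?N = "2 * DIM('a) + 1"
  from assms obtain A where A: "A > 0" "\<And>b. b \<in> Basis \<Longrightarrow> line_smooth b ?N (\<lambda>t. A / (1 + norm t) ^ (?N * j)) \<alpha>"
    unfolding rapidly_smooth_def by blast
  have "A / (1 + norm t) ^ (?N * j) = A * ker t ^ j" for t :: 'a
    unfolding ker_power[symmetric] by simp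
  then have "line_smooth b ?N (\<lambda>t. A * ker t ^ j) \<alpha>" if "b \<in> Basis" for b
    using A(2)[OF that] by (simp only:)
  with A(1) show thesis by (rule that)
qed

text \<open>A point \<open>t\<close> cannot be close to both \<open>x\<close> and \<open>z\<close> if these are far apart. This converts decay around
  the two points into decay in their distance.\<close>

lemma ker_split: "ker (t - z) * ker (t - x) \<le> ker (x - z)"
  using ker_mult_le[of "t - z" "- (t - x)"] unfolding ker_minus by simp

text \<open>Two powers of \<open>ker (t - x)\<close> are available for \<open>\<beta>\<close>: one is traded for \<open>ker (x - z)\<close> by \<open>ker_split\<close>,
  the other one stays to make the majorant integrable.\<close>

lemma ft_product2:
  fixes \<alpha> \<beta> :: "'a::euclidean_space \<Rightarrow> complex"
  assumes "rapidly_smooth \<alpha>" "rapidly_smooth \<beta>"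
  shows "\<exists>C>0. \<forall>x z \<xi>. norm (ft (\<lambda>t. \<alpha> (t - z) * \<beta> (t - x)) \<xi>) \<le> C * ker (x - z) * ker \<xi>"
proof -
  let ?N = "2 * DIM('a) + 1"
  obtain A where A: "A > 0" "\<And>b. b \<in> Basis \<Longrightarrow> line_smooth b ?N (\<lambda>t. A * ker t ^ 1) \<alpha>"
    using rapidly_smoothE[OF assms(1)] by blast
  obtain B where B: "B > 0" "\<And>b. b \<in> Basis \<Longrightarrow> line_smooth b ?N (\<lambda>t. B * ker t ^ 2) \<beta>"
    using rapidly_smoothE[OF assms(2)] by blast
  let ?C = "2 ^ ?N * (A * B)"
  let ?D = "real ((1 + DIM('a)) ^ ?N) * (\<integral>t. ker (t::'a) \<partial>lborel)"
  have bound: "norm (ft (\<lambda>t. \<alpha> (t - z) * \<beta> (t - x)) \<xi>) \<le> ?D * (?C * ker (x - z)) * ker \<xi>" for x z \<xi>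
  proof (rule ft_translated_ker_bound)
    fix b :: 'a assume b: "b \<in> Basis"
    show "line_smooth b ?N (\<lambda>t. ?C * ker (x - z) * ker (t - x)) (\<lambda>t. \<alpha> (t - z) * \<beta> (t - x))"
    proof (rule line_smooth_mono[OF line_smooth_mult[OF line_smooth_translate[OF A(2)[OF b]] line_smooth_translate[OF B(2)[OF b]]]])
      fix t
      have "?C * ker (t - x) * (ker (t - z) * ker (t - x)) \<le> ?C * ker (t - x) * ker (x - z)"
        using A(1) B(1) by (intro mult_left_mono ker_split) auto
      then show "2 ^ ?N * (A * ker (t - z) ^ 1 * (B * (ker (t - x))\<^sup>2)) \<le> ?C * ker (x - z) * ker (t - x)"
        by (simp only: power2_eq_square power_one_right mult_ac)
    qed
  qed
  have nn: "0 \<le> ?D * ?C"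
    using A(1) B(1) by (intro mult_nonneg_nonneg of_nat_0_le_iff) auto
  show ?thesis
  proof (intro exI[of _ "?D * ?C + 1"] conjI allI)
    fix x z \<xi> :: 'a
    have "?D * (?C * ker (x - z)) * ker \<xi> = (?D * ?C) * (ker (x - z) * ker \<xi>)"
      by (simp only: mult_ac)
    also have "\<dots> \<le> (?D * ?C + 1) * (ker (x - z) * ker \<xi>)"
      by (intro mult_right_mono) auto
    finally show "norm (ft (\<lambda>t. \<alpha> (t - z) * \<beta> (t - x)) \<xi>) \<le> (?D * ?C + 1) * ker (x - z) * ker \<xi>"
      using bound[of z x \<xi>] by (simp only: mult.assoc)
  qed (use nn in linarith)
qed

text \<open>As for two factors, with one power of \<open>ker (t - x)\<close> traded for each of the two distances.\<close>

lemma ft_product3: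
  fixes \<alpha> \<beta> \<gamma> :: "'a::euclidean_space \<Rightarrow> complex"
  assumes "rapidly_smooth \<alpha>" "rapidly_smooth \<beta>" "rapidly_smooth \<gamma>"
  shows "\<exists>C>0. \<forall>x y z \<xi>. norm (ft (\<lambda>t. \<gamma> (t - x) * \<beta> (t - y) * \<alpha> (t - z)) \<xi>) \<le> C * ker (x - y) * ker (x - z) * ker \<xi>"
proof -
  let ?N = "2 * DIM('a) + 1"
  obtain A where A: "A > 0" "\<And>b. b \<in> Basis \<Longrightarrow> line_smooth b ?N (\<lambda>t. A * ker t ^ 1) \<alpha>"
    using rapidly_smoothE[OF assms(1)] by blast
  obtain B where B: "B > 0" "\<And>b. b \<in> Basis \<Longrightarrow> line_smooth b ?N (\<lambda>t. B * ker t ^ 1) \<beta>"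
    using rapidly_smoothE[OF assms(2)] by blast
  obtain G where G: "G > 0" "\<And>b. b \<in> Basis \<Longrightarrow> line_smooth b ?N (\<lambda>t. G * ker t ^ 3) \<gamma>"
    using rapidly_smoothE[OF assms(3)] by blast
  let ?C = "2 ^ ?N * (2 ^ ?N * (G * B) * A)"
  let ?D = "real ((1 + DIM('a)) ^ ?N) * (\<integral>t. ker (t::'a) \<partial>lborel)"
  have bound: "norm (ft (\<lambda>t. \<gamma> (t - x) * \<beta> (t - y) * \<alpha> (t - z)) \<xi>) \<le> ?D * (?C * (ker (x - y) * ker (x - z))) * ker \<xi>" for x y z \<xi>
  proof (rule ft_translated_ker_bound)
    fix b :: 'a assume b: "b \<in> Basis"
    show "line_smooth b ?N (\<lambda>t. ?C * (ker (x - y) * ker (x - z)) * ker (t - x)) (\<lambda>t. \<gamma> (t - x) * \<beta> (t - y) * \<alpha> (t - z))"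
    proof (rule line_smooth_mono[OF line_smooth_mult[OF line_smooth_mult[OF line_smooth_translate[OF G(2)[OF b]] line_smooth_translate[OF B(2)[OF b]]]
            line_smooth_translate[OF A(2)[OF b]]]])
      fix t
      have "?C * ker (t - x) * ((ker (t - y) * ker (t - x)) * (ker (t - z) * ker (t - x))) \<le> ?C * ker (t - x) * (ker (x - y) * ker (x - z))"
        using A(1) B(1) G(1) by (intro mult_left_mono mult_mono ker_split) auto
      then show "2 ^ ?N * (2 ^ ?N * (G * ker (t - x) ^ 3 * (B * ker (t - y) ^ 1)) * (A * ker (t - z) ^ 1)) \<le> ?C * (ker (x - y) * ker (x - z)) * ker (t - x)"
        by (simp only: power3_eq_cube power_one_right mult_ac)
    qed
  qed
  have nn: "0 \<le> ?D * ?C"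
    using A(1) B(1) G(1) by (intro mult_nonneg_nonneg of_nat_0_le_iff) auto
  show ?thesis
  proof (intro exI[of _ "?D * ?C + 1"] conjI allI)
    fix x y z \<xi> :: 'a
    have "?D * (?C * (ker (x - y) * ker (x - z))) * ker \<xi> = (?D * ?C) * (ker (x - y) * ker (x - z) * ker \<xi>)"
      by (simp only: mult_ac)
    also have "\<dots> \<le> (?D * ?C + 1) * (ker (x - y) * ker (x - z) * ker \<xi>)"
      by (intro mult_right_mono) auto
    finally show "norm (ft (\<lambda>t. \<gamma> (t - x) * \<beta> (t - y) * \<alpha> (t - z)) \<xi>) \<le> (?D * ?C + 1) * ker (x - y) * ker (x - z) * ker \<xi>"
      using bound[of x y z \<xi>] by (simp only: mult.assoc)
  qed (use nn in linarith)
qed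

context window
begin

section \<open>Multiplication in the modulation space\<close>

definition mnorm :: "real \<Rightarrow> ('a \<Rightarrow> complex) \<Rightarrow> ennreal" where
  "mnorm s f = (\<integral>\<^sup>+\<xi>. ennreal (weight s \<xi>) * slice f \<xi> \<partial>lborel)"

lemma slice_le_mnorm:
  assumes "0 \<le> s"
  shows "(\<integral>\<^sup>+\<xi>. slice f \<xi> \<partial>lborel) \<le> mnorm s f"
  unfolding mnorm_def
proof (intro nn_integral_mono)
  fix \<xi>
  have "1 * slice f \<xi> \<le> ennreal (weight s \<xi>) * slice f \<xi>"
    using weight_ge_1[OF assms, of \<xi>] by (intro mult_right_mono) (auto simp: ennreal_leI simp flip: ennreal_1)
  then show "slice f \<xi> \<le> ennreal (weight s \<xi>) * slice f \<xi>" by simp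
qed

lemma admissibleI:
  assumes "continuous_on UNIV f" "\<And>t. norm (f t) \<le> B"
  shows "admissible f"
  unfolding admissible_def
proof (intro conjI allI assms(1))
  fix x
  have "integrable lborel (\<lambda>t. \<phi> (t - x))"
    using lborel_integrable_affine[OF phi_integrable, of 1 "- x"] by simp
  then have i: "integrable lborel (\<lambda>t. B * norm (\<phi> (t - x)))" by simp
  have [measurable]: "f \<in> borel_measurable borel"
    using assms(1) by (rule borel_measurable_continuous_onI)
  have le: "norm (f t * cnj (\<phi> (t - x))) \<le> norm (B * norm (\<phi> (t - x)))" for t
  proof -
    have "norm (f t) \<le> \<bar>B\<bar>" using assms(2)[of t] by linarith
    from mult_right_mono[OF this norm_ge_zero[of "\<phi> (t - x)"]] show ?thesis
      by (simp add: norm_mult abs_mult)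
  qed
  show "integrable lborel (\<lambda>t. f t * cnj (\<phi> (t - x)))"
    by (rule Bochner_Integration.integrable_bound[OF i _ AE_I2[OF le]]) measurable
qed

lemma phi_rapid: "rapidly_smooth \<phi>" "rapidly_smooth (\<lambda>t. cnj (\<phi> t))"
  using rapidly_smooth_schwartz[OF schwartz] rapidly_smooth_cnj by blast+

lemma bounded_if_mnorm_finite:
  fixes f :: "'a \<Rightarrow> complex"
  assumes "admissible f" "0 \<le> s" "mnorm s f < \<infinity>"
  shows "\<exists>B. \<forall>t. norm (f t) \<le> B"
proof -
  obtain C where C: "0 < C" "\<And>t. ennreal (norm (f t)) \<le> ennreal C * (\<integral>\<^sup>+\<eta>. slice f \<eta> \<partial>lborel)"
    using sup_bound assms(1) by blast
  have "(\<integral>\<^sup>+\<eta>. slice f \<eta> \<partial>lborel) < \<infinity>"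
    using slice_le_mnorm[OF assms(2), of f] assms(3) by (rule le_less_trans)
  then obtain S where S: "(\<integral>\<^sup>+\<eta>. slice f \<eta> \<partial>lborel) = ennreal S" "0 \<le> S"
    by (cases "\<integral>\<^sup>+\<eta>. slice f \<eta> \<partial>lborel") auto
  have "norm (f t) \<le> C * S" for t
    using C(2)[of t] C(1) S by (simp add: ennreal_mult[symmetric])
  then show ?thesis by blast
qed

text \<open>Reduces estimates of the norm to pointwise estimates of the short-time Fourier transform: the
  convolution in the time variable is absorbed by \<open>mixed_young\<close>, the one in the frequency variable by
  \<open>weighted_convolution_le\<close>.\<close>

lemma mnorm_le_convolution:
  fixes a :: "'a \<Rightarrow> 'a \<Rightarrow> ennreal"
  assumes s: "0 \<le> s"
    and [measurable]: "case_prod a \<in> borel_measurable (borel \<Otimes>\<^sub>M borel)" "\<kappa> \<in> borel_measurable borel"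
    and le: "\<And>x \<xi>. ennreal (norm (gabor h x \<xi>)) \<le> ennreal c *
      (\<integral>\<^sup>+\<eta>. \<integral>\<^sup>+y. a y \<eta> * (ennreal (ker (x - y)) * \<kappa> (\<xi> - \<eta>)) \<partial>lborel \<partial>lborel)"
  shows "mnorm s h \<le> ennreal c * (\<integral>\<^sup>+z. ennreal (ker (z::'a)) \<partial>lborel) *
    ((\<integral>\<^sup>+\<eta>. ennreal (weight s \<eta>) * Lp_norm p (\<lambda>y. a y \<eta>) \<partial>lborel) * (\<integral>\<^sup>+\<xi>. ennreal (weight s \<xi>) * \<kappa> \<xi> \<partial>lborel))"
proof -
  let ?A = "\<lambda>\<eta>. Lp_norm p (\<lambda>y. a y \<eta>)" and ?K = "\<integral>\<^sup>+z. ennreal (ker (z::'a)) \<partial>lborel"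
  have [measurable]: "?A \<in> borel_measurable borel" by measurable
  have "slice h \<xi> \<le> ennreal c * ?K * (\<integral>\<^sup>+\<eta>. ?A \<eta> * \<kappa> (\<xi> - \<eta>) \<partial>lborel)" for \<xi>
  proof -
    have "slice h \<xi> \<le> Lp_norm p (\<lambda>x. ennreal c * (\<integral>\<^sup>+\<eta>. \<integral>\<^sup>+y. a y \<eta> * (ennreal (ker (x - y)) * \<kappa> (\<xi> - \<eta>)) \<partial>lborel \<partial>lborel))"
      unfolding slice_def using p_pos by (intro Lp_norm_mono le)
    also have "\<dots> = ennreal c * Lp_norm p (\<lambda>x. \<integral>\<^sup>+\<eta>. \<integral>\<^sup>+y. a y \<eta> * (ennreal (ker (x - y)) * \<kappa> (\<xi> - \<eta>)) \<partial>lborel \<partial>lborel)"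
      using p_pos by (intro Lp_norm_cmult) measurable
    also have "\<dots> \<le> ennreal c * (?K * (\<integral>\<^sup>+\<eta>. ?A \<eta> * \<kappa> (\<xi> - \<eta>) \<partial>lborel))"
      by (intro mult_left_mono mixed_young p) auto
    finally show ?thesis by (simp only: mult.assoc)
  qed
  then have "mnorm s h \<le> (\<integral>\<^sup>+\<xi>. ennreal (weight s \<xi>) * (ennreal c * ?K * (\<integral>\<^sup>+\<eta>. ?A \<eta> * \<kappa> (\<xi> - \<eta>) \<partial>lborel)) \<partial>lborel)"
    unfolding mnorm_def by (intro nn_integral_mono mult_left_mono) auto
  also have "\<dots> = (\<integral>\<^sup>+\<xi>. (ennreal c * ?K) * (ennreal (weight s \<xi>) * (\<integral>\<^sup>+\<eta>. ?A \<eta> * \<kappa> (\<xi> - \<eta>) \<partial>lborel)) \<partial>lborel)"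
    by (simp only: mult_ac)
  also have "\<dots> = (ennreal c * ?K) * (\<integral>\<^sup>+\<xi>. ennreal (weight s \<xi>) * (\<integral>\<^sup>+\<eta>. ?A \<eta> * \<kappa> (\<xi> - \<eta>) \<partial>lborel) \<partial>lborel)"
    by (rule nn_integral_cmult) measurable
  also have "\<dots> \<le> (ennreal c * ?K) * ((\<integral>\<^sup>+\<eta>. ennreal (weight s \<eta>) * ?A \<eta> \<partial>lborel) * (\<integral>\<^sup>+\<xi>. ennreal (weight s \<xi>) * \<kappa> \<xi> \<partial>lborel))"
    by (intro mult_left_mono weighted_convolution_le s) auto
  finally show ?thesis .
qed

lemma ker_mass_finite: "(\<integral>\<^sup>+z. ennreal (ker (z::'a)) \<partial>lborel) < \<infinity>"
  using integrable_ker[where 'a='a] by (simp add: integrable_iff_bounded)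

text \<open>Cutting \<open>g\<close> by a single window leaves nothing that decays in the distance to a second window. The
  reproducing formula for \<open>g\<close> brings in a third window, whose position is integrated out, and the
  product of three windows decays in both distances from \<open>x\<close>.\<close>

lemma ft_two_windows:
  fixes g :: "'a \<Rightarrow> complex"
  assumes g: "admissible g" and fin: "(\<integral>\<^sup>+\<eta>. slice g \<eta> \<partial>lborel) < \<infinity>"
  shows "\<exists>C>0. \<forall>x y \<zeta>. ennreal (norm (ft (\<lambda>t. g t * cnj (\<phi> (t - x)) * \<phi> (t - y)) \<zeta>))
    \<le> ennreal (C * ker (x - y)) * (\<integral>\<^sup>+\<eta>. slice g \<eta> * ennreal (ker (\<zeta> - \<eta>)) \<partial>lborel)"
proof -
  note [measurable] = gabor_measurable[OF g] slice_measurable[OF g]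
  obtain D where D: "D > 0" "\<And>x y z \<xi>. norm (ft (\<lambda>t. cnj (\<phi> (t - x)) * \<phi> (t - y) * \<phi> (t - z)) \<xi>) \<le> D * ker (x - y) * ker (x - z) * ker \<xi>"
    using ft_product3[OF phi_rapid(1) phi_rapid(1) phi_rapid(2)] by auto
  obtain K where K: "(\<integral>\<^sup>+z. ennreal (ker (z::'a)) \<partial>lborel) = ennreal K" "0 \<le> K"
    using ker_mass_finite by (cases "\<integral>\<^sup>+z. ennreal (ker (z::'a)) \<partial>lborel") auto
  have "ennreal (norm (ft (\<lambda>t. g t * cnj (\<phi> (t - x)) * \<phi> (t - y)) \<zeta>))
    \<le> ennreal (1 / frame_const * (D * (1 + K)) * ker (x - y)) * (\<integral>\<^sup>+\<eta>. slice g \<eta> * ennreal (ker (\<zeta> - \<eta>)) \<partial>lborel)" for x y \<zeta>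
  proof -
    let ?m = "\<lambda>t. cnj (\<phi> (t - x)) * \<phi> (t - y)"
    have m: "integrable lborel ?m"
    proof -
      have "admissible (\<lambda>t. \<phi> (t - y))"
        using phi_continuous phi_bounded by (metis admissibleI continuous_on_compose2[OF phi_continuous continuous_on_diff[OF continuous_on_id continuous_on_const] subset_UNIV])
      then show ?thesis by (simp add: admissible_def mult.commute)
    qed
    have "ennreal frame_const * ennreal (norm (ft (\<lambda>t. g t * ?m t) \<zeta>)) \<le>
      (\<integral>\<^sup>+\<eta>. \<integral>\<^sup>+z. ennreal (norm (gabor g z \<eta>) * norm (ft (\<lambda>t. ?m t * \<phi> (t - z)) (\<zeta> - \<eta>))) \<partial>lborel \<partial>lborel)"
      by (rule ft_mult_bound[OF g fin m])
    also have "\<dots> \<le> (\<integral>\<^sup>+\<eta>. \<integral>\<^sup>+z. ennreal (D * ker (x - y) * ker (\<zeta> - \<eta>)) * (ennreal (norm (gabor g z \<eta>)) * ennreal (ker (x - z))) \<partial>lborel \<partial>lborel)"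
    proof (intro nn_integral_mono)
      fix \<eta> z :: 'a
      have "norm (gabor g z \<eta>) * norm (ft (\<lambda>t. ?m t * \<phi> (t - z)) (\<zeta> - \<eta>))
        \<le> norm (gabor g z \<eta>) * (D * ker (x - y) * ker (x - z) * ker (\<zeta> - \<eta>))"
        by (intro mult_left_mono D(2)) auto
      then have "ennreal (norm (gabor g z \<eta>) * norm (ft (\<lambda>t. ?m t * \<phi> (t - z)) (\<zeta> - \<eta>)))
        \<le> ennreal ((D * ker (x - y) * ker (\<zeta> - \<eta>)) * (norm (gabor g z \<eta>) * ker (x - z)))"
        by (intro ennreal_leI) (simp only: mult_ac)
      also have "\<dots> = ennreal (D * ker (x - y) * ker (\<zeta> - \<eta>)) * (ennreal (norm (gabor g z \<eta>)) * ennreal (ker (x - z)))"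
        using D(1) by (simp add: ennreal_mult)
      finally show "ennreal (norm (gabor g z \<eta>) * norm (ft (\<lambda>t. ?m t * \<phi> (t - z)) (\<zeta> - \<eta>)))
        \<le> ennreal (D * ker (x - y) * ker (\<zeta> - \<eta>)) * (ennreal (norm (gabor g z \<eta>)) * ennreal (ker (x - z)))" .
    qed
    also have "\<dots> = (\<integral>\<^sup>+\<eta>. ennreal (D * ker (x - y) * ker (\<zeta> - \<eta>)) * (\<integral>\<^sup>+z. ennreal (norm (gabor g z \<eta>)) * ennreal (ker (x - z)) \<partial>lborel) \<partial>lborel)"
      by (intro nn_integral_cong nn_integral_cmult) measurable
    also have "\<dots> \<le> (\<integral>\<^sup>+\<eta>. ennreal (D * ker (x - y) * ker (\<zeta> - \<eta>)) * ((1 + ennreal K) * slice g \<eta>) \<partial>lborel)"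
      unfolding slice_def K(1)[symmetric] using p by (intro nn_integral_mono mult_left_mono nn_integral_Lp_norm_ker_le) auto
    also have "\<dots> = (\<integral>\<^sup>+\<eta>. ennreal (D * (1 + K) * ker (x - y)) * (slice g \<eta> * ennreal (ker (\<zeta> - \<eta>))) \<partial>lborel)"
    proof (intro nn_integral_cong)
      fix \<eta>
      have "ennreal (D * ker (x - y) * ker (\<zeta> - \<eta>)) * ((1 + ennreal K) * slice g \<eta>)
        = (ennreal (D * ker (x - y) * ker (\<zeta> - \<eta>)) * ennreal (1 + K)) * slice g \<eta>"
        using K(2) by (simp add: mult.assoc)
      also have "ennreal (D * ker (x - y) * ker (\<zeta> - \<eta>)) * ennreal (1 + K) = ennreal (D * (1 + K) * ker (x - y)) * ennreal (ker (\<zeta> - \<eta>))"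
        using D(1) K(2) by (simp add: ennreal_mult[symmetric] mult_ac del: ennreal_plus)
      finally show "ennreal (D * ker (x - y) * ker (\<zeta> - \<eta>)) * ((1 + ennreal K) * slice g \<eta>) = ennreal (D * (1 + K) * ker (x - y)) * (slice g \<eta> * ennreal (ker (\<zeta> - \<eta>)))"
        by (simp only: mult_ac)
    qed
    also have "\<dots> = ennreal (D * (1 + K) * ker (x - y)) * (\<integral>\<^sup>+\<eta>. slice g \<eta> * ennreal (ker (\<zeta> - \<eta>)) \<partial>lborel)"
      by (rule nn_integral_cmult) measurable
    finally have "ennreal (1 / frame_const) * (ennreal frame_const * ennreal (norm (ft (\<lambda>t. g t * ?m t) \<zeta>)))
      \<le> ennreal (1 / frame_const) * (ennreal (D * (1 + K) * ker (x - y)) * (\<integral>\<^sup>+\<eta>. slice g \<eta> * ennreal (ker (\<zeta> - \<eta>)) \<partial>lborel))"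
      by (rule mult_left_mono) simp
    moreover have "ennreal (1 / frame_const) * (ennreal frame_const * ennreal (norm (ft (\<lambda>t. g t * ?m t) \<zeta>))) = ennreal (norm (ft (\<lambda>t. g t * cnj (\<phi> (t - x)) * \<phi> (t - y)) \<zeta>))"
      using frame_const_pos by (simp add: mult.assoc[symmetric] ennreal_mult[symmetric])
    moreover have "ennreal (1 / frame_const) * (ennreal (D * (1 + K) * ker (x - y)) * (\<integral>\<^sup>+\<eta>. slice g \<eta> * ennreal (ker (\<zeta> - \<eta>)) \<partial>lborel))
      = ennreal (1 / frame_const * (D * (1 + K)) * ker (x - y)) * (\<integral>\<^sup>+\<eta>. slice g \<eta> * ennreal (ker (\<zeta> - \<eta>)) \<partial>lborel)"
      using frame_const_pos D(1) K(2) by (simp only: mult.assoc[symmetric]) (simp add: ennreal_mult[symmetric] mult.assoc del: ennreal_plus)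
    ultimately show ?thesis by simp
  qed
  moreover have "0 < 1 / frame_const * (D * (1 + K))"
    using frame_const_pos D(1) K(2) by (simp add: add_pos_nonneg)
  ultimately show ?thesis by blast
qed

text \<open>In the reproducing formula for \<open>f\<close>, multiplied by \<open>g\<close> and a window, each atom of \<open>f\<close> contributes \<open>g\<close>
  cut by two windows. Hence \<open>gabor (\<lambda>t. f t * g t)\<close> is dominated by a convolution of \<open>gabor f\<close>.\<close>

lemma mnorm_mult_finite:
  fixes f g :: "'a \<Rightarrow> complex"
  assumes s: "0 \<le> s" "s \<le> 1" and f: "admissible f" "mnorm s f < \<infinity>" and g: "admissible g" "mnorm s g < \<infinity>"
  shows "mnorm s (\<lambda>t. f t * g t) < \<infinity>"
proof -
  have finf: "(\<integral>\<^sup>+\<eta>. slice f \<eta> \<partial>lborel) < \<infinity>" and fing: "(\<integral>\<^sup>+\<eta>. slice g \<eta> \<partial>lborel) < \<infinity>"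
    using slice_le_mnorm[OF s(1)] f(2) g(2) by (blast intro: le_less_trans)+
  note [measurable] = gabor_measurable[OF f(1)] slice_measurable[OF f(1)] slice_measurable[OF g(1)]
  obtain C where C: "C > 0" "\<And>x y \<zeta>. ennreal (norm (ft (\<lambda>t. g t * cnj (\<phi> (t - x)) * \<phi> (t - y)) \<zeta>))
    \<le> ennreal (C * ker (x - y)) * (\<integral>\<^sup>+\<eta>. slice g \<eta> * ennreal (ker (\<zeta> - \<eta>)) \<partial>lborel)"
    using ft_two_windows[OF g(1) fing] by blast
  define \<kappa> where "\<kappa> \<zeta> = (\<integral>\<^sup>+\<eta>. slice g \<eta> * ennreal (ker (\<zeta> - \<eta>)) \<partial>lborel)" for \<zeta>
  have [measurable]: "\<kappa> \<in> borel_measurable borel"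
    unfolding \<kappa>_def by measurable
  have "(\<integral>\<^sup>+\<xi>. ennreal (weight s \<xi>) * \<kappa> \<xi> \<partial>lborel) \<le> mnorm s g * (\<integral>\<^sup>+t. ennreal (weight s t) * ennreal (ker (t::'a)) \<partial>lborel)"
    unfolding \<kappa>_def mnorm_def by (rule weighted_convolution_le[OF s(1)]) measurable
  then have \<kappa>_fin: "(\<integral>\<^sup>+\<xi>. ennreal (weight s \<xi>) * \<kappa> \<xi> \<partial>lborel) < \<infinity>"
    using g(2) weight_ker_integral[OF s(2), where 'a='a] by (auto simp: ennreal_mult_less_top intro: le_less_trans)
  have "mnorm s (\<lambda>t. f t * g t) \<le> ennreal (C / frame_const) * (\<integral>\<^sup>+z. ennreal (ker (z::'a)) \<partial>lborel) *
    ((\<integral>\<^sup>+\<eta>. ennreal (weight s \<eta>) * Lp_norm p (\<lambda>y. ennreal (norm (gabor f y \<eta>))) \<partial>lborel) * (\<integral>\<^sup>+\<xi>. ennreal (weight s \<xi>) * \<kappa> \<xi> \<partial>lborel))"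
  proof (rule mnorm_le_convolution[OF s(1)])
    fix x \<xi>
    have m: "integrable lborel (\<lambda>t. g t * cnj (\<phi> (t - x)))"
      using g(1) by (simp add: admissible_def)
    have "ennreal frame_const * ennreal (norm (gabor (\<lambda>t. f t * g t) x \<xi>)) \<le>
      (\<integral>\<^sup>+\<eta>. \<integral>\<^sup>+y. ennreal (norm (gabor f y \<eta>) * norm (ft (\<lambda>t. g t * cnj (\<phi> (t - x)) * \<phi> (t - y)) (\<xi> - \<eta>))) \<partial>lborel \<partial>lborel)"
      using ft_mult_bound[OF f(1) finf m, of \<xi>] by (simp add: gabor_def mult.assoc)
    also have "\<dots> \<le> (\<integral>\<^sup>+\<eta>. \<integral>\<^sup>+y. ennreal C * (ennreal (norm (gabor f y \<eta>)) * (ennreal (ker (x - y)) * \<kappa> (\<xi> - \<eta>))) \<partial>lborel \<partial>lborel)"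
    proof (intro nn_integral_mono)
      fix \<eta> y
      have "ennreal (norm (gabor f y \<eta>)) * ennreal (norm (ft (\<lambda>t. g t * cnj (\<phi> (t - x)) * \<phi> (t - y)) (\<xi> - \<eta>)))
        \<le> ennreal (norm (gabor f y \<eta>)) * (ennreal (C * ker (x - y)) * \<kappa> (\<xi> - \<eta>))"
        unfolding \<kappa>_def by (intro mult_left_mono C(2)) auto
      also have "\<dots> = ennreal C * (ennreal (norm (gabor f y \<eta>)) * (ennreal (ker (x - y)) * \<kappa> (\<xi> - \<eta>)))"
        using C(1) by (simp add: ennreal_mult mult_ac)
      finally show "ennreal (norm (gabor f y \<eta>) * norm (ft (\<lambda>t. g t * cnj (\<phi> (t - x)) * \<phi> (t - y)) (\<xi> - \<eta>)))
        \<le> ennreal C * (ennreal (norm (gabor f y \<eta>)) * (ennreal (ker (x - y)) * \<kappa> (\<xi> - \<eta>)))"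
        by (simp add: ennreal_mult)
    qed
    also have "\<dots> = (\<integral>\<^sup>+\<eta>. ennreal C * (\<integral>\<^sup>+y. ennreal (norm (gabor f y \<eta>)) * (ennreal (ker (x - y)) * \<kappa> (\<xi> - \<eta>)) \<partial>lborel) \<partial>lborel)"
      by (intro nn_integral_cong nn_integral_cmult) measurable
    also have "\<dots> = ennreal C * (\<integral>\<^sup>+\<eta>. \<integral>\<^sup>+y. ennreal (norm (gabor f y \<eta>)) * (ennreal (ker (x - y)) * \<kappa> (\<xi> - \<eta>)) \<partial>lborel \<partial>lborel)" (is "_ = _ * ?I")
      by (rule nn_integral_cmult) measurable
    finally have "ennreal (1 / frame_const) * (ennreal frame_const * ennreal (norm (gabor (\<lambda>t. f t * g t) x \<xi>)))
      \<le> ennreal (1 / frame_const) * (ennreal C * ?I)"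
      by (rule mult_left_mono) simp
    then show "ennreal (norm (gabor (\<lambda>t. f t * g t) x \<xi>)) \<le> ennreal (C / frame_const) * ?I"
      using frame_const_pos C(1) by (simp add: mult.assoc[symmetric] ennreal_mult[symmetric])
  qed measurable
  also have "\<dots> < \<infinity>"
    using ker_mass_finite \<kappa>_fin f(2) by (simp add: mnorm_def slice_def ennreal_mult_less_top)
  finally show ?thesis .
qed

end

text \<open>The integral over the real line of the function that equals \<open>F\<close> on the first and \<open>G\<close> on the second of
  two unit intervals is \<open>F + G\<close>, so that this is a special case of \<open>minkowski\<close>.\<close>

lemma Lp_norm_triangle:
  assumes p: "1 \<le> p" and [measurable]: "F \<in> borel_measurable borel" "G \<in> borel_measurable borel"
  shows "Lp_norm p (\<lambda>x. F x + G x) \<le> Lp_norm p F + Lp_norm p G"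
proof -
  have p0: "0 < p" using p by simp
  let ?K = "\<lambda>x (r::real). F x * indicator {0..<1} r + G x * indicator {1..<2} r"
  have "(\<integral>\<^sup>+r. ?K x r \<partial>lborel) = F x + G x" for x
    by (subst nn_integral_add) (auto simp: nn_integral_cmult)
  then have "Lp_norm p (\<lambda>x. F x + G x) = Lp_norm p (\<lambda>x. \<integral>\<^sup>+r. ?K x r \<partial>lborel)"
    by simp
  also have "\<dots> \<le> (\<integral>\<^sup>+r. Lp_norm p (\<lambda>x. ?K x r) \<partial>lborel)"
    by (rule minkowski[OF p]) measurable
  also have "\<dots> = (\<integral>\<^sup>+r. Lp_norm p F * indicator {0..<1} r + Lp_norm p G * indicator {1..<2::real} r \<partial>lborel)"
  proof (intro nn_integral_cong)
    fix r :: real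
    consider "r \<in> {0..<1}" "r \<notin> {1..<2}" | "r \<in> {1..<2}" "r \<notin> {0..<1}" | "r \<notin> {0..<1}" "r \<notin> {1..<2}"
      by fastforce
    then show "Lp_norm p (\<lambda>x. ?K x r) = Lp_norm p F * indicator {0..<1} r + Lp_norm p G * indicator {1..<2::real} r"
      by cases (auto simp: Lp_norm_def)
  qed
  also have "\<dots> = Lp_norm p F + Lp_norm p G"
    by (subst nn_integral_add) (auto simp: nn_integral_cmult)
  finally show ?thesis .
qed

section \<open>Localisation on the frequency side\<close>

definition ift :: "('a::euclidean_space \<Rightarrow> complex) \<Rightarrow> 'a \<Rightarrow> complex" where
  "ift G t = (\<integral>\<zeta>. G \<zeta> * cis (\<zeta> \<bullet> t) \<partial>lborel)"

lemma norm_integral_le_nn_integral: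
  fixes f :: "'a \<Rightarrow> complex"
  shows "ennreal (norm (\<integral>x. f x \<partial>M)) \<le> (\<integral>\<^sup>+x. ennreal (norm (f x)) \<partial>M)"
  by (cases "integrable M f") (auto simp: integral_norm_bound_ennreal not_integrable_integral_eq)

lemma line_smooth_cis:
  assumes "b \<in> Basis" "norm h \<le> 1"
  shows "line_smooth b k (\<lambda>_. 1) (\<lambda>t. cis (t \<bullet> h))"
proof (induction k)
  case 0
  show ?case unfolding cis_conv_exp by (auto intro!: continuous_intros)
next
  case (Suc k)
  have bh: "\<bar>b \<bullet> h\<bar> \<le> 1"
    using Basis_le_norm[OF assms(1), of h] assms(2) by (simp add: inner_commute)
  have "line_smooth b k (\<lambda>_. norm (\<i> * (b \<bullet> h)) * 1) (\<lambda>t. \<i> * (b \<bullet> h) * cis (t \<bullet> h))"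
    by (rule line_smooth_cmult[OF Suc])
  then have "line_smooth b k (\<lambda>_. 1) (\<lambda>t. \<i> * (b \<bullet> h) * cis (t \<bullet> h))"
    by (rule line_smooth_mono) (use bh in \<open>simp add: norm_mult\<close>)
  moreover have "((\<lambda>r. cis ((t + r *\<^sub>R b) \<bullet> h)) has_vector_derivative \<i> * (b \<bullet> h) * cis (t \<bullet> h)) (at 0)" for t
  proof -
    have "((\<lambda>r::real. \<i> * of_real ((t + r *\<^sub>R b) \<bullet> h)) has_vector_derivative \<i> * (b \<bullet> h)) (at 0)"
      unfolding inner_add_left inner_scaleR_left by (auto intro!: derivative_eq_intros)
    from field_vector_diff_chain_at[OF this DERIV_exp]
    show ?thesis by (simp add: o_def cis_conv_exp)
  qed
  moreover have "continuous_on UNIV (\<lambda>t. cis (t \<bullet> h))"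
    unfolding cis_conv_exp by (intro continuous_intros)
  ultimately show ?case by (intro line_smooth_SucI) auto
qed

lemma norm_cis_minus_1_le: "norm (cis r - 1) \<le> \<bar>r\<bar>"
  using iexp_approx1[of r 0] by (simp add: cis_conv_exp)

lemma line_smooth_cis_minus_1:
  fixes b h :: "'a::euclidean_space"
  assumes "b \<in> Basis" "norm h \<le> 1"
  shows "line_smooth b (Suc k) (\<lambda>t. norm h * (1 + norm t)) (\<lambda>t. cis (t \<bullet> h) - 1)"
proof (rule line_smooth_SucI)
  have bh: "\<bar>b \<bullet> h\<bar> \<le> norm h"
    using Basis_le_norm[OF assms(1), of h] by (simp add: inner_commute)
  have "line_smooth b k (\<lambda>_. norm (\<i> * (b \<bullet> h)) * 1) (\<lambda>t. \<i> * (b \<bullet> h) * cis (t \<bullet> h))"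
    by (rule line_smooth_cmult[OF line_smooth_cis[OF assms]])
  then show "line_smooth b k (\<lambda>t. norm h * (1 + norm t)) (\<lambda>t. \<i> * (b \<bullet> h) * cis (t \<bullet> h))"
  proof (rule line_smooth_mono)
    fix t :: 'a
    have "norm h * 1 \<le> norm h * (1 + norm t)" by (intro mult_left_mono) auto
    then show "norm (\<i> * (b \<bullet> h)) * 1 \<le> norm h * (1 + norm t)"
      using bh by (simp add: norm_mult)
  qed
  show "continuous_on UNIV (\<lambda>t. cis (t \<bullet> h) - 1)"
    unfolding cis_conv_exp by (intro continuous_intros)
  fix t :: 'a
  have "norm (cis (t \<bullet> h) - 1) \<le> \<bar>t \<bullet> h\<bar>" by (rule norm_cis_minus_1_le)
  also have "\<dots> \<le> norm t * norm h" by (rule Cauchy_Schwarz_ineq2)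
  also have "\<dots> \<le> norm h * (1 + norm t)" by (simp add: algebra_simps)
  finally show "norm (cis (t \<bullet> h) - 1) \<le> norm h * (1 + norm t)" .
  have "((\<lambda>r::real. \<i> * of_real ((t + r *\<^sub>R b) \<bullet> h)) has_vector_derivative \<i> * (b \<bullet> h)) (at 0)"
    unfolding inner_add_left inner_scaleR_left by (auto intro!: derivative_eq_intros)
  from field_vector_diff_chain_at[OF this DERIV_exp]
  have "((\<lambda>r. cis ((t + r *\<^sub>R b) \<bullet> h)) has_vector_derivative \<i> * (b \<bullet> h) * cis (t \<bullet> h)) (at 0)"
    by (simp add: o_def cis_conv_exp)
  from has_vector_derivative_diff[OF this has_vector_derivative_const[of 1]]
  show "((\<lambda>r. cis ((t + r *\<^sub>R b) \<bullet> h) - 1) has_vector_derivative \<i> * (b \<bullet> h) * cis (t \<bullet> h)) (at 0)"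
    by simp
qed

lemma rapidly_smooth_integrable:
  fixes \<tau> :: "'a::euclidean_space \<Rightarrow> complex"
  assumes "rapidly_smooth \<tau>"
  shows "integrable lborel \<tau>"
proof -
  obtain A where A: "A > 0" "\<And>b. b \<in> Basis \<Longrightarrow> line_smooth b (2 * DIM('a) + 1) (\<lambda>t. A * ker t ^ 1) \<tau>"
    using rapidly_smoothE[OF assms] by blast
  obtain b :: 'a where "b \<in> Basis" using nonempty_Basis by blast
  have "integrable lborel (\<lambda>t::'a. A * ker t ^ 1)"
    using integrable_ker[where 'a='a] by simp
  with A(2)[OF \<open>b \<in> Basis\<close>] show ?thesis by (rule line_smooth_integrable)
qed

lemma rapidly_smooth_continuous:
  fixes \<tau> :: "'a::euclidean_space \<Rightarrow> complex"
  assumes "rapidly_smooth \<tau>"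
  shows "continuous_on UNIV \<tau>"
proof -
  obtain A where A: "\<And>b. b \<in> Basis \<Longrightarrow> line_smooth b (2 * DIM('a) + 1) (\<lambda>t. A * ker t ^ 1) \<tau>"
    using rapidly_smoothE[OF assms] by blast
  obtain b :: 'a where "b \<in> Basis" using nonempty_Basis by blast
  from line_smoothD(1)[OF A[OF this]] show ?thesis .
qed

lemma ft_rapidly_smooth:
  fixes \<tau> :: "'a::euclidean_space \<Rightarrow> complex"
  assumes "rapidly_smooth \<tau>"
  shows "\<exists>C>0. \<forall>u. norm (ft \<tau> u) \<le> C * ker u"
proof -
  obtain A where A: "A > 0" "\<And>b. b \<in> Basis \<Longrightarrow> line_smooth b (2 * DIM('a) + 1) (\<lambda>t. A * ker t ^ 1) \<tau>"
    using rapidly_smoothE[OF assms] by blast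
  let ?D = "real ((1 + DIM('a)) ^ (2 * DIM('a) + 1)) * (\<integral>t. ker (t::'a) \<partial>lborel) * A"
  have le: "norm (ft \<tau> u) \<le> ?D * ker u" for u
    by (rule ft_translated_ker_bound[where x = 0]) (use A(2) in simp)
  have "0 \<le> ?D"
    using A(1) by (intro mult_nonneg_nonneg of_nat_0_le_iff) auto
  then have "0 < ?D + 1" by linarith
  moreover have "norm (ft \<tau> u) \<le> (?D + 1) * ker u" for u
    using le[of u] ker_nonneg[of u] unfolding distrib_right mult_1 by linarith
  ultimately show ?thesis by blast
qed

text \<open>A difference of values of the transform is the transform of \<open>\<tau> t * (cis (t \<bullet> h) - 1)\<close>. The second
  factor and all its derivatives are of size \<open>norm h\<close>, at the price of one factor \<open>1 + norm t\<close>.\<close>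

lemma ft_rapidly_smooth_diff:
  fixes \<tau> :: "'a::euclidean_space \<Rightarrow> complex"
  assumes "rapidly_smooth \<tau>"
  shows "\<exists>C>0. \<forall>u h. norm h \<le> 1 \<longrightarrow> norm (ft \<tau> (u - h) - ft \<tau> u) \<le> C * norm h * ker u"
proof -
  let ?N = "2 * DIM('a) + 1"
  obtain A where A: "A > 0" "\<And>b. b \<in> Basis \<Longrightarrow> line_smooth b ?N (\<lambda>t. A * ker t ^ 2) \<tau>"
    using rapidly_smoothE[OF assms] by blast
  let ?D = "real ((1 + DIM('a)) ^ ?N) * (\<integral>t. ker (t::'a) \<partial>lborel)"
  have le: "norm (ft \<tau> (u - h) - ft \<tau> u) \<le> ?D * (2 ^ ?N * A * norm h) * ker u" if h: "norm h \<le> 1" for u h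
  proof -
    have "ft \<tau> (u - h) - ft \<tau> u = (\<integral>t. \<tau> t * cis (- (t \<bullet> (u - h))) - \<tau> t * cis (- (t \<bullet> u)) \<partial>lborel)"
      unfolding ft_def using rapidly_smooth_integrable[OF assms]
      by (intro Bochner_Integration.integral_diff[symmetric] integrable_mult_cis) auto
    also have "\<dots> = ft (\<lambda>t. \<tau> t * (cis (t \<bullet> h) - 1)) u"
      unfolding ft_def
    proof (intro Bochner_Integration.integral_cong refl)
      fix t
      have "cis (- (t \<bullet> (u - h))) = cis (t \<bullet> h) * cis (- (t \<bullet> u))"
        by (simp add: cis_mult inner_diff_right)
      then show "\<tau> t * cis (- (t \<bullet> (u - h))) - \<tau> t * cis (- (t \<bullet> u)) = \<tau> t * (cis (t \<bullet> h) - 1) * cis (- (t \<bullet> u))"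
        by (simp add: algebra_simps)
    qed
    finally have eq: "ft \<tau> (u - h) - ft \<tau> u = ft (\<lambda>t. \<tau> t * (cis (t \<bullet> h) - 1)) u" .
    show ?thesis
      unfolding eq
    proof (rule ft_translated_ker_bound[where x = 0])
      fix b :: 'a assume b: "b \<in> Basis"
      have cis: "line_smooth b ?N (\<lambda>t. norm h * (1 + norm t)) (\<lambda>t. cis (t \<bullet> h) - 1)"
        using line_smooth_cis_minus_1[OF b h, of "2 * DIM('a)"] by (simp only: Suc_eq_plus1)
      show "line_smooth b ?N (\<lambda>t. 2 ^ ?N * A * norm h * ker (t - 0)) (\<lambda>t. \<tau> t * (cis (t \<bullet> h) - 1))"
      proof (rule line_smooth_mono[OF line_smooth_mult[OF A(2)[OF b] cis]])
        fix t :: 'a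
        have "ker t * (1 + norm t) \<le> 1"
        proof -
          have "ker t * (1 + norm t) = 1 / (1 + norm t) ^ (2 * DIM('a))"
            by (simp add: ker_def)
          also have "\<dots> \<le> 1" using one_le_power[of "1 + norm t" "2 * DIM('a)"] by simp
          finally show ?thesis .
        qed
        then have "(2 ^ ?N * A * norm h * ker t) * (ker t * (1 + norm t)) \<le> (2 ^ ?N * A * norm h * ker t) * 1"
          using A(1) by (intro mult_left_mono) auto
        then show "2 ^ ?N * (A * (ker t)\<^sup>2 * (norm h * (1 + norm t))) \<le> 2 ^ ?N * A * norm h * ker (t - 0)"
          by (simp only: power2_eq_square mult_ac mult_1_right mult_1 diff_0_right)
      qed
    qed
  qed
  have nn: "0 \<le> ?D * (2 ^ ?N * A)"
    using A(1) by (intro mult_nonneg_nonneg of_nat_0_le_iff) auto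
  then have "0 < ?D * (2 ^ ?N * A) + 1" by linarith
  moreover have "norm (ft \<tau> (u - h) - ft \<tau> u) \<le> (?D * (2 ^ ?N * A) + 1) * norm h * ker u" if h: "norm h \<le> 1" for u h
  proof -
    have "?D * (2 ^ ?N * A * norm h) * ker u = (?D * (2 ^ ?N * A)) * (norm h * ker u)"
      by (simp only: mult_ac)
    also have "\<dots> \<le> (?D * (2 ^ ?N * A) + 1) * (norm h * ker u)"
      by (intro mult_right_mono) auto
    finally show ?thesis using le[OF h, of u] by (simp only: mult.assoc)
  qed
  ultimately show ?thesis by blast
qed

text \<open>After the substitution \<open>u = l *\<^sub>R \<xi>\<close> the weight becomes \<open>weight s (u /\<^sub>R l)\<close>, which is at most
  \<open>l powr (- s) * weight s u\<close>. If \<open>l * norm \<theta> \<le> 1\<close> the Lipschitz bound for \<open>T\<close> applies, and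
  \<open>l powr (- s) * (l * norm \<theta>)\<close> equals \<open>(l * norm \<theta>) powr (1 - s) * norm \<theta> powr s\<close>. Otherwise the
  two terms of the difference are estimated separately, and \<open>1 / l\<close> is at most \<open>norm \<theta>\<close>.\<close>

lemma dilated_difference_bound:
  fixes T :: "'a::euclidean_space \<Rightarrow> complex" and \<theta> :: 'a
  assumes s: "0 \<le> s" "s < 1" and [measurable]: "T \<in> borel_measurable borel" and C: "0 < C"
    and T: "\<And>u. norm (T u) \<le> C * ker u" "\<And>u h. norm h \<le> 1 \<Longrightarrow> norm (T (u - h) - T u) \<le> C * norm h * ker u"
    and l: "0 < l" "l \<le> 1"
  shows "(\<integral>\<^sup>+\<xi>. ennreal (weight s \<xi>) * ennreal (l ^ DIM('a) * norm (T (l *\<^sub>R \<xi> - l *\<^sub>R \<theta>) - T (l *\<^sub>R \<xi>))) \<partial>lborel)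
    \<le> ennreal (3 * C * (weight s \<theta> * min 1 ((l * norm \<theta>) powr (1 - s)))) * (\<integral>\<^sup>+u. ennreal (weight s u) * ennreal (ker (u::'a)) \<partial>lborel)"
proof -
  let ?W = "\<integral>\<^sup>+u. ennreal (weight s u) * ennreal (ker (u::'a)) \<partial>lborel"
  let ?g = "\<lambda>u. ennreal (weight s (u /\<^sub>R l)) * ennreal (norm (T (u - l *\<^sub>R \<theta>) - T u))"
  have "(\<integral>\<^sup>+\<xi>. ennreal (weight s \<xi>) * ennreal (l ^ DIM('a) * norm (T (l *\<^sub>R \<xi> - l *\<^sub>R \<theta>) - T (l *\<^sub>R \<xi>))) \<partial>lborel)
    = (\<integral>\<^sup>+\<xi>. ennreal (l ^ DIM('a)) * ?g (0 + l *\<^sub>R \<xi>) \<partial>lborel)"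
    using l by (intro nn_integral_cong) (simp add: ennreal_mult mult_ac)
  also have "\<dots> = ennreal (l ^ DIM('a)) * (\<integral>\<^sup>+\<xi>. ?g (0 + l *\<^sub>R \<xi>) \<partial>lborel)"
    by (rule nn_integral_cmult) measurable
  also have "\<dots> = (\<integral>\<^sup>+u. ?g u \<partial>lborel)"
    using l by (subst nn_integral_lborel_affine[of ?g l 0]) auto
  finally have eq: "(\<integral>\<^sup>+\<xi>. ennreal (weight s \<xi>) * ennreal (l ^ DIM('a) * norm (T (l *\<^sub>R \<xi> - l *\<^sub>R \<theta>) - T (l *\<^sub>R \<xi>))) \<partial>lborel)
    = (\<integral>\<^sup>+u. ?g u \<partial>lborel)" .
  have wt_l: "weight s (u /\<^sub>R l) \<le> l powr (- s) * weight s u" for u :: 'a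
  proof -
    have "1 + norm (u /\<^sub>R l) \<le> inverse l * (1 + norm u)"
      using l by (simp add: distrib_left one_le_inverse)
    then have "weight s (u /\<^sub>R l) \<le> (inverse l * (1 + norm u)) powr s"
      unfolding weight_def using s by (intro powr_mono2) (auto simp: add_nonneg_nonneg)
    also have "\<dots> = l powr (- s) * weight s u"
      unfolding weight_def using l by (subst powr_mult) (auto simp: powr_minus inverse_powr)
    finally show ?thesis .
  qed
  show ?thesis
  proof (cases "l * norm \<theta> \<le> 1")
    case True
    have coef: "l powr (- s) * (l * norm \<theta>) \<le> weight s \<theta> * min 1 ((l * norm \<theta>) powr (1 - s))"
    proof (cases "\<theta> = 0")
      case False
      then have n: "0 < norm \<theta>" by simp
      have "l powr (- s) * (l * norm \<theta>) = norm \<theta> powr s * (l * norm \<theta>) powr (1 - s)"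
        using l n by (simp add: powr_mult powr_diff powr_minus field_simps)
      also have "\<dots> \<le> weight s \<theta> * (l * norm \<theta>) powr (1 - s)"
        unfolding weight_def using s n by (intro mult_right_mono powr_mono2) auto
      also have "(l * norm \<theta>) powr (1 - s) = min 1 ((l * norm \<theta>) powr (1 - s))"
        using True s l n powr_mono2[of "1 - s" "l * norm \<theta>" 1] by simp
      finally show ?thesis .
    qed (auto simp: weight_def)
    have "?g u \<le> ennreal (C * (weight s \<theta> * min 1 ((l * norm \<theta>) powr (1 - s)))) * (ennreal (weight s u) * ennreal (ker u))" for u
    proof -
      have "weight s (u /\<^sub>R l) * norm (T (u - l *\<^sub>R \<theta>) - T u) \<le> (l powr (- s) * weight s u) * (C * (l * norm \<theta>) * ker u)"
        using T(2)[of "l *\<^sub>R \<theta>" u] True l wt_l by (intro mult_mono) auto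
      also have "\<dots> = C * (l powr (- s) * (l * norm \<theta>)) * (weight s u * ker u)"
        by (simp only: mult_ac)
      also have "\<dots> \<le> C * (weight s \<theta> * min 1 ((l * norm \<theta>) powr (1 - s))) * (weight s u * ker u)"
        using coef C by (intro mult_right_mono mult_left_mono) auto
      finally show ?thesis
        using C by (simp add: ennreal_mult[symmetric] ennreal_leI)
    qed
    then have "(\<integral>\<^sup>+u. ?g u \<partial>lborel) \<le> (\<integral>\<^sup>+u. ennreal (C * (weight s \<theta> * min 1 ((l * norm \<theta>) powr (1 - s)))) * (ennreal (weight s u) * ennreal (ker (u::'a))) \<partial>lborel)"
      by (intro nn_integral_mono)
    also have "\<dots> = ennreal (C * (weight s \<theta> * min 1 ((l * norm \<theta>) powr (1 - s)))) * ?W"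
      by (rule nn_integral_cmult) measurable
    also have "\<dots> \<le> ennreal (3 * C * (weight s \<theta> * min 1 ((l * norm \<theta>) powr (1 - s)))) * ?W"
      using C by (intro mult_right_mono ennreal_leI) (auto intro!: mult_right_mono)
    finally show ?thesis unfolding eq .
  next
    case False
    then have n: "0 < norm \<theta>" "1 < l * norm \<theta>" using l by (auto simp: not_le)
    then have il: "inverse l \<le> norm \<theta>" using l by (simp add: field_simps)
    have m: "min 1 ((l * norm \<theta>) powr (1 - s)) = 1"
      using n s ge_one_powr_ge_zero[of "l * norm \<theta>" "1 - s"] by simp
    have w1: "weight s (u /\<^sub>R l) \<le> weight s \<theta> * weight s u" for u :: 'a
    proof -
      have "l powr (- s) = inverse l powr s"
        using l by (simp add: powr_minus inverse_powr)
      also have "\<dots> \<le> weight s \<theta>"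
        unfolding weight_def using il l s by (intro powr_mono2) auto
      finally have "l powr (- s) * weight s u \<le> weight s \<theta> * weight s u"
        by (intro mult_right_mono) auto
      with wt_l[of u] show ?thesis by linarith
    qed
    have w2: "weight s (u /\<^sub>R l + \<theta>) \<le> 2 * (weight s \<theta> * weight s u)" for u :: 'a
    proof -
      have "norm (u /\<^sub>R l + \<theta>) \<le> inverse l * norm u + norm \<theta>"
        using norm_triangle_ineq[of "u /\<^sub>R l" \<theta>] l by simp
      moreover have "1 \<le> inverse l" using l by (simp add: one_le_inverse)
      moreover have "inverse l * norm u \<le> norm \<theta> * norm u"
        using il by (intro mult_right_mono) auto
      moreover have "0 \<le> norm \<theta> * norm u" by simp
      ultimately have "1 + norm (u /\<^sub>R l + \<theta>) \<le> 2 * (norm \<theta> * (1 + norm u))"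
        using il unfolding distrib_left mult_1_right by linarith
      also have "\<dots> \<le> 2 * ((1 + norm \<theta>) * (1 + norm u))"
        by (intro mult_left_mono mult_right_mono) auto
      finally have "weight s (u /\<^sub>R l + \<theta>) \<le> (2 * ((1 + norm \<theta>) * (1 + norm u))) powr s"
        unfolding weight_def using s by (intro powr_mono2) auto
      also have "\<dots> = 2 powr s * (weight s \<theta> * weight s u)"
        unfolding weight_def by (simp add: powr_mult)
      also have "\<dots> \<le> 2 powr 1 * (weight s \<theta> * weight s u)"
        using s by (intro mult_right_mono powr_mono) auto
      finally show ?thesis by simp
    qed
    have "?g u \<le> ennreal (C * weight s \<theta>) * (ennreal (weight s u) * ennreal (ker u))
        + ennreal C * (ennreal (weight s ((u - l *\<^sub>R \<theta>) /\<^sub>R l + \<theta>)) * ennreal (ker (u - l *\<^sub>R \<theta>)))" for u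
    proof -
      have shift: "(u - l *\<^sub>R \<theta>) /\<^sub>R l + \<theta> = u /\<^sub>R l"
        using l by (simp add: scaleR_diff_right)
      have "norm (T (u - l *\<^sub>R \<theta>) - T u) \<le> C * ker u + C * ker (u - l *\<^sub>R \<theta>)"
        using norm_triangle_ineq4[of "T (u - l *\<^sub>R \<theta>)" "T u"] T(1)[of u] T(1)[of "u - l *\<^sub>R \<theta>"] by linarith
      then have "weight s (u /\<^sub>R l) * norm (T (u - l *\<^sub>R \<theta>) - T u) \<le> weight s (u /\<^sub>R l) * (C * ker u + C * ker (u - l *\<^sub>R \<theta>))"
        by (rule mult_left_mono) simp
      also have "\<dots> = weight s (u /\<^sub>R l) * (C * ker u) + C * (weight s (u /\<^sub>R l) * ker (u - l *\<^sub>R \<theta>))"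
        by (simp add: algebra_simps)
      also have "weight s (u /\<^sub>R l) * (C * ker u) \<le> (weight s \<theta> * weight s u) * (C * ker u)"
        using w1[of u] C by (intro mult_right_mono) auto
      finally have "weight s (u /\<^sub>R l) * norm (T (u - l *\<^sub>R \<theta>) - T u)
         \<le> (C * weight s \<theta>) * (weight s u * ker u) + C * (weight s (u /\<^sub>R l) * ker (u - l *\<^sub>R \<theta>))"
        by (simp add: mult_ac)
      then have "ennreal (weight s (u /\<^sub>R l) * norm (T (u - l *\<^sub>R \<theta>) - T u))
         \<le> ennreal ((C * weight s \<theta>) * (weight s u * ker u) + C * (weight s (u /\<^sub>R l) * ker (u - l *\<^sub>R \<theta>)))"
        by (rule ennreal_leI)
      also have "\<dots> = ennreal ((C * weight s \<theta>) * (weight s u * ker u)) + ennreal (C * (weight s (u /\<^sub>R l) * ker (u - l *\<^sub>R \<theta>)))"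
        using C by (intro ennreal_plus) auto
      finally have "ennreal (weight s (u /\<^sub>R l) * norm (T (u - l *\<^sub>R \<theta>) - T u))
         \<le> ennreal ((C * weight s \<theta>) * (weight s u * ker u)) + ennreal (C * (weight s (u /\<^sub>R l) * ker (u - l *\<^sub>R \<theta>)))" .
      then show ?thesis
        using C unfolding shift by (simp add: ennreal_mult)
    qed
    then have "(\<integral>\<^sup>+u. ?g u \<partial>lborel) \<le> (\<integral>\<^sup>+u. ennreal (C * weight s \<theta>) * (ennreal (weight s u) * ennreal (ker u))
        + ennreal C * (ennreal (weight s ((u - l *\<^sub>R \<theta>) /\<^sub>R l + \<theta>)) * ennreal (ker (u - l *\<^sub>R \<theta>))) \<partial>lborel)"
      by (intro nn_integral_mono)
    also have "\<dots> = ennreal (C * weight s \<theta>) * ?W + ennreal C * (\<integral>\<^sup>+u. ennreal (weight s ((u - l *\<^sub>R \<theta>) /\<^sub>R l + \<theta>)) * ennreal (ker (u - l *\<^sub>R \<theta>)) \<partial>lborel)"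
      by (subst nn_integral_add) (auto simp: nn_integral_cmult)
    also have "(\<integral>\<^sup>+u. ennreal (weight s ((u - l *\<^sub>R \<theta>) /\<^sub>R l + \<theta>)) * ennreal (ker (u - l *\<^sub>R \<theta>)) \<partial>lborel)
       = (\<integral>\<^sup>+u. ennreal (weight s (u /\<^sub>R l + \<theta>)) * ennreal (ker u) \<partial>lborel)"
      by (rule nn_integral_lborel_translate(1)[of "\<lambda>u. ennreal (weight s (u /\<^sub>R l + \<theta>)) * ennreal (ker u)"]) measurable
    also have "\<dots> \<le> (\<integral>\<^sup>+u. ennreal (2 * weight s \<theta>) * (ennreal (weight s u) * ennreal (ker (u::'a))) \<partial>lborel)"
    proof (intro nn_integral_mono)
      fix u :: 'a
      have "weight s (u /\<^sub>R l + \<theta>) * ker u \<le> 2 * (weight s \<theta> * weight s u) * ker u"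
        by (intro mult_right_mono w2) simp
      then show "ennreal (weight s (u /\<^sub>R l + \<theta>)) * ennreal (ker u) \<le> ennreal (2 * weight s \<theta>) * (ennreal (weight s u) * ennreal (ker u))"
        by (simp add: ennreal_mult[symmetric] ennreal_leI mult.assoc)
    qed
    also have "\<dots> = ennreal (2 * weight s \<theta>) * ?W"
      by (rule nn_integral_cmult) measurable
    finally have "(\<integral>\<^sup>+u. ?g u \<partial>lborel) \<le> ennreal (C * weight s \<theta>) * ?W + ennreal C * (ennreal (2 * weight s \<theta>) * ?W)"
      by (simp add: add_left_mono mult_left_mono)
    also have "\<dots> = (ennreal (C * weight s \<theta>) + ennreal (C * (2 * weight s \<theta>))) * ?W"
      using C by (simp add: distrib_right ennreal_mult mult.assoc)
    also have "ennreal (C * weight s \<theta>) + ennreal (C * (2 * weight s \<theta>)) = ennreal (3 * C * (weight s \<theta> * 1))"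
      using C by (subst ennreal_plus[symmetric]) auto
    finally show ?thesis unfolding eq m .
  qed
qed

lemma fourier_inversion_ift:
  fixes h :: "'a::euclidean_space \<Rightarrow> complex"
  assumes "continuous_on UNIV h" "integrable lborel h" "integrable lborel (ft h)"
  shows "ift (\<lambda>\<xi>. ft h \<xi> / (2 * pi) ^ DIM('a)) t = h t"
proof -
  have "ift (\<lambda>\<xi>. ft h \<xi> / (2 * pi) ^ DIM('a)) t = (\<integral>\<xi>. inverse (complex_of_real ((2 * pi) ^ DIM('a))) * (ft h \<xi> * cis (\<xi> \<bullet> t)) \<partial>lborel)"
    unfolding ift_def by (intro Bochner_Integration.integral_cong) (auto simp: divide_inverse)
  also have "\<dots> = inverse (complex_of_real ((2 * pi) ^ DIM('a))) * (complex_of_real ((2 * pi) ^ DIM('a)) * h t)"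
    using fourier_inversion[OF assms, of t] by (simp only: integral_mult_right_zero)
  also have "\<dots> = h t"
  proof -
    have nz: "complex_of_real ((2 * pi) ^ DIM('a)) \<noteq> 0" by simp
    show ?thesis by (simp only: mult.assoc[symmetric] left_inverse[OF nz] mult_1)
  qed
  finally show ?thesis .
qed

lemma ift_dilated:
  fixes T :: "'a::euclidean_space \<Rightarrow> complex"
  assumes T: "integrable lborel T" and l: "0 < l"
  shows "integrable lborel (\<lambda>\<zeta>. of_real (l ^ DIM('a)) * T (l *\<^sub>R \<zeta>) * cis (- (\<zeta> \<bullet> x)))"
    and "ift (\<lambda>\<zeta>. of_real (l ^ DIM('a)) * T (l *\<^sub>R \<zeta>) * cis (- (\<zeta> \<bullet> x))) t = ift T ((t - x) /\<^sub>R l)"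
proof -
  have [measurable]: "T \<in> borel_measurable borel" using T by auto
  have i: "integrable lborel (\<lambda>\<zeta>. T (l *\<^sub>R \<zeta>))"
    using lborel_integrable_affine[OF T, of l 0] l by simp
  then have "integrable lborel (\<lambda>\<zeta>. of_real (l ^ DIM('a)) * T (l *\<^sub>R \<zeta>))" by simp
  then show "integrable lborel (\<lambda>\<zeta>. of_real (l ^ DIM('a)) * T (l *\<^sub>R \<zeta>) * cis (- (\<zeta> \<bullet> x)))"
    by (rule integrable_mult_cis) measurable
  have "ift T ((t - x) /\<^sub>R l) = l ^ DIM('a) *\<^sub>R (\<integral>\<zeta>. T (l *\<^sub>R \<zeta>) * cis ((l *\<^sub>R \<zeta>) \<bullet> ((t - x) /\<^sub>R l)) \<partial>lborel)"
    unfolding ift_def using lborel_integral_affine[of "\<lambda>\<zeta>. T \<zeta> * cis (\<zeta> \<bullet> ((t - x) /\<^sub>R l))" l 0] l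
    by (simp add: integrable_mult_cis[OF T])
  also have "\<dots> = (\<integral>\<zeta>. l ^ DIM('a) *\<^sub>R (T (l *\<^sub>R \<zeta>) * cis ((l *\<^sub>R \<zeta>) \<bullet> ((t - x) /\<^sub>R l))) \<partial>lborel)"
    by simp
  also have "\<dots> = ift (\<lambda>\<zeta>. of_real (l ^ DIM('a)) * T (l *\<^sub>R \<zeta>) * cis (- (\<zeta> \<bullet> x))) t"
    unfolding ift_def
  proof (intro Bochner_Integration.integral_cong refl)
    fix \<zeta>
    have "(l *\<^sub>R \<zeta>) \<bullet> ((t - x) /\<^sub>R l) = - (\<zeta> \<bullet> x) + \<zeta> \<bullet> t"
      using l by (simp add: inner_diff_right field_simps)
    then have "cis ((l *\<^sub>R \<zeta>) \<bullet> ((t - x) /\<^sub>R l)) = cis (- (\<zeta> \<bullet> x)) * cis (\<zeta> \<bullet> t)"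
      by (simp add: cis_mult)
    then show "l ^ DIM('a) *\<^sub>R (T (l *\<^sub>R \<zeta>) * cis ((l *\<^sub>R \<zeta>) \<bullet> ((t - x) /\<^sub>R l)))
      = of_real (l ^ DIM('a)) * T (l *\<^sub>R \<zeta>) * cis (- (\<zeta> \<bullet> x)) * cis (\<zeta> \<bullet> t)"
      by (simp add: scaleR_conv_of_real)
  qed
  finally show "ift (\<lambda>\<zeta>. of_real (l ^ DIM('a)) * T (l *\<^sub>R \<zeta>) * cis (- (\<zeta> \<bullet> x))) t = ift T ((t - x) /\<^sub>R l)" ..
qed

lemma weight_integrable:
  assumes s: "0 \<le> s" and [measurable]: "G \<in> borel_measurable borel"
    and fin: "(\<integral>\<^sup>+\<xi>. ennreal (weight s \<xi>) * ennreal (norm (G \<xi> :: complex)) \<partial>lborel) < \<infinity>"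
  shows "integrable lborel G"
proof (rule integrableI_bounded)
  have "(\<integral>\<^sup>+\<xi>. ennreal (norm (G \<xi>)) \<partial>lborel) \<le> (\<integral>\<^sup>+\<xi>. ennreal (weight s \<xi>) * ennreal (norm (G \<xi>)) \<partial>lborel)"
  proof (intro nn_integral_mono)
    fix \<xi>
    have "1 * norm (G \<xi>) \<le> weight s \<xi> * norm (G \<xi>)"
      by (intro mult_right_mono weight_ge_1 s) auto
    then show "ennreal (norm (G \<xi>)) \<le> ennreal (weight s \<xi>) * ennreal (norm (G \<xi>))"
      by (simp add: ennreal_mult[symmetric] ennreal_leI)
  qed
  then show "(\<integral>\<^sup>+\<xi>. ennreal (norm (G \<xi>)) \<partial>lborel) < \<infinity>"
    using fin by (rule le_less_trans)
qed measurable

lemma dilation_factor_le: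
  assumes "0 < C" "0 \<le> r"
  shows "ennreal (norm z) * ennreal (3 * C * (weight s \<theta> * min 1 r)) \<le> ennreal (3 * C) * (ennreal (weight s \<theta>) * ennreal (norm z))"
proof -
  have "norm z * (3 * C * (weight s \<theta> * min 1 r)) \<le> norm z * (3 * C * (weight s \<theta> * 1))"
    using assms by (intro mult_left_mono) auto
  then have "ennreal (norm z * (3 * C * (weight s \<theta> * min 1 r))) \<le> ennreal (3 * C * (weight s \<theta> * norm z))"
    by (intro ennreal_leI) (simp add: mult_ac)
  then show ?thesis
    using assms by (simp add: ennreal_mult)
qed

text \<open>Multiplying \<open>ift H\<close> by a dilated copy of \<open>ift T\<close> convolves \<open>H\<close> with the dilated and modulated \<open>T\<close>, called
  \<open>Tl\<close>. As \<open>ift H x = 0\<close>, the multiple \<open>cis (x \<bullet> \<theta>) * Tl \<xi>\<close> of \<open>Tl\<close> may be subtracted under the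
  integral over \<open>\<theta>\<close> without changing the product. The modulation in \<open>Tl\<close> is such that what remains is a
  difference of two values of \<open>T\<close>.\<close>

lemma dilation_localises:
  fixes T H :: "'a::euclidean_space \<Rightarrow> complex"
  assumes s: "0 \<le> s" "s < 1" and Tm[measurable]: "T \<in> borel_measurable borel" and Ti: "integrable lborel T" and C: "0 < C"
    and T: "\<And>u. norm (T u) \<le> C * ker u" "\<And>u h. norm h \<le> 1 \<Longrightarrow> norm (T (u - h) - T u) \<le> C * norm h * ker u"
    and Hm[measurable]: "H \<in> borel_measurable borel"
    and H: "(\<integral>\<^sup>+\<theta>. ennreal (weight s \<theta>) * ennreal (norm (H \<theta>)) \<partial>lborel) < \<infinity>"
    and zero: "ift H x = 0" and l: "0 < l" "l \<le> 1"
  shows "\<exists>G. G \<in> borel_measurable borel \<and> integrable lborel G \<and>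
    (\<integral>\<^sup>+\<xi>. ennreal (weight s \<xi>) * ennreal (norm (G \<xi>)) \<partial>lborel) \<le>
      (\<integral>\<^sup>+\<theta>. ennreal (norm (H \<theta>)) * ennreal (3 * C * (weight s \<theta> * min 1 ((l * norm \<theta>) powr (1 - s)))) \<partial>lborel)
        * (\<integral>\<^sup>+u. ennreal (weight s u) * ennreal (ker (u::'a)) \<partial>lborel) \<and>
    (\<forall>t. ift G t = ift T ((t - x) /\<^sub>R l) * ift H t)"
proof -
  let ?W = "\<integral>\<^sup>+u. ennreal (weight s u) * ennreal (ker (u::'a)) \<partial>lborel"
  let ?M = "\<lambda>\<theta>. ennreal (3 * C * (weight s \<theta> * min 1 ((l * norm \<theta>) powr (1 - s))))"
  have Wfin: "?W < \<infinity>" using s by (intro weight_ker_integral) auto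
  have [measurable]: "(\<lambda>\<theta>::'a. (l * norm \<theta>) powr (1 - s)) \<in> borel_measurable borel"
    using s by (intro borel_measurable_continuous_onI continuous_on_powr') (auto intro!: continuous_intros simp: l less_imp_le)
  have Hi: "integrable lborel H"
    using s(1) Hm H by (rule weight_integrable)
  define Tl where "Tl \<zeta> = of_real (l ^ DIM('a)) * T (l *\<^sub>R \<zeta>) * cis (- (\<zeta> \<bullet> x))" for \<zeta>
  have [measurable]: "Tl \<in> borel_measurable borel" unfolding Tl_def by measurable
  have Tli: "integrable lborel Tl" and Tlt: "ift Tl t = ift T ((t - x) /\<^sub>R l)" for t
    using ift_dilated[OF Ti l(1), of x] unfolding Tl_def by auto
  define D where "D \<theta> \<xi> = Tl (\<xi> - \<theta>) - cis (x \<bullet> \<theta>) * Tl \<xi>" for \<theta> \<xi>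
  have [measurable]: "case_prod D \<in> borel_measurable (borel \<Otimes>\<^sub>M borel)" unfolding D_def by measurable
  have nD: "norm (D \<theta> \<xi>) = l ^ DIM('a) * norm (T (l *\<^sub>R \<xi> - l *\<^sub>R \<theta>) - T (l *\<^sub>R \<xi>))" for \<theta> \<xi>
  proof -
    have "cis (- ((\<xi> - \<theta>) \<bullet> x)) = cis (x \<bullet> \<theta>) * cis (- (\<xi> \<bullet> x))"
      by (simp add: cis_mult inner_diff_left inner_commute[of x \<theta>])
    then have "D \<theta> \<xi> = of_real (l ^ DIM('a)) * (cis (x \<bullet> \<theta>) * cis (- (\<xi> \<bullet> x))) * (T (l *\<^sub>R \<xi> - l *\<^sub>R \<theta>) - T (l *\<^sub>R \<xi>))"
      unfolding D_def Tl_def by (simp add: scaleR_diff_right algebra_simps)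
    then show ?thesis using l by (simp add: norm_mult norm_power)
  qed
  have \<Psi>: "(\<integral>\<^sup>+\<xi>. ennreal (weight s \<xi>) * ennreal (norm (D \<theta> \<xi>)) \<partial>lborel) \<le> ?M \<theta> * ?W" for \<theta>
    unfolding nD by (rule dilated_difference_bound[OF s Tm C T l])
  let ?K = "\<lambda>\<theta> \<xi>. H \<theta> * D \<theta> \<xi>"
  have K_le: "(\<integral>\<^sup>+\<xi>. ennreal (weight s \<xi>) * (\<integral>\<^sup>+\<theta>. ennreal (norm (?K \<theta> \<xi>)) \<partial>lborel) \<partial>lborel)
      \<le> (\<integral>\<^sup>+\<theta>. ennreal (norm (H \<theta>)) * ?M \<theta> \<partial>lborel) * ?W"
  proof -
    have "(\<integral>\<^sup>+\<xi>. ennreal (weight s \<xi>) * (\<integral>\<^sup>+\<theta>. ennreal (norm (?K \<theta> \<xi>)) \<partial>lborel) \<partial>lborel)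
      = (\<integral>\<^sup>+\<xi>. \<integral>\<^sup>+\<theta>. ennreal (weight s \<xi>) * ennreal (norm (?K \<theta> \<xi>)) \<partial>lborel \<partial>lborel)"
      by (intro nn_integral_cong nn_integral_cmult[symmetric]) measurable
    also have "\<dots> = (\<integral>\<^sup>+\<theta>. \<integral>\<^sup>+\<xi>. ennreal (weight s \<xi>) * ennreal (norm (?K \<theta> \<xi>)) \<partial>lborel \<partial>lborel)"
      by (rule lborel_pair.Fubini') measurable
    also have "\<dots> = (\<integral>\<^sup>+\<theta>. \<integral>\<^sup>+\<xi>. ennreal (norm (H \<theta>)) * (ennreal (weight s \<xi>) * ennreal (norm (D \<theta> \<xi>))) \<partial>lborel \<partial>lborel)"
      by (simp add: norm_mult ennreal_mult mult_ac)
    also have "\<dots> = (\<integral>\<^sup>+\<theta>. ennreal (norm (H \<theta>)) * (\<integral>\<^sup>+\<xi>. ennreal (weight s \<xi>) * ennreal (norm (D \<theta> \<xi>)) \<partial>lborel) \<partial>lborel)"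
      by (intro nn_integral_cong nn_integral_cmult) measurable
    also have "\<dots> \<le> (\<integral>\<^sup>+\<theta>. ennreal (norm (H \<theta>)) * (?M \<theta> * ?W) \<partial>lborel)"
      by (intro nn_integral_mono mult_left_mono \<Psi>) auto
    also have "\<dots> = (\<integral>\<^sup>+\<theta>. ennreal (norm (H \<theta>)) * ?M \<theta> * ?W \<partial>lborel)"
      by (simp only: mult.assoc)
    also have "\<dots> = (\<integral>\<^sup>+\<theta>. ennreal (norm (H \<theta>)) * ?M \<theta> \<partial>lborel) * ?W"
      by (rule nn_integral_multc) measurable
    finally show ?thesis .
  qed
  have Mfin: "(\<integral>\<^sup>+\<theta>. ennreal (norm (H \<theta>)) * ?M \<theta> \<partial>lborel) < \<infinity>"
  proof -
    have "(\<integral>\<^sup>+\<theta>. ennreal (norm (H \<theta>)) * ?M \<theta> \<partial>lborel) \<le> (\<integral>\<^sup>+\<theta>. ennreal (3 * C) * (ennreal (weight s \<theta>) * ennreal (norm (H \<theta>))) \<partial>lborel)"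
      by (intro nn_integral_mono dilation_factor_le C) simp
    also have "\<dots> = ennreal (3 * C) * (\<integral>\<^sup>+\<theta>. ennreal (weight s \<theta>) * ennreal (norm (H \<theta>)) \<partial>lborel)"
      by (rule nn_integral_cmult) measurable
    also have "\<dots> < \<infinity>" using H by (simp add: ennreal_mult_less_top)
    finally show ?thesis .
  qed
  define G where "G \<xi> = (\<integral>\<theta>. ?K \<theta> \<xi> \<partial>lborel)" for \<xi>
  have [measurable]: "G \<in> borel_measurable borel" unfolding G_def by measurable
  have "(\<integral>\<^sup>+\<xi>. ennreal (weight s \<xi>) * ennreal (norm (G \<xi>)) \<partial>lborel)
    \<le> (\<integral>\<^sup>+\<xi>. ennreal (weight s \<xi>) * (\<integral>\<^sup>+\<theta>. ennreal (norm (?K \<theta> \<xi>)) \<partial>lborel) \<partial>lborel)"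
    unfolding G_def by (intro nn_integral_mono mult_left_mono norm_integral_le_nn_integral) auto
  note G_le = order_trans[OF this K_le]
  have "ift G t = ift T ((t - x) /\<^sub>R l) * ift H t" for t
  proof -
    have Ki: "integrable (lborel \<Otimes>\<^sub>M lborel) (\<lambda>(\<xi>, \<theta>). ?K \<theta> \<xi> * cis (\<xi> \<bullet> t))"
    proof (rule integrable_pairI)
      have "(\<integral>\<^sup>+\<xi>. \<integral>\<^sup>+\<theta>. ennreal (norm (?K \<theta> \<xi> * cis (\<xi> \<bullet> t))) \<partial>lborel \<partial>lborel)
        \<le> (\<integral>\<^sup>+\<xi>. ennreal (weight s \<xi>) * (\<integral>\<^sup>+\<theta>. ennreal (norm (?K \<theta> \<xi>)) \<partial>lborel) \<partial>lborel)"
      proof (intro nn_integral_mono)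
        fix \<xi>
        have "1 * (\<integral>\<^sup>+\<theta>. ennreal (norm (?K \<theta> \<xi>)) \<partial>lborel) \<le> ennreal (weight s \<xi>) * (\<integral>\<^sup>+\<theta>. ennreal (norm (?K \<theta> \<xi>)) \<partial>lborel)"
          using weight_ge_1[OF s(1), of \<xi>] by (intro mult_right_mono) (auto simp: ennreal_leI simp flip: ennreal_1)
        then show "(\<integral>\<^sup>+\<theta>. ennreal (norm (?K \<theta> \<xi> * cis (\<xi> \<bullet> t))) \<partial>lborel) \<le> ennreal (weight s \<xi>) * (\<integral>\<^sup>+\<theta>. ennreal (norm (?K \<theta> \<xi>)) \<partial>lborel)"
          by (simp add: norm_mult)
      qed
      also have "\<dots> \<le> (\<integral>\<^sup>+\<theta>. ennreal (norm (H \<theta>)) * ?M \<theta> \<partial>lborel) * ?W" by (rule K_le)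
      also have "\<dots> < \<infinity>" using Mfin Wfin by (simp add: ennreal_mult_less_top)
      finally show "(\<integral>\<^sup>+\<xi>. \<integral>\<^sup>+\<theta>. ennreal (norm (?K \<theta> \<xi> * cis (\<xi> \<bullet> t))) \<partial>lborel \<partial>lborel) < \<infinity>" .
    qed measurable
    have DI: "(\<integral>\<xi>. D \<theta> \<xi> * cis (\<xi> \<bullet> t) \<partial>lborel) = (cis (\<theta> \<bullet> t) - cis (\<theta> \<bullet> x)) * ift Tl t" for \<theta>
    proof -
      have i1: "integrable lborel (\<lambda>\<xi>. Tl (\<xi> - \<theta>))"
        using lborel_integrable_affine[OF Tli, of 1 "- \<theta>"] by simp
      have "(\<integral>\<xi>. D \<theta> \<xi> * cis (\<xi> \<bullet> t) \<partial>lborel) = (\<integral>\<xi>. Tl (\<xi> - \<theta>) * cis (\<xi> \<bullet> t) - cis (x \<bullet> \<theta>) * (Tl \<xi> * cis (\<xi> \<bullet> t)) \<partial>lborel)"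
        by (intro Bochner_Integration.integral_cong) (auto simp: D_def algebra_simps)
      also have "\<dots> = (\<integral>\<xi>. Tl (\<xi> - \<theta>) * cis (\<xi> \<bullet> t) \<partial>lborel) - (\<integral>\<xi>. cis (x \<bullet> \<theta>) * (Tl \<xi> * cis (\<xi> \<bullet> t)) \<partial>lborel)"
        by (intro Bochner_Integration.integral_diff integrable_mult_right integrable_mult_cis i1 Tli) measurable
      also have "(\<integral>\<xi>. cis (x \<bullet> \<theta>) * (Tl \<xi> * cis (\<xi> \<bullet> t)) \<partial>lborel) = cis (\<theta> \<bullet> x) * ift Tl t"
        by (simp add: ift_def inner_commute)
      also have "(\<integral>\<xi>. Tl (\<xi> - \<theta>) * cis (\<xi> \<bullet> t) \<partial>lborel) = (\<integral>\<xi>. cis (\<theta> \<bullet> t) * (Tl \<xi> * cis (\<xi> \<bullet> t)) \<partial>lborel)"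
      proof -
        have "(\<integral>\<xi>. Tl (\<xi> - \<theta>) * cis (\<xi> \<bullet> t) \<partial>lborel) = (\<integral>\<xi>. Tl (\<theta> + 1 *\<^sub>R \<xi> - \<theta>) * cis ((\<theta> + 1 *\<^sub>R \<xi>) \<bullet> t) \<partial>lborel)"
          by (subst lborel_integral_affine[of _ 1 \<theta>]) (auto intro!: integrable_mult_cis i1)
        also have "\<dots> = (\<integral>\<xi>. cis (\<theta> \<bullet> t) * (Tl \<xi> * cis (\<xi> \<bullet> t)) \<partial>lborel)"
          by (intro Bochner_Integration.integral_cong) (auto simp: inner_add_left cis_mult[symmetric] mult_ac)
        finally show ?thesis .
      qed
      also have "\<dots> = cis (\<theta> \<bullet> t) * ift Tl t"
        unfolding ift_def by (rule integral_mult_right_zero)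
      finally show ?thesis by (simp only: left_diff_distrib)
    qed
    have "ift G t = (\<integral>\<xi>. \<integral>\<theta>. ?K \<theta> \<xi> * cis (\<xi> \<bullet> t) \<partial>lborel \<partial>lborel)"
      unfolding ift_def G_def by simp
    also have "\<dots> = (\<integral>\<theta>. \<integral>\<xi>. ?K \<theta> \<xi> * cis (\<xi> \<bullet> t) \<partial>lborel \<partial>lborel)"
      using lborel_pair.Fubini_integral[OF Ki] by simp
    also have "\<dots> = (\<integral>\<theta>. H \<theta> * (\<integral>\<xi>. D \<theta> \<xi> * cis (\<xi> \<bullet> t) \<partial>lborel) \<partial>lborel)"
      by (simp add: mult.assoc)
    also have "\<dots> = (\<integral>\<theta>. ift Tl t * (H \<theta> * cis (\<theta> \<bullet> t) - H \<theta> * cis (\<theta> \<bullet> x)) \<partial>lborel)"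
      unfolding DI by (intro Bochner_Integration.integral_cong) (auto simp: algebra_simps)
    also have "\<dots> = ift Tl t * (\<integral>\<theta>. H \<theta> * cis (\<theta> \<bullet> t) - H \<theta> * cis (\<theta> \<bullet> x) \<partial>lborel)"
      by (rule integral_mult_right_zero)
    also have "(\<integral>\<theta>. H \<theta> * cis (\<theta> \<bullet> t) - H \<theta> * cis (\<theta> \<bullet> x) \<partial>lborel) = ift H t - ift H x"
      unfolding ift_def by (intro Bochner_Integration.integral_diff integrable_mult_cis Hi) measurable
    finally show ?thesis using zero by (simp add: Tlt)
  qed
  moreover have "integrable lborel G"
  proof (rule weight_integrable[OF s(1) _ le_less_trans[OF G_le]])
    show "(\<integral>\<^sup>+\<theta>. ennreal (norm (H \<theta>)) * ?M \<theta> \<partial>lborel) * ?W < \<infinity>"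
      using Mfin Wfin by (simp add: ennreal_mult_less_top)
  qed measurable
  ultimately show ?thesis using G_le by (intro exI[of _ G]) auto
qed

text \<open>For each \<open>\<theta>\<close> the minimum tends to 0 because \<open>1 - s\<close> is positive; \<open>weight s \<theta> * norm (H \<theta>)\<close> is an
  integrable majorant.\<close>

lemma dilation_weight_tendsto_0:
  fixes H :: "'a::euclidean_space \<Rightarrow> complex"
  assumes s: "0 \<le> s" "s < 1" and Hm[measurable]: "H \<in> borel_measurable borel" and C: "0 < C"
    and H: "(\<integral>\<^sup>+\<theta>. ennreal (weight s \<theta>) * ennreal (norm (H \<theta>)) \<partial>lborel) < \<infinity>"
  shows "(\<lambda>j. \<integral>\<^sup>+\<theta>. ennreal (norm (H \<theta>)) * ennreal (3 * C * (weight s \<theta> * min 1 ((inverse (real (Suc j)) * norm \<theta>) powr (1 - s)))) \<partial>lborel) \<longlonglongrightarrow> 0"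
proof -
  have m[measurable]: "(\<lambda>\<theta>::'a. (r * norm \<theta>) powr (1 - s)) \<in> borel_measurable borel" if "0 \<le> r" for r
    using s that by (intro borel_measurable_continuous_onI continuous_on_powr') (auto intro!: continuous_intros)
  have "(\<lambda>j. \<integral>\<^sup>+\<theta>. ennreal (norm (H \<theta>)) * ennreal (3 * C * (weight s \<theta> * min 1 ((inverse (real (Suc j)) * norm \<theta>) powr (1 - s)))) \<partial>lborel)
    \<longlonglongrightarrow> (\<integral>\<^sup>+(\<theta>::'a). 0 \<partial>lborel)"
  proof (rule nn_integral_dominated_convergence[where w = "\<lambda>\<theta>. ennreal (3 * C) * (ennreal (weight s \<theta>) * ennreal (norm (H \<theta>)))"])
    show "(\<integral>\<^sup>+\<theta>. ennreal (3 * C) * (ennreal (weight s \<theta>) * ennreal (norm (H \<theta>))) \<partial>lborel) < \<infinity>"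
      using H by (subst nn_integral_cmult) (auto simp: ennreal_mult_less_top)
    show "AE \<theta> in lborel. ennreal (norm (H \<theta>)) * ennreal (3 * C * (weight s \<theta> * min 1 ((inverse (real (Suc j)) * norm \<theta>) powr (1 - s))))
       \<le> ennreal (3 * C) * (ennreal (weight s \<theta>) * ennreal (norm (H \<theta>)))" for j
      by (intro AE_I2 dilation_factor_le C) simp
    show "AE \<theta> in lborel. (\<lambda>j. ennreal (norm (H \<theta>)) * ennreal (3 * C * (weight s \<theta> * min 1 ((inverse (real (Suc j)) * norm \<theta>) powr (1 - s))))) \<longlonglongrightarrow> 0"
    proof (intro AE_I2)
      fix \<theta> :: 'a
      have "(\<lambda>j. inverse (real (Suc j)) * norm \<theta>) \<longlonglongrightarrow> 0"
        using tendsto_mult[OF LIMSEQ_inverse_real_of_nat tendsto_const[of "norm \<theta>"]] by simp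
      then have "(\<lambda>j. (inverse (real (Suc j)) * norm \<theta>) powr (1 - s)) \<longlonglongrightarrow> 0 powr (1 - s)"
        using s by (intro tendsto_powr') auto
      then have "(\<lambda>j. norm (H \<theta>) * (3 * C * (weight s \<theta> * min 1 ((inverse (real (Suc j)) * norm \<theta>) powr (1 - s))))) \<longlonglongrightarrow> norm (H \<theta>) * (3 * C * (weight s \<theta> * min 1 0))"
        by (intro tendsto_mult tendsto_const tendsto_min) simp
      then have "(\<lambda>j. ennreal (norm (H \<theta>) * (3 * C * (weight s \<theta> * min 1 ((inverse (real (Suc j)) * norm \<theta>) powr (1 - s)))))) \<longlonglongrightarrow> ennreal (norm (H \<theta>) * (3 * C * (weight s \<theta> * min 1 0)))"
        by (rule tendsto_ennrealI)
      then show "(\<lambda>j. ennreal (norm (H \<theta>)) * ennreal (3 * C * (weight s \<theta> * min 1 ((inverse (real (Suc j)) * norm \<theta>) powr (1 - s))))) \<longlonglongrightarrow> 0"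
        using C by (simp add: ennreal_mult)
    qed
  qed measurable
  then show ?thesis by simp
qed

context window
begin

section \<open>Localisation in the modulation space\<close>

lemma rapidly_smooth_bounded:
  fixes \<beta> :: "'a \<Rightarrow> complex"
  assumes "rapidly_smooth \<beta>"
  shows "\<exists>B. \<forall>t. norm (\<beta> t) \<le> B"
proof -
  obtain A where A: "A > 0" "\<And>b. b \<in> Basis \<Longrightarrow> line_smooth b (2 * DIM('a) + 1) (\<lambda>t. A * ker t ^ 0) \<beta>"
    using rapidly_smoothE[OF assms] by blast
  obtain b :: 'a where "b \<in> Basis" using nonempty_Basis by blast
  from line_smoothD(2)[OF A(2)[OF this]] show ?thesis by auto
qed

lemma admissible_translate:
  assumes "rapidly_smooth \<beta>"
  shows "admissible (\<lambda>t. \<beta> (t - x0))"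
proof -
  obtain B where "\<And>t. norm (\<beta> t) \<le> B" using rapidly_smooth_bounded[OF assms] by blast
  then show ?thesis
    by (intro admissibleI[where B = B] continuous_on_compose2[OF rapidly_smooth_continuous[OF assms]])
       (auto intro!: continuous_intros)
qed

lemma Lp_norm_ker_finite: "Lp_norm p (\<lambda>x. ennreal (ker (x - x0 :: 'a))) < \<infinity>"
proof -
  have "(\<integral>\<^sup>+x. ennreal_powr (ennreal (ker (x - x0))) p \<partial>lborel) \<le> (\<integral>\<^sup>+x. ennreal (ker (x - x0)) \<partial>lborel)"
  proof (intro nn_integral_mono)
    fix x :: 'a
    have "ker (x - x0) powr p \<le> ker (x - x0) powr 1"
      using ker_pos[of "x - x0"] ker_le_1[of "x - x0"] p by (intro powr_mono') auto
    then show "ennreal_powr (ennreal (ker (x - x0))) p \<le> ennreal (ker (x - x0))"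
      by (simp add: ennreal_powr_ennreal ennreal_leI)
  qed
  also have "\<dots> = (\<integral>\<^sup>+x. ennreal (ker (x::'a)) \<partial>lborel)"
    by (rule nn_integral_lborel_translate(1)[of "\<lambda>x. ennreal (ker x)"]) measurable
  also have "\<dots> < \<infinity>" by (rule ker_mass_finite)
  finally show ?thesis
    unfolding Lp_norm_def by (simp add: less_top[symmetric])
qed

text \<open>On functions cut off to a fixed bounded region the norm is controlled by the weighted size of the
  Fourier transform: windows far away from the region see almost nothing, which takes care of the
  norm in the time variable.\<close>

lemma mnorm_ift_window:
  fixes \<beta> :: "'a \<Rightarrow> complex"
  assumes s: "0 \<le> s" "s \<le> 1" and \<beta>: "rapidly_smooth \<beta>"
  shows "\<exists>C. C < \<infinity> \<and> (\<forall>G. G \<in> borel_measurable borel \<longrightarrow> integrable lborel G \<longrightarrow>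
    mnorm s (\<lambda>t. ift G t * \<beta> (t - x0)) \<le> C * (\<integral>\<^sup>+\<xi>. ennreal (weight s \<xi>) * ennreal (norm (G \<xi>)) \<partial>lborel))"
proof -
  obtain D where D: "D > 0" "\<And>x z \<xi>. norm (ft (\<lambda>t. \<beta> (t - z) * cnj (\<phi> (t - x))) \<xi>) \<le> D * ker (x - z) * ker \<xi>"
    using ft_product2[OF \<beta> phi_rapid(2)] by blast
  let ?L = "Lp_norm p (\<lambda>x. ennreal (ker (x - x0 :: 'a)))"
  let ?W = "\<integral>\<^sup>+t. ennreal (weight s t) * ennreal (ker (t::'a)) \<partial>lborel"
  have bound: "mnorm s (\<lambda>t. ift G t * \<beta> (t - x0)) \<le> (?L * ennreal D * ?W) * (\<integral>\<^sup>+\<xi>. ennreal (weight s \<xi>) * ennreal (norm (G \<xi>)) \<partial>lborel)"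
    if Gm: "G \<in> borel_measurable borel" and Gi: "integrable lborel G" for G
  proof -
    note [measurable] = Gm
    have [measurable]: "\<beta> \<in> borel_measurable borel"
      using rapidly_smooth_continuous[OF \<beta>] by (rule borel_measurable_continuous_onI)
    define Q where "Q \<xi> = (\<integral>\<^sup>+\<zeta>. ennreal (norm (G \<zeta>)) * ennreal (ker (\<xi> - \<zeta>)) \<partial>lborel)" for \<xi>
    have [measurable]: "Q \<in> borel_measurable borel" unfolding Q_def by measurable
    have g: "ennreal (norm (gabor (\<lambda>t. ift G t * \<beta> (t - x0)) x \<xi>)) \<le> ennreal (ker (x - x0)) * (ennreal D * Q \<xi>)" for x \<xi>
    proof -
      let ?m = "\<lambda>t. \<beta> (t - x0) * cnj (\<phi> (t - x))"
      have mi: "integrable lborel ?m"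
        using admissible_translate[OF \<beta>] by (simp add: admissible_def)
      let ?K = "\<lambda>t \<zeta>. G \<zeta> * cis (\<zeta> \<bullet> t) * (?m t * cis (- (t \<bullet> \<xi>)))"
      have Ki: "integrable (lborel \<Otimes>\<^sub>M lborel) (\<lambda>(t, \<zeta>). ?K t \<zeta>)"
      proof (rule integrable_pairI)
        have "(\<integral>\<^sup>+t. \<integral>\<^sup>+\<zeta>. ennreal (norm (?K t \<zeta>)) \<partial>lborel \<partial>lborel) = (\<integral>\<^sup>+t. \<integral>\<^sup>+\<zeta>. ennreal (norm (?m t)) * ennreal (norm (G \<zeta>)) \<partial>lborel \<partial>lborel)"
          by (simp add: norm_mult ennreal_mult mult_ac)
        also have "\<dots> = (\<integral>\<^sup>+t. ennreal (norm (?m t)) * (\<integral>\<^sup>+\<zeta>. ennreal (norm (G \<zeta>)) \<partial>lborel) \<partial>lborel)"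
          by (intro nn_integral_cong nn_integral_cmult) measurable
        also have "\<dots> = (\<integral>\<^sup>+t. ennreal (norm (?m t)) \<partial>lborel) * (\<integral>\<^sup>+\<zeta>. ennreal (norm (G \<zeta>)) \<partial>lborel)"
          by (rule nn_integral_multc) measurable
        also have "\<dots> < \<infinity>"
          using mi Gi unfolding integrable_iff_bounded by (simp add: ennreal_mult_less_top)
        finally show "(\<integral>\<^sup>+t. \<integral>\<^sup>+\<zeta>. ennreal (norm (?K t \<zeta>)) \<partial>lborel \<partial>lborel) < \<infinity>" .
      qed measurable
      have "gabor (\<lambda>t. ift G t * \<beta> (t - x0)) x \<xi> = (\<integral>t. \<integral>\<zeta>. ?K t \<zeta> \<partial>lborel \<partial>lborel)"
        unfolding gabor_def ft_def ift_def integral_mult_left_zero by (simp add: mult.assoc)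
      also have "\<dots> = (\<integral>\<zeta>. \<integral>t. ?K t \<zeta> \<partial>lborel \<partial>lborel)"
        using lborel_pair.Fubini_integral[OF Ki] by simp
      also have "\<dots> = (\<integral>\<zeta>. G \<zeta> * ft ?m (\<xi> - \<zeta>) \<partial>lborel)"
        unfolding ft_def integral_mult_right_zero[symmetric]
      proof (intro Bochner_Integration.integral_cong refl)
        fix t \<zeta>
        have "cis (- (t \<bullet> (\<xi> - \<zeta>))) = cis (- (t \<bullet> \<xi>)) * cis (\<zeta> \<bullet> t)"
          by (simp add: cis_mult inner_diff_right inner_commute[of t \<zeta>])
        then show "?K t \<zeta> = G \<zeta> * (?m t * cis (- (t \<bullet> (\<xi> - \<zeta>))))"
          by (simp only: mult_ac)
      qed
      finally have "ennreal (norm (gabor (\<lambda>t. ift G t * \<beta> (t - x0)) x \<xi>)) \<le> (\<integral>\<^sup>+\<zeta>. ennreal (norm (G \<zeta> * ft ?m (\<xi> - \<zeta>))) \<partial>lborel)"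
        by (simp only: norm_integral_le_nn_integral)
      also have "\<dots> \<le> (\<integral>\<^sup>+\<zeta>. ennreal (D * ker (x - x0)) * (ennreal (norm (G \<zeta>)) * ennreal (ker (\<xi> - \<zeta>))) \<partial>lborel)"
      proof (intro nn_integral_mono)
        fix \<zeta>
        have "norm (G \<zeta>) * norm (ft ?m (\<xi> - \<zeta>)) \<le> norm (G \<zeta>) * (D * ker (x - x0) * ker (\<xi> - \<zeta>))"
          by (intro mult_left_mono D(2)) simp
        then have "ennreal (norm (G \<zeta> * ft ?m (\<xi> - \<zeta>))) \<le> ennreal ((D * ker (x - x0)) * (norm (G \<zeta>) * ker (\<xi> - \<zeta>)))"
          by (intro ennreal_leI) (simp only: norm_mult mult_ac)
        then show "ennreal (norm (G \<zeta> * ft ?m (\<xi> - \<zeta>))) \<le> ennreal (D * ker (x - x0)) * (ennreal (norm (G \<zeta>)) * ennreal (ker (\<xi> - \<zeta>)))"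
          using D(1) by (simp add: ennreal_mult)
      qed
      also have "\<dots> = ennreal (D * ker (x - x0)) * Q \<xi>"
        unfolding Q_def by (rule nn_integral_cmult) measurable
      also have "\<dots> = ennreal (ker (x - x0)) * (ennreal D * Q \<xi>)"
        using D(1) by (simp add: ennreal_mult mult_ac)
      finally show ?thesis .
    qed
    have "slice (\<lambda>t. ift G t * \<beta> (t - x0)) \<xi> \<le> ?L * ennreal D * Q \<xi>" for \<xi>
    proof -
      have "slice (\<lambda>t. ift G t * \<beta> (t - x0)) \<xi> \<le> Lp_norm p (\<lambda>x. ennreal (ker (x - x0)) * (ennreal D * Q \<xi>))"
        unfolding slice_def by (intro Lp_norm_mono g p_pos)
      also have "\<dots> = ?L * (ennreal D * Q \<xi>)"
        using p_pos by (intro Lp_norm_multc) auto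
      finally show ?thesis by (simp only: mult.assoc)
    qed
    then have "mnorm s (\<lambda>t. ift G t * \<beta> (t - x0)) \<le> (\<integral>\<^sup>+\<xi>. ennreal (weight s \<xi>) * (?L * ennreal D * Q \<xi>) \<partial>lborel)"
      unfolding mnorm_def by (intro nn_integral_mono mult_left_mono) auto
    also have "\<dots> = (\<integral>\<^sup>+\<xi>. (?L * ennreal D) * (ennreal (weight s \<xi>) * Q \<xi>) \<partial>lborel)"
      by (simp only: mult_ac)
    also have "\<dots> = (?L * ennreal D) * (\<integral>\<^sup>+\<xi>. ennreal (weight s \<xi>) * Q \<xi> \<partial>lborel)"
      by (rule nn_integral_cmult) measurable
    also have "\<dots> \<le> (?L * ennreal D) * ((\<integral>\<^sup>+\<xi>. ennreal (weight s \<xi>) * ennreal (norm (G \<xi>)) \<partial>lborel) * ?W)"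
      unfolding Q_def by (intro mult_left_mono weighted_convolution_le s) auto
    finally show ?thesis by (simp only: mult_ac)
  qed
  have fin: "?L * ennreal D * ?W < \<infinity>"
    using Lp_norm_ker_finite[of x0] weight_ker_integral[OF s(2), where 'a='a] by (simp add: ennreal_mult_less_top)
  show ?thesis by (rule exI[of _ "?L * ennreal D * ?W"]) (use bound fin in blast)
qed

text \<open>Together with \<open>mnorm_ift_window\<close> this shows that, locally, the space is a weighted Fourier algebra
  for every exponent \<open>p\<close>.\<close>

lemma ft_cut_weighted:
  fixes f \<beta> :: "'a \<Rightarrow> complex"
  assumes s: "0 \<le> s" "s \<le> 1" and \<beta>: "rapidly_smooth \<beta>" and f: "admissible f" and fin: "mnorm s f < \<infinity>"
  shows "(\<integral>\<^sup>+\<xi>. ennreal (weight s \<xi>) * ennreal (norm (ft (\<lambda>t. f t * \<beta> (t - x0)) \<xi>)) \<partial>lborel) < \<infinity>"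
proof -
  note [measurable] = gabor_measurable[OF f] slice_measurable[OF f]
  have sfin: "(\<integral>\<^sup>+\<eta>. slice f \<eta> \<partial>lborel) < \<infinity>"
    using slice_le_mnorm[OF s(1)] fin by (rule le_less_trans)
  obtain D where D: "D > 0" "\<And>x z \<xi>. norm (ft (\<lambda>t. \<beta> (t - z) * \<phi> (t - x)) \<xi>) \<le> D * ker (x - z) * ker \<xi>"
    using ft_product2[OF \<beta> phi_rapid(1)] by blast
  have m: "integrable lborel (\<lambda>t. \<beta> (t - x0))"
    using lborel_integrable_affine[OF rapidly_smooth_integrable[OF \<beta>], of 1 "- x0"] by simp
  let ?K = "1 + (\<integral>\<^sup>+y. ennreal (ker (y::'a)) \<partial>lborel)"
  let ?c = "ennreal (1 / frame_const) * (ennreal D * ?K)"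
  have pt: "ennreal (norm (ft (\<lambda>t. f t * \<beta> (t - x0)) \<xi>)) \<le> ?c * (\<integral>\<^sup>+\<eta>. slice f \<eta> * ennreal (ker (\<xi> - \<eta>)) \<partial>lborel)" for \<xi>
  proof -
    have "ennreal frame_const * ennreal (norm (ft (\<lambda>t. f t * \<beta> (t - x0)) \<xi>)) \<le>
      (\<integral>\<^sup>+\<eta>. \<integral>\<^sup>+y. ennreal (norm (gabor f y \<eta>) * norm (ft (\<lambda>t. \<beta> (t - x0) * \<phi> (t - y)) (\<xi> - \<eta>))) \<partial>lborel \<partial>lborel)"
      by (rule ft_mult_bound[OF f sfin m])
    also have "\<dots> \<le> (\<integral>\<^sup>+\<eta>. \<integral>\<^sup>+y. ennreal (D * ker (\<xi> - \<eta>)) * (ennreal (norm (gabor f y \<eta>)) * ennreal (ker (x0 - y))) \<partial>lborel \<partial>lborel)"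
    proof (intro nn_integral_mono)
      fix \<eta> y :: 'a
      have "ker (y - x0) = ker (x0 - y)" using ker_minus[of "x0 - y"] by simp
      then have "norm (gabor f y \<eta>) * norm (ft (\<lambda>t. \<beta> (t - x0) * \<phi> (t - y)) (\<xi> - \<eta>)) \<le> norm (gabor f y \<eta>) * (D * ker (x0 - y) * ker (\<xi> - \<eta>))"
        using D(2)[of x0 y "\<xi> - \<eta>"] by (intro mult_left_mono) auto
      then have "ennreal (norm (gabor f y \<eta>) * norm (ft (\<lambda>t. \<beta> (t - x0) * \<phi> (t - y)) (\<xi> - \<eta>)))
        \<le> ennreal ((D * ker (\<xi> - \<eta>)) * (norm (gabor f y \<eta>) * ker (x0 - y)))"
        by (intro ennreal_leI) (simp only: mult_ac)
      then show "ennreal (norm (gabor f y \<eta>) * norm (ft (\<lambda>t. \<beta> (t - x0) * \<phi> (t - y)) (\<xi> - \<eta>)))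
        \<le> ennreal (D * ker (\<xi> - \<eta>)) * (ennreal (norm (gabor f y \<eta>)) * ennreal (ker (x0 - y)))"
        using D(1) by (simp add: ennreal_mult)
    qed
    also have "\<dots> = (\<integral>\<^sup>+\<eta>. ennreal (D * ker (\<xi> - \<eta>)) * (\<integral>\<^sup>+y. ennreal (norm (gabor f y \<eta>)) * ennreal (ker (x0 - y)) \<partial>lborel) \<partial>lborel)"
      by (intro nn_integral_cong nn_integral_cmult) measurable
    also have "\<dots> \<le> (\<integral>\<^sup>+\<eta>. ennreal (D * ker (\<xi> - \<eta>)) * (?K * slice f \<eta>) \<partial>lborel)"
      unfolding slice_def using p by (intro nn_integral_mono mult_left_mono nn_integral_Lp_norm_ker_le) auto
    also have "\<dots> = (\<integral>\<^sup>+\<eta>. (ennreal D * ?K) * (slice f \<eta> * ennreal (ker (\<xi> - \<eta>))) \<partial>lborel)"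
      using D(1) by (intro nn_integral_cong) (simp add: ennreal_mult mult_ac)
    also have "\<dots> = (ennreal D * ?K) * (\<integral>\<^sup>+\<eta>. slice f \<eta> * ennreal (ker (\<xi> - \<eta>)) \<partial>lborel)"
      by (rule nn_integral_cmult) measurable
    finally have "ennreal (1 / frame_const) * (ennreal frame_const * ennreal (norm (ft (\<lambda>t. f t * \<beta> (t - x0)) \<xi>)))
      \<le> ennreal (1 / frame_const) * ((ennreal D * ?K) * (\<integral>\<^sup>+\<eta>. slice f \<eta> * ennreal (ker (\<xi> - \<eta>)) \<partial>lborel))"
      by (rule mult_left_mono) simp
    moreover have "ennreal (1 / frame_const) * (ennreal frame_const * ennreal (norm (ft (\<lambda>t. f t * \<beta> (t - x0)) \<xi>))) = ennreal (norm (ft (\<lambda>t. f t * \<beta> (t - x0)) \<xi>))"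
      using frame_const_pos by (simp add: mult.assoc[symmetric] ennreal_mult[symmetric])
    ultimately show ?thesis by (simp only: mult.assoc)
  qed
  have "(\<integral>\<^sup>+\<xi>. ennreal (weight s \<xi>) * ennreal (norm (ft (\<lambda>t. f t * \<beta> (t - x0)) \<xi>)) \<partial>lborel)
    \<le> (\<integral>\<^sup>+\<xi>. ennreal (weight s \<xi>) * (?c * (\<integral>\<^sup>+\<eta>. slice f \<eta> * ennreal (ker (\<xi> - \<eta>)) \<partial>lborel)) \<partial>lborel)"
    by (intro nn_integral_mono mult_left_mono pt) auto
  also have "\<dots> = (\<integral>\<^sup>+\<xi>. ?c * (ennreal (weight s \<xi>) * (\<integral>\<^sup>+\<eta>. slice f \<eta> * ennreal (ker (\<xi> - \<eta>)) \<partial>lborel)) \<partial>lborel)"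
    by (simp only: mult.left_commute)
  also have "\<dots> = ?c * (\<integral>\<^sup>+\<xi>. ennreal (weight s \<xi>) * (\<integral>\<^sup>+\<eta>. slice f \<eta> * ennreal (ker (\<xi> - \<eta>)) \<partial>lborel) \<partial>lborel)"
    by (rule nn_integral_cmult) measurable
  also have "\<dots> \<le> ?c * (mnorm s f * (\<integral>\<^sup>+t. ennreal (weight s t) * ennreal (ker (t::'a)) \<partial>lborel))"
    unfolding mnorm_def by (intro mult_left_mono weighted_convolution_le[where G = "\<lambda>t. ennreal (ker t)"] s) auto
  also have "\<dots> < \<infinity>"
    using fin ker_mass_finite weight_ker_integral[OF s(2), where 'a='a] by (simp add: ennreal_mult_less_top)
  finally show ?thesis .
qed

text \<open>Multiplying by the dilated cutoff is the same as multiplying first by the fixed cutoff \<open>cutoff 2\<close>, twice,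
  since that one equals 1 on the support of the dilated one. One factor makes the Fourier transform
  of \<open>f\<close> accessible, the other one turns the estimate of \<open>dilation_localises\<close> into one of the norm.\<close>

lemma localisation_small:
  fixes f :: "'a \<Rightarrow> complex"
  assumes s: "0 \<le> s" "s < 1" and f: "admissible f" and fin: "mnorm s f < \<infinity>" and f0: "f x0 = 0" and \<epsilon>: "0 < \<epsilon>"
  shows "\<exists>l>0. l \<le> 1 \<and> mnorm s (\<lambda>t. f t * cutoff 1 ((t - x0) /\<^sub>R l)) < \<epsilon>"
proof -
  have s1: "s \<le> 1" using s by simp
  let ?\<tau> = "cutoff 1 :: 'a \<Rightarrow> complex" and ?\<beta> = "cutoff 2 :: 'a \<Rightarrow> complex"
  have \<beta>: "rapidly_smooth ?\<beta>" and \<tau>: "rapidly_smooth ?\<tau>" by (rule rapidly_smooth_cutoff)+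
  have fc: "continuous_on UNIV f" using f by (simp add: admissible_def)
  have [measurable]: "f \<in> borel_measurable borel" by (rule admissible_measurable[OF f])
  let ?n = "complex_of_real ((2 * pi) ^ DIM('a))"
  \<comment> \<open>the frequency side of \<open>f\<close> cut off near the point\<close>
  let ?h = "\<lambda>t. f t * ?\<beta> (t - x0)"
  have hc: "continuous_on UNIV ?h"
    using admissible_translate[OF \<beta>, of x0] fc unfolding admissible_def by (intro continuous_on_mult) auto
  obtain B where B: "\<And>t. norm (f t) \<le> B" using bounded_if_mnorm_finite[OF f s(1) fin] by blast
  have hi: "integrable lborel ?h"
  proof (rule Bochner_Integration.integrable_bound)
    show "integrable lborel (\<lambda>t. B * norm (?\<beta> (t - x0)))"
      using lborel_integrable_affine[OF rapidly_smooth_integrable[OF \<beta>], of 1 "- x0"] by simp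
    show "?h \<in> borel_measurable lborel" using hc by (simp add: borel_measurable_continuous_onI)
    have "norm (?h t) \<le> norm (B * norm (?\<beta> (t - x0)))" for t
    proof -
      have "norm (f t) \<le> \<bar>B\<bar>" using B[of t] by linarith
      from mult_right_mono[OF this norm_ge_zero[of "?\<beta> (t - x0)"]] show ?thesis
        by (simp add: norm_mult abs_mult)
    qed
    then show "AE t in lborel. norm (?h t) \<le> norm (B * norm (?\<beta> (t - x0)))" by simp
  qed
  have [measurable]: "?h \<in> borel_measurable borel" using hc by (rule borel_measurable_continuous_onI)
  have ftm[measurable]: "ft ?h \<in> borel_measurable borel" by (rule ft_measurable) measurable
  have ftw: "(\<integral>\<^sup>+\<xi>. ennreal (weight s \<xi>) * ennreal (norm (ft ?h \<xi>)) \<partial>lborel) < \<infinity>"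
    by (rule ft_cut_weighted[OF s(1) s1 \<beta> f fin])
  define H where "H \<xi> = ft ?h \<xi> / ?n" for \<xi>
  have Hm[measurable]: "H \<in> borel_measurable borel" unfolding H_def by measurable
  have H: "(\<integral>\<^sup>+\<xi>. ennreal (weight s \<xi>) * ennreal (norm (H \<xi>)) \<partial>lborel) < \<infinity>"
  proof -
    have "norm ?n = (2 * pi) ^ DIM('a)" by (simp add: norm_power norm_mult)
    then have "(\<integral>\<^sup>+\<xi>. ennreal (weight s \<xi>) * ennreal (norm (H \<xi>)) \<partial>lborel)
      = (\<integral>\<^sup>+\<xi>. ennreal (1 / (2 * pi) ^ DIM('a)) * (ennreal (weight s \<xi>) * ennreal (norm (ft ?h \<xi>))) \<partial>lborel)"
      unfolding H_def by (intro nn_integral_cong) (simp add: norm_divide ennreal_mult[symmetric] del: of_real_power)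
    also have "\<dots> = ennreal (1 / (2 * pi) ^ DIM('a)) * (\<integral>\<^sup>+\<xi>. ennreal (weight s \<xi>) * ennreal (norm (ft ?h \<xi>)) \<partial>lborel)"
      by (rule nn_integral_cmult) measurable
    also have "\<dots> < \<infinity>" using ftw by (simp add: ennreal_mult_less_top)
    finally show ?thesis .
  qed
  have iH: "ift H t = ?h t" for t
    using fourier_inversion_ift[OF hc hi weight_integrable[OF s(1) ftm ftw]] unfolding H_def by simp
  have zero: "ift H x0 = 0" using iH[of x0] f0 by simp
  \<comment> \<open>the frequency side of the cutoff\<close>
  define T where "T u = ft ?\<tau> u / ?n" for u
  have \<tau>m[measurable]: "?\<tau> \<in> borel_measurable borel"
    using rapidly_smooth_continuous[OF \<tau>] by (rule borel_measurable_continuous_onI)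
  have ft\<tau>m: "ft ?\<tau> \<in> borel_measurable borel" by (rule ft_measurable) measurable
  obtain C1 where C1: "C1 > 0" "\<And>u. norm (ft ?\<tau> u) \<le> C1 * ker u"
    using ft_rapidly_smooth[OF \<tau>] by blast
  obtain C2 where C2: "C2 > 0" "\<And>u h. norm h \<le> 1 \<Longrightarrow> norm (ft ?\<tau> (u - h) - ft ?\<tau> u) \<le> C2 * norm h * ker u"
    using ft_rapidly_smooth_diff[OF \<tau>] by blast
  have ft\<tau>i: "integrable lborel (ft ?\<tau>)"
  proof (rule Bochner_Integration.integrable_bound)
    show "integrable lborel (\<lambda>u::'a. C1 * ker u)" using integrable_ker[where 'a='a] by simp
    show "AE u in lborel. norm (ft ?\<tau> u) \<le> norm (C1 * ker u)"
    proof (rule AE_I2)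
      fix u :: 'a
      show "norm (ft ?\<tau> u) \<le> norm (C1 * ker u)"
        using C1(2)[of u] by simp
    qed
  qed (use ft\<tau>m in simp)
  have Tm: "T \<in> borel_measurable borel" unfolding T_def using ft\<tau>m by measurable
  have Ti: "integrable lborel T" unfolding T_def using ft\<tau>i by simp
  have iT: "ift T u = ?\<tau> u" for u
    using fourier_inversion_ift[OF rapidly_smooth_continuous[OF \<tau>] rapidly_smooth_integrable[OF \<tau>] ft\<tau>i] unfolding T_def by simp
  define C where "C = (C1 + C2) / norm ?n"
  have n: "norm ?n > 0" by simp
  have C: "C > 0" unfolding C_def using C1(1) C2(1) n by (intro divide_pos_pos) auto
  have T1: "norm (T u) \<le> C * ker u" for u
  proof -
    have "C1 * ker u \<le> (C1 + C2) * ker u" using C2(1) by (intro mult_right_mono) auto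
    then have "norm (ft ?\<tau> u) / norm ?n \<le> (C1 + C2) * ker u / norm ?n"
      using C1(2)[of u] by (intro divide_right_mono) auto
    then show ?thesis unfolding T_def C_def norm_divide by (simp only: times_divide_eq_left)
  qed
  have T2: "norm (T (u - h) - T u) \<le> C * norm h * ker u" if "norm h \<le> 1" for u h
  proof -
    have "C2 * (norm h * ker u) \<le> (C1 + C2) * (norm h * ker u)" using C1(1) by (intro mult_right_mono) auto
    then have "norm (ft ?\<tau> (u - h) - ft ?\<tau> u) / norm ?n \<le> (C1 + C2) * (norm h * ker u) / norm ?n"
      using C2(2)[OF that, of u] by (intro divide_right_mono) (auto simp: mult.assoc)
    then show ?thesis unfolding T_def C_def diff_divide_distrib[symmetric] norm_divide
      by (simp only: times_divide_eq_left mult.assoc)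
  qed
  obtain K where K: "K < \<infinity>" "\<And>G. G \<in> borel_measurable borel \<Longrightarrow> integrable lborel G \<Longrightarrow>
    mnorm s (\<lambda>t. ift G t * ?\<beta> (t - x0)) \<le> K * (\<integral>\<^sup>+\<xi>. ennreal (weight s \<xi>) * ennreal (norm (G \<xi>)) \<partial>lborel)"
    using mnorm_ift_window[OF s(1) s1 \<beta>, of x0] by blast
  let ?W = "\<integral>\<^sup>+u. ennreal (weight s u) * ennreal (ker (u::'a)) \<partial>lborel"
  have W: "?W < \<infinity>" by (rule weight_ker_integral[OF s1])
  define q where "q j = (\<integral>\<^sup>+\<theta>. ennreal (norm (H \<theta>)) * ennreal (3 * C * (weight s \<theta> * min 1 ((inverse (real (Suc j)) * norm \<theta>) powr (1 - s)))) \<partial>lborel)" for j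
  have "(\<lambda>j. K * ?W * q j) \<longlonglongrightarrow> K * ?W * 0"
    unfolding q_def using K(1) W dilation_weight_tendsto_0[OF s Hm C H]
    by (intro ennreal_tendsto_cmult) (auto simp: ennreal_mult_less_top)
  then have "eventually (\<lambda>j. K * ?W * q j < min \<epsilon> 1) sequentially"
    using \<epsilon> by (intro order_tendstoD(2)) auto
  then obtain j where j: "K * ?W * q j < min \<epsilon> 1"
    by (auto simp: eventually_sequentially)
  \<comment> \<open>\<open>q j * ?W\<close> bounds the weighted size of the localised transform for the dilation \<open>1 / Suc j\<close>\<close>
  define l where "l = inverse (real (Suc j))"
  have l: "0 < l" "l \<le> 1" by (auto simp: l_def inverse_le_1_iff)
  obtain G where G: "G \<in> borel_measurable borel" and Gi: "integrable lborel G"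
    and Gle: "(\<integral>\<^sup>+\<xi>. ennreal (weight s \<xi>) * ennreal (norm (G \<xi>)) \<partial>lborel) \<le> q j * ?W"
    and Gift: "\<And>t. ift G t = ift T ((t - x0) /\<^sub>R l) * ift H t"
    using dilation_localises[OF s Tm Ti C T1 T2 Hm H zero l] unfolding q_def l_def by blast
  \<comment> \<open>where \<open>?\<tau> ((t - x0) /\<^sub>R l)\<close> is not 0, the squared distance of \<open>t\<close> to \<open>x0\<close> is less than 2, and \<open>?\<beta> (t - x0)\<close> is 1\<close>
  have eq: "(\<lambda>t. f t * ?\<tau> ((t - x0) /\<^sub>R l)) = (\<lambda>t. ift G t * ?\<beta> (t - x0))"
  proof
    fix t
    show "f t * ?\<tau> ((t - x0) /\<^sub>R l) = ift G t * ?\<beta> (t - x0)"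
    proof (cases "(norm (t - x0))\<^sup>2 \<le> 2")
      case True
      then have "?\<beta> (t - x0) = 1" by (rule cutoff_eq_1)
      then show ?thesis by (simp add: Gift iT iH)
    next
      case False
      have "norm (t - x0) \<le> norm ((t - x0) /\<^sub>R l)"
        using l mult_right_mono[of 1 "inverse l" "norm (t - x0)"] by (simp add: one_le_inverse)
      then have "(norm (t - x0))\<^sup>2 \<le> (norm ((t - x0) /\<^sub>R l))\<^sup>2" by (intro power_mono) auto
      then have "?\<tau> ((t - x0) /\<^sub>R l) = 0" using False by (intro cutoff_eq_0) linarith
      then show ?thesis by (simp add: Gift iT)
    qed
  qed
  have "mnorm s (\<lambda>t. f t * ?\<tau> ((t - x0) /\<^sub>R l)) \<le> K * (\<integral>\<^sup>+\<xi>. ennreal (weight s \<xi>) * ennreal (norm (G \<xi>)) \<partial>lborel)"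
    unfolding eq by (rule K(2)[OF G Gi])
  also have "\<dots> \<le> K * (q j * ?W)" by (intro mult_left_mono Gle) simp
  also have "\<dots> = K * ?W * q j" by (simp only: mult_ac)
  also have "\<dots> < min \<epsilon> 1" by (rule j)
  finally show ?thesis using l by (intro exI[of _ l]) auto
qed

end

section \<open>The modulation algebra\<close>

lemma japanese_bracket_bounds: "japanese_bracket \<xi> \<le> 1 + norm \<xi>" "1 + norm \<xi> \<le> 2 * japanese_bracket \<xi>"
proof -
  have "1 + (norm \<xi>)\<^sup>2 \<le> (1 + norm \<xi>)\<^sup>2"
    unfolding power2_sum by simp
  then show "japanese_bracket \<xi> \<le> 1 + norm \<xi>"
    unfolding japanese_bracket_def by (intro real_le_lsqrt) auto
  have "1 \<le> japanese_bracket \<xi>"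
    unfolding japanese_bracket_def by simp
  moreover have "norm \<xi> \<le> japanese_bracket \<xi>"
    unfolding japanese_bracket_def by (intro real_le_rsqrt) simp
  ultimately show "1 + norm \<xi> \<le> 2 * japanese_bracket \<xi>" by linarith
qed

text \<open>The supremum in the seminorm of order zero with exponent \<open>2 * DIM('a) + 1\<close> bounds \<open>\<psi>\<close> by a multiple
  of \<open>ker\<close>.\<close>

lemma integrable_bounded_times_schwartz:
  fixes f \<psi> :: "'a::euclidean_space \<Rightarrow> complex"
  assumes f: "continuous_on UNIV f" "\<And>t. norm (f t) \<le> B" and \<psi>: "\<psi> \<in> schwartz_space"
  shows "integrable lborel (\<lambda>t. f t * \<psi> t)"
    and "norm (\<integral>t. f t * \<psi> t \<partial>lborel) \<le> B * (\<integral>t. ker (t::'a) \<partial>lborel) * schwartz_seminorm (2 * DIM('a) + 1) 0 \<psi>"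
proof -
  let ?N = "2 * DIM('a) + 1"
  let ?p = "schwartz_seminorm ?N 0 \<psi>"
  have B: "0 \<le> B" using f(2)[of 0] norm_ge_zero[of "f 0"] by linarith
  have p: "?p = (SUP x. (1 + norm x) ^ ?N * norm (\<psi> x))"
  proof -
    have "{bs \<in> lists (Basis :: 'a set). length bs \<le> 0} = {[]}" by auto
    then show ?thesis by (simp add: schwartz_seminorm_def)
  qed
  have le: "norm (\<psi> t) \<le> ?p * ker t" for t
  proof (rule le_kerI)
    have "bdd_above (range (\<lambda>x. (1 + norm x) ^ ?N * norm (\<psi> x)))"
    proof -
      obtain A where A: "\<And>x. norm ((1 + norm x) ^ ?N *\<^sub>R \<psi> x) \<le> A"
        using schwartz_bounded[OF \<psi>, of ?N] by (auto simp: bounded_iff)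
      show ?thesis
      proof (rule bdd_aboveI2)
        fix x :: 'a
        have "0 \<le> (1 + norm x) ^ ?N" by (intro zero_le_power) simp
        then show "(1 + norm x) ^ ?N * norm (\<psi> x) \<le> A"
          using A[of x] by (simp only: norm_scaleR abs_of_nonneg)
      qed
    qed
    then show "(1 + norm t) ^ ?N * norm (\<psi> t) \<le> ?p"
      unfolding p by (rule cSUP_upper2[of _ _ t]) auto
  qed
  have m: "(\<lambda>t. f t * \<psi> t) \<in> borel_measurable lborel"
    using f(1) schwartz_continuous[OF \<psi>] by (auto intro!: borel_measurable_continuous_onI continuous_intros)
  have i: "integrable lborel (\<lambda>t::'a. B * (?p * ker t))"
    using integrable_ker[where 'a='a] by (intro integrable_mult_right) auto
  have le': "norm (f t * \<psi> t) \<le> B * (?p * ker t)" for t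
    unfolding norm_mult using f(2)[of t] le[of t] B by (intro mult_mono) auto
  show int: "integrable lborel (\<lambda>t. f t * \<psi> t)"
  proof (rule Bochner_Integration.integrable_bound[OF i m AE_I2])
    fix t show "norm (f t * \<psi> t) \<le> norm (B * (?p * ker t))"
      using le'[of t] by simp
  qed
  have "norm (\<integral>t. f t * \<psi> t \<partial>lborel) \<le> (\<integral>t. norm (f t * \<psi> t) \<partial>lborel)"
    by (rule integral_norm_bound)
  also have "\<dots> \<le> (\<integral>t. B * (?p * ker (t::'a)) \<partial>lborel)"
    using int i le' by (intro integral_mono integrable_norm)
  also have "\<dots> = B * (\<integral>t. ker (t::'a) \<partial>lborel) * ?p"
    unfolding integral_mult_right_zero by (simp only: mult_ac)
  finally show "norm (\<integral>t. f t * \<psi> t \<partial>lborel) \<le> B * (\<integral>t. ker (t::'a) \<partial>lborel) * ?p" .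
qed

lemma distribution_of_bounded_tempered:
  fixes f :: "'a::euclidean_space \<Rightarrow> complex"
  assumes f: "continuous_on UNIV f" "\<And>t. norm (f t) \<le> B"
  shows "distribution_of f \<in> tempered_distributions"
proof -
  note I = integrable_bounded_times_schwartz[OF f]
  have add: "(\<lambda>t. g t + h t) \<in> schwartz_space" if "g \<in> schwartz_space" "h \<in> schwartz_space" for g h :: "'a \<Rightarrow> complex"
    using schwartz_linear[OF that, of 1 1] by simp
  have scale: "(\<lambda>t. c * g t) \<in> schwartz_space" if "g \<in> schwartz_space" for c and g :: "'a \<Rightarrow> complex"
    using schwartz_linear[OF that that, of c 0] by simp
  show ?thesis
    unfolding tempered_distributions_def
  proof (intro CollectI conjI ballI allI)
    show "distribution_of f \<in> extensional schwartz_space"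
      unfolding distribution_of_def by simp
    fix g h :: "'a \<Rightarrow> complex" assume g: "g \<in> schwartz_space"
    show "distribution_of f (\<lambda>t. c * g t) = c * distribution_of f g" for c
    proof -
      have "(\<integral>t. f t * (c * g t) \<partial>lborel) = (\<integral>t. c * (f t * g t) \<partial>lborel)"
        by (intro Bochner_Integration.integral_cong) auto
      then show ?thesis unfolding distribution_of_def using g scale[OF g, of c] by simp
    qed
    assume h: "h \<in> schwartz_space"
    have "(\<integral>t. f t * (g t + h t) \<partial>lborel) = (\<integral>t. f t * g t + f t * h t \<partial>lborel)"
      by (intro Bochner_Integration.integral_cong) (auto simp: distrib_left)
    also have "\<dots> = (\<integral>t. f t * g t \<partial>lborel) + (\<integral>t. f t * h t \<partial>lborel)"
      by (intro Bochner_Integration.integral_add I g h)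
    finally show "distribution_of f (\<lambda>t. g t + h t) = distribution_of f g + distribution_of f h"
      unfolding distribution_of_def using g h add[OF g h] by simp
  next
    show "\<exists>C k m. \<forall>g\<in>schwartz_space. norm (distribution_of f g) \<le> C * schwartz_seminorm k m g"
      using I(2) unfolding distribution_of_def
      by (intro exI[of _ "B * (\<integral>t. ker (t::'a) \<partial>lborel)"] exI[of _ "2 * DIM('a) + 1"] exI[of _ 0] ballI) (simp only: restrict_apply')
  qed
qed

context window
begin

lemma stft_distribution_of: "stft \<phi> (distribution_of f) x \<xi> = gabor f x \<xi>"
  using schwartz_time_frequency_shift[OF schwartz, of x \<xi>]
  by (simp add: stft_def distribution_of_def gabor_def ft_def mult.assoc)

lemma modulation_algebra_norm_eq:
  "modulation_algebra_norm p s \<phi> f = (\<integral>\<^sup>+\<xi>. ennreal (japanese_bracket \<xi> powr s) * slice f \<xi> \<partial>lborel)"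
  unfolding modulation_algebra_norm_def modulation_norm_def stft_distribution_of slice_def Lp_norm_def
  by (simp add: ennreal_powr_ennreal)

lemma modulation_algebra_norm_le_mnorm:
  assumes "0 \<le> s"
  shows "modulation_algebra_norm p s \<phi> f \<le> mnorm s f"
  unfolding modulation_algebra_norm_eq mnorm_def
proof (intro nn_integral_mono mult_right_mono ennreal_leI)
  fix \<xi> :: 'a
  have "0 \<le> japanese_bracket \<xi>" by (simp add: japanese_bracket_def)
  then show "japanese_bracket \<xi> powr s \<le> weight s \<xi>"
    unfolding weight_def using assms japanese_bracket_bounds by (intro powr_mono2) auto
qed auto

lemma mnorm_le_modulation_algebra_norm:
  assumes s: "0 \<le> s" "s \<le> 1" and f: "admissible f"
  shows "mnorm s f \<le> 2 * modulation_algebra_norm p s \<phi> f"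
proof -
  note [measurable] = slice_measurable[OF f]
  have [measurable]: "(\<lambda>\<xi>::'a. japanese_bracket \<xi> powr s) \<in> borel_measurable borel"
  proof -
    have "sqrt (1 + (norm \<xi>)\<^sup>2) \<noteq> 0" for \<xi> :: 'a
      using sum_power2_gt_zero_iff[of 1 "norm \<xi>"] by simp
    then show ?thesis unfolding japanese_bracket_def
      by (intro borel_measurable_continuous_onI continuous_intros) auto
  qed
  have "mnorm s f \<le> (\<integral>\<^sup>+\<xi>. 2 * (ennreal (japanese_bracket \<xi> powr s) * slice f \<xi>) \<partial>lborel)"
    unfolding mnorm_def
  proof (intro nn_integral_mono)
    fix \<xi> :: 'a
    have "weight s \<xi> \<le> (2 * japanese_bracket \<xi>) powr s"
      unfolding weight_def using s japanese_bracket_bounds by (intro powr_mono2) auto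
    also have "\<dots> = 2 powr s * japanese_bracket \<xi> powr s"
      by (rule powr_mult) 
    also have "\<dots> \<le> 2 powr 1 * japanese_bracket \<xi> powr s"
      using s by (intro mult_right_mono powr_mono) auto
    finally have "ennreal (weight s \<xi>) \<le> ennreal (2 * japanese_bracket \<xi> powr s)"
      by (intro ennreal_leI) simp
    also have "\<dots> = 2 * ennreal (japanese_bracket \<xi> powr s)"
      by (simp add: ennreal_mult)
    finally have "ennreal (weight s \<xi>) * slice f \<xi> \<le> 2 * ennreal (japanese_bracket \<xi> powr s) * slice f \<xi>"
      by (rule mult_right_mono) simp
    then show "ennreal (weight s \<xi>) * slice f \<xi> \<le> 2 * (ennreal (japanese_bracket \<xi> powr s) * slice f \<xi>)"
      by (simp only: mult.assoc)
  qed
  also have "\<dots> = 2 * modulation_algebra_norm p s \<phi> f"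
    unfolding modulation_algebra_norm_eq by (rule nn_integral_cmult) measurable
  finally show ?thesis .
qed

text \<open>For bounded continuous functions, the conditions on test functions and distributions are automatic and
  only the norm matters. The converse is \<open>modulation_algebraD\<close>.\<close>

lemma modulation_algebraI:
  assumes "0 \<le> s" "continuous_on UNIV f" "\<And>t. norm (f t) \<le> B" "mnorm s f < \<infinity>"
  shows "f \<in> modulation_algebra p s \<phi>"
proof -
  have "modulation_norm p s \<phi> (distribution_of f) < \<infinity>"
    using le_less_trans[OF modulation_algebra_norm_le_mnorm[OF assms(1)] assms(4)]
    by (simp add: modulation_algebra_norm_def)
  then show ?thesis
    using assms(2) integrable_bounded_times_schwartz(1)[OF assms(2,3)] distribution_of_bounded_tempered[OF assms(2,3)]
    by (auto simp: modulation_algebra_def modulation_space_def)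
qed

lemma modulation_algebraD:
  assumes s: "0 \<le> s" "s \<le> 1" and f: "f \<in> modulation_algebra p s \<phi>"
  shows "continuous_on UNIV f" "admissible f" "mnorm s f < \<infinity>" "\<exists>B. \<forall>t. norm (f t) \<le> B"
proof -
  show c: "continuous_on UNIV f" using f by (simp add: modulation_algebra_def)
  have "integrable lborel (\<lambda>t. f t * cnj (\<phi> (t - x)))" for x
    using f schwartz_time_frequency_shift[OF schwartz, of x 0] by (auto simp: modulation_algebra_def)
  with c show a: "admissible f" by (simp add: admissible_def)
  have "modulation_algebra_norm p s \<phi> f < \<infinity>"
    using f by (simp add: modulation_algebra_def modulation_space_def modulation_algebra_norm_def)
  then have "2 * modulation_algebra_norm p s \<phi> f < \<infinity>"
    by (simp add: ennreal_mult_less_top)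
  with mnorm_le_modulation_algebra_norm[OF s a] show m: "mnorm s f < \<infinity>"
    by (rule le_less_trans)
  show "\<exists>B. \<forall>t. norm (f t) \<le> B"
    by (rule bounded_if_mnorm_finite[OF a s(1) m])
qed

lemma gabor_linear:
  assumes "admissible f" "admissible g"
  shows "gabor (\<lambda>t. a * f t + c * g t) x \<xi> = a * gabor f x \<xi> + c * gabor g x \<xi>"
proof -
  have i: "integrable lborel (\<lambda>t. f t * cnj (\<phi> (t - x)) * cis (- (t \<bullet> \<xi>)))"
    "integrable lborel (\<lambda>t. g t * cnj (\<phi> (t - x)) * cis (- (t \<bullet> \<xi>)))"
    using assms by (auto simp: admissible_def intro!: integrable_mult_cis)
  have "gabor (\<lambda>t. a * f t + c * g t) x \<xi> =
    (\<integral>t. a * (f t * cnj (\<phi> (t - x)) * cis (- (t \<bullet> \<xi>))) + c * (g t * cnj (\<phi> (t - x)) * cis (- (t \<bullet> \<xi>))) \<partial>lborel)"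
    unfolding gabor_def ft_def by (intro Bochner_Integration.integral_cong) (auto simp: algebra_simps)
  also have "\<dots> = a * gabor f x \<xi> + c * gabor g x \<xi>"
    unfolding gabor_def ft_def by (subst Bochner_Integration.integral_add) (use i in auto)
  finally show ?thesis .
qed

lemma mnorm_linear_finite:
  assumes f: "admissible f" "mnorm s f < \<infinity>" and g: "admissible g" "mnorm s g < \<infinity>"
  shows "mnorm s (\<lambda>t. a * f t + c * g t) < \<infinity>"
proof -
  note [measurable] = gabor_measurable[OF f(1)] gabor_measurable[OF g(1)] slice_measurable[OF f(1)] slice_measurable[OF g(1)]
  have "slice (\<lambda>t. a * f t + c * g t) \<xi> \<le> ennreal (norm a) * slice f \<xi> + ennreal (norm c) * slice g \<xi>" for \<xi>
  proof -
    have "slice (\<lambda>t. a * f t + c * g t) \<xi>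
      \<le> Lp_norm p (\<lambda>x. ennreal (norm a) * ennreal (norm (gabor f x \<xi>)) + ennreal (norm c) * ennreal (norm (gabor g x \<xi>)))"
      unfolding slice_def
    proof (rule Lp_norm_mono[OF _ p_pos])
      fix x
      have "norm (gabor (\<lambda>t. a * f t + c * g t) x \<xi>) \<le> norm a * norm (gabor f x \<xi>) + norm c * norm (gabor g x \<xi>)"
        unfolding gabor_linear[OF f(1) g(1)] by (metis norm_mult norm_triangle_ineq)
      then have "ennreal (norm (gabor (\<lambda>t. a * f t + c * g t) x \<xi>)) \<le> ennreal (norm a * norm (gabor f x \<xi>) + norm c * norm (gabor g x \<xi>))"
        by (rule ennreal_leI)
      then show "ennreal (norm (gabor (\<lambda>t. a * f t + c * g t) x \<xi>)) \<le> ennreal (norm a) * ennreal (norm (gabor f x \<xi>)) + ennreal (norm c) * ennreal (norm (gabor g x \<xi>))"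
        by (simp add: ennreal_mult)
    qed
    also have "\<dots> \<le> Lp_norm p (\<lambda>x. ennreal (norm a) * ennreal (norm (gabor f x \<xi>))) + Lp_norm p (\<lambda>x. ennreal (norm c) * ennreal (norm (gabor g x \<xi>)))"
      by (rule Lp_norm_triangle[OF p]) measurable
    also have "\<dots> = ennreal (norm a) * slice f \<xi> + ennreal (norm c) * slice g \<xi>"
      unfolding slice_def using p_pos by (intro arg_cong2[where f = "(+)"] Lp_norm_cmult) auto
    finally show ?thesis .
  qed
  then have "mnorm s (\<lambda>t. a * f t + c * g t) \<le> (\<integral>\<^sup>+\<xi>. ennreal (weight s \<xi>) * (ennreal (norm a) * slice f \<xi> + ennreal (norm c) * slice g \<xi>) \<partial>lborel)"
    unfolding mnorm_def by (intro nn_integral_mono mult_left_mono) auto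
  also have "\<dots> = (\<integral>\<^sup>+\<xi>. ennreal (norm a) * (ennreal (weight s \<xi>) * slice f \<xi>) + ennreal (norm c) * (ennreal (weight s \<xi>) * slice g \<xi>) \<partial>lborel)"
    by (simp only: distrib_left mult.left_commute)
  also have "\<dots> = ennreal (norm a) * mnorm s f + ennreal (norm c) * mnorm s g"
    unfolding mnorm_def by (subst nn_integral_add) (auto simp: nn_integral_cmult)
  also have "\<dots> < \<infinity>" using f(2) g(2) by (simp add: ennreal_mult_less_top)
  finally show ?thesis .
qed

lemma modulation_algebra_linear:
  assumes s: "0 \<le> s" "s \<le> 1" and f: "f \<in> modulation_algebra p s \<phi>" and g: "g \<in> modulation_algebra p s \<phi>"
  shows "(\<lambda>t. a * f t + c * g t) \<in> modulation_algebra p s \<phi>"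
proof -
  note F = modulation_algebraD[OF s f] and G = modulation_algebraD[OF s g]
  obtain A B where A: "\<And>t. norm (f t) \<le> A" and B: "\<And>t. norm (g t) \<le> B"
    using F(4) G(4) by blast
  show ?thesis
  proof (rule modulation_algebraI[OF s(1) _ _ mnorm_linear_finite[OF F(2,3) G(2,3)]])
    show "continuous_on UNIV (\<lambda>t. a * f t + c * g t)" using F(1) G(1) by (intro continuous_intros)
    show "norm (a * f t + c * g t) \<le> norm a * A + norm c * B" for t
      using A[of t] B[of t] by (intro norm_triangle_mono) (auto simp: norm_mult intro!: mult_left_mono)
  qed
qed

lemma modulation_algebra_mult:
  assumes s: "0 \<le> s" "s \<le> 1" and f: "f \<in> modulation_algebra p s \<phi>" and g: "g \<in> modulation_algebra p s \<phi>"
  shows "(\<lambda>t. f t * g t) \<in> modulation_algebra p s \<phi>"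
proof -
  note F = modulation_algebraD[OF s f] and G = modulation_algebraD[OF s g]
  obtain A B where A: "\<And>t. norm (f t) \<le> A" and B: "\<And>t. norm (g t) \<le> B"
    using F(4) G(4) by blast
  have A0: "0 \<le> A" using order_trans[OF norm_ge_zero A] .
  show ?thesis
  proof (rule modulation_algebraI[OF s(1) _ _ mnorm_mult_finite[OF s F(2,3) G(2,3)]])
    show "continuous_on UNIV (\<lambda>t. f t * g t)" using F(1) G(1) by (intro continuous_intros)
    show "norm (f t * g t) \<le> A * B" for t
      unfolding norm_mult using A[of t] B[of t] A0 by (intro mult_mono) auto
  qed
qed

lemma zero_in_modulation_algebra:
  assumes "0 \<le> s"
  shows "(\<lambda>_. 0) \<in> modulation_algebra p s \<phi>"
proof (rule modulation_algebraI[OF assms, of _ 0])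
  have "gabor (\<lambda>_. 0) x \<xi> = 0" for x \<xi> by (simp add: gabor_def ft_def)
  then show "mnorm s (\<lambda>_. 0) < \<infinity>"
    by (simp add: mnorm_def slice_def Lp_norm_def ennreal_powr_ennreal)
qed auto

section \<open>Spectral synthesis\<close>

lemma point_evaluation_bounded:
  assumes s: "0 \<le> s" "s \<le> 1"
  shows "\<exists>C>0. \<forall>f\<in>modulation_algebra p s \<phi>. \<forall>t. ennreal (norm (f t)) \<le> ennreal C * modulation_algebra_norm p s \<phi> f"
proof -
  obtain C where C: "0 < C" "\<And>(f :: 'a \<Rightarrow> complex) t. admissible f \<Longrightarrow> ennreal (norm (f t)) \<le> ennreal C * (\<integral>\<^sup>+\<eta>. slice f \<eta> \<partial>lborel)"
    using sup_bound by blast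
  have "ennreal (norm (f t)) \<le> ennreal (C * 2) * modulation_algebra_norm p s \<phi> f" if f: "f \<in> modulation_algebra p s \<phi>" for f t
  proof -
    note F = modulation_algebraD[OF s f]
    have "ennreal (norm (f t)) \<le> ennreal C * (\<integral>\<^sup>+\<eta>. slice f \<eta> \<partial>lborel)" by (rule C(2)[OF F(2)])
    also have "\<dots> \<le> ennreal C * mnorm s f" by (intro mult_left_mono slice_le_mnorm s) auto
    also have "\<dots> \<le> ennreal C * (2 * modulation_algebra_norm p s \<phi> f)"
      by (intro mult_left_mono mnorm_le_modulation_algebra_norm s F(2)) auto
    also have "\<dots> = ennreal (C * 2) * modulation_algebra_norm p s \<phi> f"
      using C(1) by (simp add: ennreal_mult mult.assoc)
    finally show ?thesis .
  qed
  then show ?thesis using C(1) by (intro exI[of _ "C * 2"]) auto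
qed

lemma vanishing_ideal_closed:
  assumes s: "0 \<le> s" "s \<le> 1"
  shows "closed_function_ideal (modulation_algebra p s \<phi>) (modulation_algebra_norm p s \<phi>)
    (vanishing_ideal (modulation_algebra p s \<phi>) {x0})"
proof -
  let ?X = "modulation_algebra p s \<phi>" and ?N = "modulation_algebra_norm p s \<phi>"
  let ?I = "vanishing_ideal ?X {x0}"
  have "function_ideal ?X ?I"
    unfolding function_ideal_def
  proof (intro conjI ballI allI)
    show "?I \<subseteq> ?X" by (auto simp: vanishing_ideal_def)
    show "(\<lambda>_. 0) \<in> ?I" using zero_in_modulation_algebra[OF s(1)] by (simp add: vanishing_ideal_def)
    show "(\<lambda>x. f x + g x) \<in> ?I" if "f \<in> ?I" "g \<in> ?I" for f g
      using that modulation_algebra_linear[OF s, of f g 1 1] by (simp add: vanishing_ideal_def)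
    show "(\<lambda>x. c * f x) \<in> ?I" if "f \<in> ?I" for c f
      using that modulation_algebra_linear[OF s, of f f c 0] by (simp add: vanishing_ideal_def)
    show "(\<lambda>x. f x * g x) \<in> ?I" if "f \<in> ?X" "g \<in> ?I" for f g
      using that modulation_algebra_mult[OF s, of f g] by (simp add: vanishing_ideal_def)
  qed
  moreover have "norm_closed_in ?X ?N ?I"
    unfolding norm_closed_in_def
  proof (intro conjI ballI impI)
    show "?I \<subseteq> ?X" by (auto simp: vanishing_ideal_def)
    fix f assume f: "f \<in> ?X" and approx: "\<forall>\<epsilon>>0. \<exists>g\<in>?I. ?N (\<lambda>x. f x - g x) < \<epsilon>"
    obtain C where C: "0 < C" "\<And>f t. f \<in> ?X \<Longrightarrow> ennreal (norm (f t)) \<le> ennreal C * ?N f"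
      using point_evaluation_bounded[OF s] by blast
    have "f x0 = 0"
    proof (rule ccontr)
      assume nz: "f x0 \<noteq> 0"
      then have "0 < ennreal (norm (f x0) / C)" using C(1) by simp
      with approx obtain g where g: "g \<in> ?I" "?N (\<lambda>x. f x - g x) < ennreal (norm (f x0) / C)" by blast
      have gX: "g \<in> ?X" "g x0 = 0" using g(1) by (auto simp: vanishing_ideal_def)
      have "(\<lambda>x. f x - g x) \<in> ?X"
        using modulation_algebra_linear[OF s f gX(1), of 1 "- 1"] by simp
      from C(2)[OF this, of x0] have "ennreal (norm (f x0)) \<le> ennreal C * ?N (\<lambda>x. f x - g x)"
        using gX(2) by simp
      also have "\<dots> < ennreal C * ennreal (norm (f x0) / C)"
        using g(2) C(1) by (intro ennreal_mult_strict_left_mono) auto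
      also have "\<dots> = ennreal (norm (f x0))"
        using C(1) by (simp add: ennreal_mult[symmetric])
      finally show False by simp
    qed
    then show "f \<in> ?I" using f by (simp add: vanishing_ideal_def)
  qed
  ultimately show ?thesis by (simp add: closed_function_ideal_def)
qed

text \<open>Remove from \<open>f\<close> its localisation to a small ball around the point.\<close>

lemma vanishing_at_point_approximable:
  assumes s: "0 \<le> s" "s < 1" and f: "f \<in> modulation_algebra p s \<phi>" and f0: "f x0 = 0" and \<epsilon>: "0 < \<epsilon>"
  shows "\<exists>g\<in>locally_vanishing (modulation_algebra p s \<phi>) {x0}. modulation_algebra_norm p s \<phi> (\<lambda>x. f x - g x) < \<epsilon>"
proof -
  let ?X = "modulation_algebra p s \<phi>"
  have s1: "s \<le> 1" using s by simp
  note F = modulation_algebraD[OF s(1) s1 f]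
  obtain B where B: "\<And>t. norm (f t) \<le> B" using F(4) by blast
  have B0: "0 \<le> B" using order_trans[OF norm_ge_zero B] .
  have "0 < min \<epsilon> 1" using \<epsilon> by simp
  from localisation_small[OF s F(2,3) f0 this] obtain l
    where l: "0 < l" "mnorm s (\<lambda>t. f t * cutoff 1 ((t - x0) /\<^sub>R l)) < min \<epsilon> 1"
    by blast
  let ?h = "\<lambda>t. f t * cutoff 1 ((t - x0) /\<^sub>R l)"
  obtain A where A: "\<And>t::'a. norm (cutoff 1 t) \<le> A"
    using rapidly_smooth_bounded[OF rapidly_smooth_cutoff] by blast
  have h: "?h \<in> ?X"
  proof (rule modulation_algebraI[OF s(1)])
    show "continuous_on UNIV ?h"
      by (intro continuous_on_mult F(1) continuous_on_compose2[OF rapidly_smooth_continuous[OF rapidly_smooth_cutoff[of 1]]])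
         (auto intro!: continuous_intros)
    show "norm (?h t) \<le> B * A" for t
      unfolding norm_mult using A[of "(t - x0) /\<^sub>R l"] B[of t] B0 by (intro mult_mono) auto
    have "mnorm s ?h < 1" using l(2) by simp
    then show "mnorm s ?h < \<infinity>" by (auto intro: less_trans)
  qed
  let ?g = "\<lambda>t. f t - ?h t"
  have "?g \<in> ?X"
    using modulation_algebra_linear[OF s(1) s1 f h, of 1 "- 1"] by simp
  moreover have "?g t = 0" if "t \<in> ball x0 l" for t
  proof -
    have "norm ((t - x0) /\<^sub>R l) \<le> 1"
    proof -
      have "norm (t - x0) \<le> l" using that by (simp add: dist_norm norm_minus_commute)
      moreover have "norm ((t - x0) /\<^sub>R l) = norm (t - x0) / l"
        using l(1) by (simp add: divide_inverse mult.commute)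
      ultimately show ?thesis using l(1) by simp
    qed
    then have "(norm ((t - x0) /\<^sub>R l))\<^sup>2 \<le> 1"
      by (simp add: power_le_one)
    then have "cutoff 1 ((t - x0) /\<^sub>R l) = 1" by (rule cutoff_eq_1)
    then show ?thesis by simp
  qed
  ultimately have "?g \<in> locally_vanishing ?X {x0}"
    unfolding locally_vanishing_def using l(1) by (intro CollectI conjI exI[of _ "ball x0 l"]) auto
  moreover have "modulation_algebra_norm p s \<phi> (\<lambda>x. f x - ?g x) < \<epsilon>"
  proof -
    have "(\<lambda>x. f x - ?g x) = ?h" by auto
    then show ?thesis using modulation_algebra_norm_le_mnorm[OF s(1), of ?h] l(2) by (simp add: le_less_trans)
  qed
  ultimately show ?thesis by (rule bexI[where x = ?g, rotated])
qed

text \<open>The vanishing ideal is one of the closed ideals in the intersection that defines the generated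
  ideal, and by approximation it is contained in all of them.\<close>

lemma spectral_synthesis_point:
  assumes s: "0 \<le> s" "s < 1"
  shows "spectral_synthesis_set (modulation_algebra p s \<phi>) (modulation_algebra_norm p s \<phi>) {x0}"
proof -
  let ?X = "modulation_algebra p s \<phi>" and ?N = "modulation_algebra_norm p s \<phi>"
  have "closed_ideal_generated ?X ?N (locally_vanishing ?X {x0}) \<subseteq> vanishing_ideal ?X {x0}"
  proof -
    have "locally_vanishing ?X {x0} \<subseteq> vanishing_ideal ?X {x0}"
      by (auto simp: locally_vanishing_def vanishing_ideal_def)
    moreover have "closed_function_ideal ?X ?N (vanishing_ideal ?X {x0})"
      using s by (intro vanishing_ideal_closed) auto
    ultimately show ?thesis unfolding closed_ideal_generated_def by blast
  qed
  moreover have "vanishing_ideal ?X {x0} \<subseteq> closed_ideal_generated ?X ?N (locally_vanishing ?X {x0})"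
    unfolding closed_ideal_generated_def
  proof (intro subsetI InterI)
    fix f K assume f: "f \<in> vanishing_ideal ?X {x0}"
      and "K \<in> {K. closed_function_ideal ?X ?N K \<and> locally_vanishing ?X {x0} \<subseteq> K}"
    then have K: "norm_closed_in ?X ?N K" "locally_vanishing ?X {x0} \<subseteq> K"
      by (auto simp: closed_function_ideal_def)
    have "f \<in> ?X" "f x0 = 0" using f by (auto simp: vanishing_ideal_def)
    then have "\<forall>\<epsilon>>0. \<exists>g\<in>K. ?N (\<lambda>x. f x - g x) < \<epsilon>"
      using vanishing_at_point_approximable[OF s] K(2) by blast
    then show "f \<in> K" using K(1) \<open>f \<in> ?X\<close> by (simp add: norm_closed_in_def)
  qed
  ultimately show ?thesis by (simp add: spectral_synthesis_set_def subset_antisym)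
qed

end

theorem theorem7p1:
  fixes p s :: real and x\<^sub>0 :: "real ^ 'n" and \<phi> :: "real ^ 'n \<Rightarrow> complex"
  assumes "1 \<le> p" and "0 \<le> s" and "s < 1"
    and "\<phi> \<in> schwartz_space" and "\<phi> \<noteq> (\<lambda>_. 0)"
  shows "spectral_synthesis_set (modulation_algebra p s \<phi>) (modulation_algebra_norm p s \<phi>) {x\<^sub>0}"
proof -
  interpret window \<phi> p
    using assms(4,5,1) by unfold_locales
  show ?thesis
    using assms(2,3) by (rule spectral_synthesis_point)
qed

end
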